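(* Let $\mathbb{F}$ be a field and let $B$ be a non-constant Blaschke product with Property $\mathfrak{B}$. Let $\{\omega_j\}_j$ be an enumeration of the distinct points of $\mathcal{Z}(B')\setminus\mathcal{Z}(B)$, and for each $j$ let $m_j$ be the order of $\omega_j$ as a critical point, i.e. $B^{(k)}(\omega_j)=0$ for $k=1,\ldots,m_j$ and $B^{(m_j+1)}(\omega_j)\neq 0$. Put $s_j=\ln\frac{1+|B(\omega_j)|}{1-|B(\omega_j)|}$. Then the persistence module $\mathbb{B}$ induced by $B$ decomposes into interval modules: $$\mathbb{B}\cong\mathbb{F}(0,+\infty)\oplus\Big(\bigoplus_{j}(\mathbb{F}(0,s_j])^{m_j}\Big).$$
   Context: $\mathbb{D}$ is the open unit disk in $\mathbb{C}$. An inner function is a bounded analytic function on $\mathbb{D}$ with unimodular radial limits almost everywhere on $\partial\mathbb{D}$. A Blaschke product is an inner function $B(z)=\lambda z^m\prod_n\frac{|\alpha_n|}{\alpha_n}\frac{\alpha_n-z}{1-\overline{\alpha_n}z}$ with $|\lambda|=1$, $m\ge 0$ an integer, $\{\alpha_n\}$ a finite or infinite sequence in $\mathbb{D}\setminus\{0\}$ with $\sum_n(1-|\alpha_n|)<\infty$. $\mathcal{Z}(f)$ denotes the set of zeros of $f$ in $\mathbb{D}$. For an inner function $u$ and $\theta\in(0,1)$ put $\Omega_{u,\theta}=\{z\in\mathbb{D}: |u(z)|<\theta\}$. Property $\mathfrak{B}$ of $u$: for every $\theta\in(0,1)$, the closure of each connected component of $\Omega_{u,\theta}$ is contained in $\mathbb{D}$.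 Persistence module (over a field $\mathbb{F}$): a family of $\mathbb{F}$-vector spaces $\{V_t\}_{t\in\mathbb{R}}$ (possibly infinite-dimensional) with linear maps $\pi_{s,t}:V_s\to V_t$ for $s\le t$, such that $\pi_{s,r}=\pi_{t,r}\circ\pi_{s,t}$ for $s\le t\le r$, $\pi_{t,t}=\mathrm{id}$, and $V_s=0$ for all sufficiently small $s$. A morphism is a family of linear maps $V_t\to V'_t$ commuting with the structure maps; isomorphism $\cong$ and direct sums are defined accordingly (pointwise). The interval module $\mathbb{F}(a,b]$ (resp. $\mathbb{F}(a,+\infty)$) is $\mathbb{F}$ for $t$ in the interval and $0$ otherwise, with structure map the identity when $s,t$ are both in the interval and $0$ otherwise; $(\cdot)^{m}$ denotes the direct sum of $m$ copies. Persistence module induced by an inner function $u$: for $t\in(0,+\infty)$ let $\theta(t)=\frac{e^t-1}{e^t+1}$ (so $t=\ln\frac{1+\theta}{1-\theta}$) and $\Sigma_{u,t}=\Omega_{u,\theta(t)}$. Set $V_t=H_0(\Sigma_{u,t};\mathbb{F})$ for $t>0$ (all higher homology vanishes), $V_t=0$ for $t\le 0$, with $\pi_{s,t}$ induced by the inclusion $\Sigma_{u,s}\hookrightarrow\Sigma_{u,t}$ for $0<s\le t$. *)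

theory Defs
  imports "HOL-Analysis.Analysis" "HOL-Homology.Homology"
begin

section \<open>Linear algebra over a field\<close>

definition linear_maps ::
    "('f, 'r) ring_scheme \<Rightarrow> ('f, 'v, 'm) module_scheme \<Rightarrow> ('f, 'w, 'n) module_scheme \<Rightarrow> ('v \<Rightarrow> 'w) set"
  where "linear_maps F M N =
    {f \<in> carrier M \<rightarrow> carrier N.
       (\<forall>x\<in>carrier M. \<forall>y\<in>carrier M. f (x \<oplus>\<^bsub>M\<^esub> y) = f x \<oplus>\<^bsub>N\<^esub> f y) \<and>
       (\<forall>a\<in>carrier F. \<forall>x\<in>carrier M. f (a \<odot>\<^bsub>M\<^esub> x) = a \<odot>\<^bsub>N\<^esub> f x)}"

text \<open>The record type \<open>module\<close> extends \<open>ring\<close>; the locale \<open>module\<close> puts no condition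
  on the fields \<open>mult\<close> and \<open>one\<close>, which are left undefined below.\<close>

definition zero_module :: "'v \<Rightarrow> ('f, 'v) module"
  where "zero_module z =
    \<lparr>carrier = {z}, mult = undefined, one = undefined, zero = z,
     add = (\<lambda>_ _. z), smult = (\<lambda>_ _. z)\<rparr>"

definition line_module :: "('f, 'r) ring_scheme \<Rightarrow> ('f, 'f) module"
  where "line_module F =
    \<lparr>carrier = carrier F, mult = undefined, one = undefined, zero = \<zero>\<^bsub>F\<^esub>,
     add = add F, smult = mult F\<rparr>"

definition quotient_module :: "('f, 'v, 'm) module_scheme \<Rightarrow> 'v set \<Rightarrow> ('f, 'v set) module"
  where "quotient_module M N =
    \<lparr>carrier = a_rcosets\<^bsub>M\<^esub> N, mult = undefined, one = undefined, zero = N,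
     add = set_add M, smult = (\<lambda>a S. N <+>\<^bsub>M\<^esub> (\<lambda>x. a \<odot>\<^bsub>M\<^esub> x) ` S)\<rparr>"

definition prod_module ::
    "('f, 'v, 'm) module_scheme \<Rightarrow> ('f, 'w, 'n) module_scheme \<Rightarrow> ('f, 'v \<times> 'w) module"
  where "prod_module M N =
    \<lparr>carrier = carrier M \<times> carrier N, mult = undefined, one = undefined,
     zero = (\<zero>\<^bsub>M\<^esub>, \<zero>\<^bsub>N\<^esub>),
     add = (\<lambda>(x, y) (x', y'). (x \<oplus>\<^bsub>M\<^esub> x', y \<oplus>\<^bsub>N\<^esub> y')),
     smult = (\<lambda>a (x, y). (a \<odot>\<^bsub>M\<^esub> x, a \<odot>\<^bsub>N\<^esub> y))\<rparr>"

definition dsum_module :: "'i set \<Rightarrow> ('i \<Rightarrow> ('f, 'v, 'm) module_scheme) \<Rightarrow> ('f, 'i \<Rightarrow> 'v) module"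
  where "dsum_module I M =
    \<lparr>carrier = {x \<in> \<Pi>\<^sub>E i\<in>I. carrier (M i). finite {i\<in>I. x i \<noteq> \<zero>\<^bsub>M i\<^esub>}},
     mult = undefined, one = undefined,
     zero = (\<lambda>i\<in>I. \<zero>\<^bsub>M i\<^esub>),
     add = (\<lambda>x y. \<lambda>i\<in>I. x i \<oplus>\<^bsub>M i\<^esub> y i),
     smult = (\<lambda>a x. \<lambda>i\<in>I. a \<odot>\<^bsub>M i\<^esub> x i)\<rparr>"


section \<open>Persistence modules\<close>

record ('f, 'v) persistence =
  space_at :: "real \<Rightarrow> ('f, 'v) module"
  map_at :: "real \<Rightarrow> real \<Rightarrow> 'v \<Rightarrow> 'v"

locale persistence_module = field F
  for F :: "('f, 'r) ring_scheme" and V :: "('f, 'v) persistence" +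
  assumes module_at: "module F (space_at V t)"
    and map_linear: "s \<le> t \<Longrightarrow> map_at V s t \<in> linear_maps F (space_at V s) (space_at V t)"
    and map_comp: "\<lbrakk>s \<le> t; t \<le> r; x \<in> carrier (space_at V s)\<rbrakk>
      \<Longrightarrow> map_at V s r x = map_at V t r (map_at V s t x)"
    and map_refl: "x \<in> carrier (space_at V t) \<Longrightarrow> map_at V t t x = x"
    and bounded_below: "\<exists>t0. \<forall>t\<le>t0. carrier (space_at V t) = {\<zero>\<^bsub>space_at V t\<^esub>}"

definition persistence_morphism ::
    "('f, 'r) ring_scheme \<Rightarrow> ('f, 'v) persistence \<Rightarrow> ('f, 'w) persistence \<Rightarrow> (real \<Rightarrow> 'v \<Rightarrow> 'w) \<Rightarrow> bool"
  where "persistence_morphism F V W \<phi> \<longleftrightarrow>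
    (\<forall>t. \<phi> t \<in> linear_maps F (space_at V t) (space_at W t)) \<and>
    (\<forall>s t. s \<le> t \<longrightarrow>
      (\<forall>x\<in>carrier (space_at V s). \<phi> t (map_at V s t x) = map_at W s t (\<phi> s x)))"

definition persistence_isomorphic ::
    "('f, 'r) ring_scheme \<Rightarrow> ('f, 'v) persistence \<Rightarrow> ('f, 'w) persistence \<Rightarrow> bool"
  where "persistence_isomorphic F V W \<longleftrightarrow>
    persistence_module F V \<and> persistence_module F W \<and>
    (\<exists>\<phi>. persistence_morphism F V W \<phi> \<and>
      (\<forall>t. bij_betw (\<phi> t) (carrier (space_at V t)) (carrier (space_at W t))))"

definition interval_persistence :: "('f, 'r) ring_scheme \<Rightarrow> real set \<Rightarrow> ('f, 'f) persistence"
  where "interval_persistence F I =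
    \<lparr>space_at = (\<lambda>t. if t \<in> I then line_module F else zero_module \<zero>\<^bsub>F\<^esub>),
     map_at = (\<lambda>s t x. if s \<in> I \<and> t \<in> I then x else \<zero>\<^bsub>F\<^esub>)\<rparr>"

definition persistence_sum ::
    "('f, 'v) persistence \<Rightarrow> ('f, 'w) persistence \<Rightarrow> ('f, 'v \<times> 'w) persistence"
  where "persistence_sum V W =
    \<lparr>space_at = (\<lambda>t. prod_module (space_at V t) (space_at W t)),
     map_at = (\<lambda>s t. map_prod (map_at V s t) (map_at W s t))\<rparr>"

definition persistence_dsum :: "'i set \<Rightarrow> ('i \<Rightarrow> ('f, 'v) persistence) \<Rightarrow> ('f, 'i \<Rightarrow> 'v) persistence"
  where "persistence_dsum I V =
    \<lparr>space_at = (\<lambda>t. dsum_module I (\<lambda>i. space_at (V i) t)),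
     map_at = (\<lambda>s t x. \<lambda>i\<in>I. map_at (V i) s t (x i))\<rparr>"

definition persistence_power :: "nat \<Rightarrow> ('f, 'v) persistence \<Rightarrow> ('f, nat \<Rightarrow> 'v) persistence"
  where "persistence_power m V = persistence_dsum {..<m} (\<lambda>_. V)"


section \<open>Singular homology with coefficients in a field\<close>

text \<open>The homology groups of \<open>HOL-Homology\<close> have integer coefficients. Here a \<open>p\<close>-chain with
  coefficients in \<open>F\<close> is a finitely supported \<open>F\<close>-valued function on the singular \<open>p\<close>-simplices
  of \<^term>\<open>X\<close>.\<close>

type_synonym ('a, 'f) coeff_chain = "((nat \<Rightarrow> real) \<Rightarrow> 'a) \<Rightarrow> 'f"

definition chain_module ::
    "('f, 'r) ring_scheme \<Rightarrow> nat \<Rightarrow> 'a topology \<Rightarrow> ('f, ('a, 'f) coeff_chain) module"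
  where "chain_module F p X =
    \<lparr>carrier = {c. (\<forall>\<sigma>. c \<sigma> \<in> carrier F) \<and> finite {\<sigma>. c \<sigma> \<noteq> \<zero>\<^bsub>F\<^esub>} \<and>
                   (\<forall>\<sigma>. c \<sigma> \<noteq> \<zero>\<^bsub>F\<^esub> \<longrightarrow> singular_simplex p X \<sigma>)},
     mult = undefined, one = undefined,
     zero = (\<lambda>_. \<zero>\<^bsub>F\<^esub>),
     add = (\<lambda>c d \<sigma>. c \<sigma> \<oplus>\<^bsub>F\<^esub> d \<sigma>),
     smult = (\<lambda>a c \<sigma>. a \<otimes>\<^bsub>F\<^esub> c \<sigma>)\<rparr>"

text \<open>Linear extension of a map \<^term>\<open>h\<close> on simplices to chains.\<close>

definition push_chain ::
    "('f, 'r) ring_scheme \<Rightarrow> (((nat \<Rightarrow> real) \<Rightarrow> 'a) \<Rightarrow> ((nat \<Rightarrow> real) \<Rightarrow> 'b))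
      \<Rightarrow> ('a, 'f) coeff_chain \<Rightarrow> ('b, 'f) coeff_chain"
  where "push_chain F h c = (\<lambda>\<tau>. \<Oplus>\<^bsub>F\<^esub>\<sigma>\<in>{\<sigma>. c \<sigma> \<noteq> \<zero>\<^bsub>F\<^esub> \<and> h \<sigma> = \<tau>}. c \<sigma>)"

definition boundary_map ::
    "('f, 'r) ring_scheme \<Rightarrow> nat \<Rightarrow> ('a, 'f) coeff_chain \<Rightarrow> ('a, 'f) coeff_chain"
  where "boundary_map F p c = (\<lambda>\<tau>. if p = 0 then \<zero>\<^bsub>F\<^esub> else
    \<Oplus>\<^bsub>F\<^esub>k\<in>{..p}. ((\<ominus>\<^bsub>F\<^esub> \<one>\<^bsub>F\<^esub>) [^]\<^bsub>F\<^esub> k) \<otimes>\<^bsub>F\<^esub> push_chain F (singular_face p k) c \<tau>)"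

definition cycles :: "('f, 'r) ring_scheme \<Rightarrow> nat \<Rightarrow> 'a topology \<Rightarrow> ('a, 'f) coeff_chain set"
  where "cycles F p X = {c \<in> carrier (chain_module F p X). boundary_map F p c = (\<lambda>_. \<zero>\<^bsub>F\<^esub>)}"

definition boundaries :: "('f, 'r) ring_scheme \<Rightarrow> nat \<Rightarrow> 'a topology \<Rightarrow> ('a, 'f) coeff_chain set"
  where "boundaries F p X = boundary_map F (Suc p) ` carrier (chain_module F (Suc p) X)"

definition homology_module ::
    "('f, 'r) ring_scheme \<Rightarrow> nat \<Rightarrow> 'a topology \<Rightarrow> ('f, ('a, 'f) coeff_chain set) module"
  where "homology_module F p X =
    quotient_module ((chain_module F p X)\<lparr>carrier := cycles F p X\<rparr>) (boundaries F p X)"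

text \<open>The map induced by a continuous \<^term>\<open>g\<close> into \<^term>\<open>Y\<close>: the class of a cycle \<open>c\<close> is sent to
  the class of its image, i.e. to the coset of \<^term>\<open>boundaries F p Y\<close> containing it.\<close>

definition homology_map ::
    "('f, 'r) ring_scheme \<Rightarrow> nat \<Rightarrow> ('a \<Rightarrow> 'b) \<Rightarrow> 'b topology
      \<Rightarrow> ('a, 'f) coeff_chain set \<Rightarrow> ('b, 'f) coeff_chain set"
  where "homology_map F p g Y S =
    boundaries F p Y <+>\<^bsub>chain_module F p Y\<^esub> push_chain F (simplex_map p g) ` S"


section \<open>Inner functions and Blaschke products\<close>

text \<open>Functions on the unit disk are represented by functions on all of \<^typ>\<open>complex\<close>, whose values
  outside \<open>ball 0 1\<close> are irrelevant.\<close>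

definition inner_function :: "(complex \<Rightarrow> complex) \<Rightarrow> bool"
  where "inner_function u \<longleftrightarrow>
    u holomorphic_on ball 0 1 \<and> bounded (u ` ball 0 1) \<and>
    (AE x in lborel. \<exists>l. ((\<lambda>r. u (of_real r * cis x)) \<longlongrightarrow> l) (at_left (1::real)) \<and> norm l = 1)"

definition blaschke_factor :: "complex \<Rightarrow> complex \<Rightarrow> complex"
  where "blaschke_factor a z = (of_real (norm a) / a) * ((a - z) / (1 - cnj a * z))"

definition blaschke_product :: "(complex \<Rightarrow> complex) \<Rightarrow> bool"
  where "blaschke_product B \<longleftrightarrow> inner_function B \<and>
    (\<exists>(c::complex) (m::nat) (\<alpha>::nat \<Rightarrow> complex). norm c = 1 \<and>
      ((\<exists>N::nat. (\<forall>n<N. \<alpha> n \<in> ball 0 1 - {0}) \<and>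
          (\<forall>z\<in>ball 0 1. B z = c * z ^ m * (\<Prod>n<N. blaschke_factor (\<alpha> n) z))) \<or>
       ((\<forall>n. \<alpha> n \<in> ball 0 1 - {0}) \<and> summable (\<lambda>n. 1 - norm (\<alpha> n)) \<and>
          (\<forall>z\<in>ball 0 1. B z = c * z ^ m * prodinf (\<lambda>n. blaschke_factor (\<alpha> n) z)))))"

definition disk_zeros :: "(complex \<Rightarrow> complex) \<Rightarrow> complex set"
  where "disk_zeros f = {z \<in> ball 0 1. f z = 0}"

definition sublevel :: "(complex \<Rightarrow> complex) \<Rightarrow> real \<Rightarrow> complex set"
  where "sublevel u \<theta> = {z \<in> ball 0 1. norm (u z) < \<theta>}"

definition property_B :: "(complex \<Rightarrow> complex) \<Rightarrow> bool"
  where "property_B u \<longleftrightarrow>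
    (\<forall>\<theta>\<in>{0<..<1}. \<forall>C\<in>components (sublevel u \<theta>). closure C \<subseteq> ball 0 1)"


section \<open>The persistence module of an inner function\<close>

text \<open>The inverse of \<open>\<theta> \<mapsto> ln ((1 + \<theta>) / (1 - \<theta>))\<close> on \<open>(0, 1)\<close>.\<close>

definition level :: "real \<Rightarrow> real"
  where "level t = (exp t - 1) / (exp t + 1)"

definition sigma_space :: "(complex \<Rightarrow> complex) \<Rightarrow> real \<Rightarrow> complex topology"
  where "sigma_space u t = top_of_set (sublevel u (level t))"

definition inner_persistence ::
    "('f, 'r) ring_scheme \<Rightarrow> (complex \<Rightarrow> complex) \<Rightarrow> ('f, (complex, 'f) coeff_chain set) persistence"
  where "inner_persistence F u =
    \<lparr>space_at = (\<lambda>t. if t > 0 then homology_module F 0 (sigma_space u t) else zero_module {}),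
     map_at = (\<lambda>s t x. if s > 0 then homology_map F 0 (\<lambda>z. z) (sigma_space u t) x
                       else if t > 0 then \<zero>\<^bsub>homology_module F 0 (sigma_space u t)\<^esub> else {})\<rparr>"

end

(* The components of {|B| < theta} are relatively compact and, by the maximum principle, simply
   connected. Composing B with a Riemann map of such a component C gives a proper self-map of the
   disk, i.e. a finite Blaschke product; the numerator of its logarithmic derivative is, on the unit
   circle, a positive multiple of z^(q-1), where q is the number of distinct zeros, so by Rouche it
   has q - 1 zeros in the disk. Hence the number of distinct zeros of B in C exceeds by one the
   number of critical points in C that are not zeros, counted with multiplicity.

   Enumerate the zeros of B and apply the elder rule: when components merge, only the zero of least
   index survives. Every zero except the first has a finite death time, and the count above, applied
   at all levels, matches the death times with the values s_j, with multiplicities m_j. The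
   coordinate of a class along a zero z is its mass in the component of z at the death time of z; this
   does not depend on the current time, and against the basis of surviving zeros the coordinates are
   given by a unitriangular matrix, which yields the isomorphism. *)

theory Submission
  imports Defs "HOL-Complex_Analysis.Complex_Analysis"
begin

section \<open>Components of sublevel sets\<close>

text \<open>Below a given time there may be infinitely many zeros and critical points, so counts
  over the whole disk carry no information, and no induction along time is available. Every count is
  therefore made inside one component, where closure in the disk forces finiteness, and the
  correspondence between zeros and bars is glued from such finite pieces. A basis of surviving
  classes would not be compatible with the structure maps: a class [z] does not vanish at its death
  but becomes the class of an older zero. Passing to differences would require choosing which elder
  absorbs z. Linear functionals on chains need no such choice. They also allow both persistence
  modules to be presented as quotients of one increasing family of chain modules, whose structure
  maps are inclusions. An isomorphism then amounts to equality of kernels, and naturality is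
  automatic. Since the zeros are enumerated by natural numbers, only finitely many are older than a
  given one. This finiteness is what puts the coordinates into a direct sum and not merely into a
  product.\<close>

text \<open>A larger modulus at \<open>w\<close> is excluded by continuity. A smaller one is
  excluded by maximality: \<open>w\<close> could then be added to \<open>C\<close> without losing
  connectedness.\<close>

lemma frontier_component_sublevel:
  fixes f :: "complex \<Rightarrow> complex"
  assumes "continuous_on S f" "open S"
    and C: "C \<in> components {z\<in>S. norm (f z) < \<theta>}" and w: "w \<in> frontier C" "w \<in> S"
  shows "norm (f w) = \<theta>"
proof (rule antisym)
  let ?O = "{z\<in>S. norm (f z) < \<theta>}"
  have "?O = S \<inter> f -` ball 0 \<theta>" by (auto simp: dist_norm)
  moreover have "open (S \<inter> f -` ball 0 \<theta>)"
    using assms(1,2) by (intro continuous_open_preimage) auto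
  ultimately have O: "open ?O" by simp
  have oC: "open C" using C O open_components by blast
  have CO: "C \<subseteq> ?O" using C in_components_subset by blast
  have wC: "w \<in> closure C" "w \<notin> C" using w oC by (auto simp: frontier_def interior_open)
  show "norm (f w) \<le> \<theta>"
  proof (rule ccontr)
    assume "\<not> norm (f w) \<le> \<theta>"
    then have "w \<in> S \<inter> f -` (- cball 0 \<theta>)" using w by simp
    moreover have "open (S \<inter> f -` (- cball 0 \<theta>))"
      using assms(1,2) by (intro continuous_open_preimage) auto
    ultimately have "C \<inter> (S \<inter> f -` (- cball 0 \<theta>)) \<noteq> {}"
      using wC(1) by (metis closure_iff_nhds_not_empty order_refl)
    then show False using CO by force
  qed
  show "\<theta> \<le> norm (f w)"
  proof (rule ccontr)
    assume "\<not> \<theta> \<le> norm (f w)"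
    then have "insert w C \<subseteq> ?O" using CO w by auto
    moreover have "connected (insert w C)"
      by (rule connected_intermediate_closure [of C])
        (use C wC closure_subset in \<open>auto simp: in_components_connected\<close>)
    ultimately have "insert w C \<subseteq> C"
      by (intro components_maximal [OF C])
        (use in_components_nonempty [OF C] in auto)
    then show False using wC by auto
  qed
qed

text \<open>Filling the holes of \<open>closure C\<close> gives a compact set on which the maximum
  principle yields modulus at most \<theta>, and the open mapping theorem makes this strict in the
  interior. A hole of \<open>C\<close> would contain a frontier point of \<open>C\<close>, where the
  modulus is exactly \<theta>.\<close>

lemma simply_connected_component_sublevel:
  assumes f: "f holomorphic_on S" and S: "open S" "convex S" and nc: "\<not> f constant_on S"
    and C: "C \<in> components {z\<in>S. norm (f z) < \<theta>}" and cl: "closure C \<subseteq> S" and bC: "bounded C"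
  shows "simply_connected C"
proof -
  let ?O = "{z\<in>S. norm (f z) < \<theta>}"
  have contf: "continuous_on S f" using f by (rule holomorphic_on_imp_continuous_on)
  have "?O = S \<inter> f -` ball 0 \<theta>" by (auto simp: dist_norm)
  moreover have "open (S \<inter> f -` ball 0 \<theta>)"
    using contf S by (intro continuous_open_preimage) auto
  ultimately have O: "open ?O" by simp
  have oC: "open C" using C O open_components by blast
  have CO: "C \<subseteq> ?O" using C in_components_subset by blast
  have conC: "connected C" and neC: "C \<noteq> {}"
    using C in_components_connected in_components_nonempty by blast+
  have fr: "norm (f w) = \<theta>" if "w \<in> frontier C" for w
    using frontier_component_sublevel [OF contf S(1) C that] cl that by (auto simp: frontier_def)
  have fcl: "norm (f w) \<le> \<theta>" if "w \<in> closure C" for w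
    using fr [of w] CO that closure_Un_frontier [of C] by force
  \<comment> \<open>\<open>T\<close> is \<open>closure C\<close> with its holes filled. Taking the
    outside of the closure, an open set, makes \<open>T\<close> closed; convexity of
    \<open>S\<close> keeps it inside \<open>S\<close>.\<close>
  define T where "T = - outside (closure C)"
  have bcl: "bounded (closure C)" using bC by (rule bounded_closure)
  have opo: "open (outside (closure C))" by (simp add: open_outside)
  have TS: "T \<subseteq> S" using outside_subset_convex [OF S(2) cl] by (auto simp: T_def)
  have bT: "bounded T" using bcl cobounded_outside by (simp add: T_def)
  have closedT: "closed T" using opo by (simp add: T_def closed_def)
  have frT: "frontier T \<subseteq> closure C"
    using frontier_outside_subset [of "closure C"] by (simp add: T_def frontier_complement)
  have fT: "norm (f p) \<le> \<theta>" if "p \<in> T" for p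
  proof (rule maximum_modulus_frontier [of f T])
    show "f holomorphic_on interior T"
      using f TS interior_subset by (metis holomorphic_on_subset order_trans)
    show "continuous_on (closure T) f"
      using contf TS closedT by (simp add: continuous_on_subset)
  qed (use bT frT fcl that in auto)
  have fiT: "norm (f p) < \<theta>" if "p \<in> interior T" for p
  proof -
    have "interior T \<subseteq> S" using TS interior_subset by blast
    then have "open (f ` interior T)"
      using open_mapping_thm [OF f S(1) convex_connected [OF S(2)] _ _ nc, of "interior T"] by auto
    moreover have "f ` interior T \<subseteq> cball 0 \<theta>" using fT interior_subset [of T] by auto
    ultimately have "f ` interior T \<subseteq> ball 0 \<theta>" using interior_maximal [of "f ` interior T" "cball 0 \<theta>"] by simp
    then show ?thesis using that by auto
  qed
  \<comment> \<open>A point of \<open>inside C\<close> missing from the interior would be a limit of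
    the connected set \<open>outside C\<close>; adjoining it would keep that set connected within
    the complement of \<open>C\<close>, so the point would be outside.\<close>
  have inT: "inside C \<subseteq> interior T"
  proof
    fix w assume w: "w \<in> inside C"
    show "w \<in> interior T"
    proof (rule ccontr)
      assume "w \<notin> interior T"
      then have "w \<in> closure (outside (closure C))" by (simp add: T_def interior_complement)
      then have wc: "w \<in> closure (outside C)"
        using closure_mono [OF outside_mono [OF closure_subset]] by blast
      have "connected (outside C)" using bC by (simp add: connected_outside)
      then have con: "connected (insert w (outside C))"
        by (rule connected_intermediate_closure) (use wc closure_subset in auto)
      have "insert w (outside C) \<subseteq> - C"
        using w outside_no_overlap [of C] inside_no_overlap [of C] by blast
      obtain v where v: "v \<in> outside C" using outside_bounded_nonempty [OF bC] by blast
      then have "connected_component (- C) v w"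
        using con \<open>insert w (outside C) \<subseteq> - C\<close> unfolding connected_component_def by blast
      then have "w \<in> outside C" using v outside_same_component by blast
      then show False using w by (simp add: inside_outside)
    qed
  qed
  have "inside C = {}"
  proof (rule ccontr)
    assume "inside C \<noteq> {}"
    then obtain w where w: "w \<in> inside C" by blast
    define K where "K = connected_component_set (- C) w"
    have wC: "w \<in> - C" using w inside_no_overlap by blast
    have wK: "w \<in> K" using wC by (simp add: K_def)
    \<comment> \<open>If the hole \<open>K\<close> missed \<open>closure C\<close>, it would be a
      component of an open set, hence open; as a component of the closed set \<open>- C\<close> it
      is also closed. Connectedness of the plane forbids this.\<close>
    have "K \<inter> closure C \<noteq> {}"
    proof
      assume K0: "K \<inter> closure C = {}"
      have cK: "connected K" by (simp add: K_def)
      have "K \<subseteq> connected_component_set (- closure C) w"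
        by (rule connected_component_maximal) (use K0 wK cK in auto)
      moreover have "connected_component_set (- closure C) w \<subseteq> K"
        unfolding K_def by (intro connected_component_mono) (use closure_subset in auto)
      ultimately have "K = connected_component_set (- closure C) w" by blast
      then have "open K" using open_Compl [OF closed_closure] by (metis open_connected_component)
      moreover have "closed K"
        unfolding K_def by (rule closed_connected_component) (use oC in auto)
      ultimately have "K = UNIV" using wK clopen by blast
      moreover have "K \<subseteq> - C" by (simp add: K_def connected_component_subset)
      ultimately show False using neC by blast
    qed
    then obtain v where v: "v \<in> K" "v \<in> closure C" by blast
    have "connected_component (- C) w v" using v(1) by (simp add: K_def)
    then have "v \<in> inside C" using w inside_same_component by blast
    then have "norm (f v) < \<theta>" "v \<notin> C" using inT fiT inside_no_overlap [of C] by blast+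
    moreover have "v \<in> frontier C" using \<open>v \<notin> C\<close> v oC by (simp add: frontier_def interior_open)
    ultimately show False using fr [of v] by simp
  qed
  then show ?thesis using oC conC simply_connected_eq_empty_inside by blast
qed

lemma holomorphic_factor_zeros:
  assumes "finite Z" "f holomorphic_on S" "open S" "connected S" "\<not> f constant_on S"
    "Z = {z\<in>S. f z = 0}"
  obtains n h where "\<And>a. a \<in> Z \<Longrightarrow> n a > (0::nat)" "h holomorphic_on S" "\<And>z. z \<in> S \<Longrightarrow> h z \<noteq> 0"
    "\<And>z. z \<in> S \<Longrightarrow> f z = h z * (\<Prod>a\<in>Z. (z - a) ^ n a)"
proof -
  \<comment> \<open>The induction asks only for a point where \<open>f\<close> is nonzero: once all
    zeros are divided out, the cofactor may well be constant.\<close>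
  have "\<exists>n h. (\<forall>a\<in>Z. n a > (0::nat)) \<and> h holomorphic_on S \<and> (\<forall>z\<in>S. h z \<noteq> 0) \<and>
    (\<forall>z\<in>S. f z = h z * (\<Prod>a\<in>Z. (z - a) ^ n a))" if "\<exists>z\<in>S. f z \<noteq> 0"
    using assms(1,2,6) that
  proof (induction Z arbitrary: f rule: finite_induct)
    case empty
    then show ?case by (intro exI [of _ "\<lambda>_. 0"] exI [of _ f]) auto
  next
    case (insert a Z)
    have a: "a \<in> S" "f a = 0" using insert.prems by auto
    obtain z0 where z0: "z0 \<in> S" "f z0 \<noteq> 0" using insert.prems by blast
    have "\<not> f constant_on S"
    proof
      assume "f constant_on S"
      then obtain c where "\<forall>x\<in>S. f x = c" unfolding constant_on_def by blast
      then show False using a z0 by force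
    qed
    from holomorphic_factor_zero_nonconstant [OF insert.prems(1) assms(3,4) a this]
    obtain g r k where g: "0 < (k::nat)" "0 < r" "ball a r \<subseteq> S" "g holomorphic_on ball a r"
      and gf: "\<And>w. w \<in> ball a r \<Longrightarrow> f w = (w - a) ^ k * g w"
      and g0: "\<And>w. w \<in> ball a r \<Longrightarrow> g w \<noteq> 0" by metis
    \<comment> \<open>The quotient has a removable singularity at \<open>a\<close>; the local
      cofactor \<open>g\<close> supplies its values there, and the two formulas agree on the
      overlap.\<close>
    define h where "h = (\<lambda>z. if z \<in> ball a r then g z else f z / (z - a) ^ k)"
    have hf: "f z = (z - a) ^ k * h z" if "z \<in> S" for z
      using gf that g(2) by (auto simp: h_def)
    have h1: "h holomorphic_on ball a r"
      using g(4) by (rule holomorphic_transform) (simp add: h_def)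
    have "(\<lambda>z. f z / (z - a) ^ k) holomorphic_on S - {a}"
      by (intro holomorphic_intros holomorphic_on_subset [OF insert.prems(1)]) auto
    then have h2: "h holomorphic_on S - {a}"
      by (rule holomorphic_transform) (use gf in \<open>auto simp: h_def\<close>)
    have "h holomorphic_on ball a r \<union> (S - {a})"
      by (intro holomorphic_on_Un h1 h2) (use assms(3) in auto)
    moreover have "ball a r \<union> (S - {a}) = S" using g(2,3) by auto
    ultimately have h: "h holomorphic_on S" by simp
    have ha: "h a \<noteq> 0" using g0 g(2) by (simp add: h_def)
    have Z: "Z = {z\<in>S. h z = 0}"
    proof -
      have "z \<in> Z \<longleftrightarrow> z \<in> S \<and> h z = 0" for z
      proof (cases "z = a")
        case True then show ?thesis using ha insert.hyps by auto
      next
        case False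
        have "z \<in> insert a Z \<longleftrightarrow> z \<in> S \<and> f z = 0" using insert.prems(2) by blast
        moreover have "z \<in> S \<Longrightarrow> f z = 0 \<longleftrightarrow> h z = 0" using hf [of z] False by simp
        ultimately show ?thesis using False by blast
      qed
      then show ?thesis by auto
    qed
    have "\<exists>z\<in>S. h z \<noteq> 0" using ha a by blast
    from insert.IH [OF h Z this] obtain n q where n: "\<forall>a\<in>Z. n a > (0::nat)" "q holomorphic_on S"
      "\<forall>z\<in>S. q z \<noteq> 0" "\<forall>z\<in>S. h z = q z * (\<Prod>a\<in>Z. (z - a) ^ n a)" by blast
    show ?case
    proof (intro exI conjI)
      show "\<forall>b\<in>insert a Z. (n(a := k)) b > 0" using n(1) g(1) by simp
      show "\<forall>z\<in>S. f z = q z * (\<Prod>b\<in>insert a Z. (z - b) ^ (n(a := k)) b)"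
      proof
        fix z assume z: "z \<in> S"
        have "(\<Prod>b\<in>Z. (z - b) ^ (n(a := k)) b) = (\<Prod>b\<in>Z. (z - b) ^ n b)"
          by (rule prod.cong) (use insert.hyps in auto)
        then show "f z = q z * (\<Prod>b\<in>insert a Z. (z - b) ^ (n(a := k)) b)"
          using insert.hyps hf [OF z] n(4) z by simp
      qed
    qed (use n in auto)
  qed
  moreover have "\<exists>z\<in>S. f z \<noteq> 0" using assms(5) by (auto simp: constant_on_def)
  ultimately show ?thesis using that by blast
qed

section \<open>Critical points of proper maps of the disk\<close>

lemma compact_subset_unit_ball:
  assumes "compact K" "K \<subseteq> ball (0::'a::real_normed_vector) 1"
  obtains r where "0 \<le> r" "r < 1" "K \<subseteq> cball 0 r"
proof (cases "K = {}")
  case True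
  then show ?thesis using that [of 0] by auto
next
  case False
  obtain x where "x \<in> K" "\<forall>y\<in>K. norm y \<le> norm x"
    using continuous_attains_sup [OF assms(1) False, of norm] continuous_on_norm_id by blast
  then have "norm x < 1" "K \<subseteq> cball 0 (norm x)" using assms(2) by auto
  then show ?thesis using that [of "norm x"] by simp
qed

text \<open>The maximum principle for a function without boundary values: it is applied on smaller
  closed disks, whose boundary circles lie in the region where the modulus is at most
  \<delta>.\<close>

lemma norm_le_one_of_boundary:
  assumes h: "h holomorphic_on ball 0 1"
    and b: "\<And>\<delta>. 1 < \<delta> \<Longrightarrow> \<exists>r<1. \<forall>z. r < norm z \<and> norm z < 1 \<longrightarrow> norm (h z) \<le> \<delta>"
    and z: "norm z < 1"
  shows "norm (h z) \<le> 1"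
proof (rule ccontr)
  assume "\<not> norm (h z) \<le> 1"
  \<comment> \<open>The midpoint of 1 and the supposedly larger modulus serves as \<delta>: it
    exceeds 1, and a bound by it contradicts the value at \<open>z\<close>.\<close>
  then have d: "1 < (1 + norm (h z)) / 2" by simp
  then obtain r where r: "r < 1" "\<And>w. r < norm w \<Longrightarrow> norm w < 1 \<Longrightarrow> norm (h w) \<le> (1 + norm (h z)) / 2"
    using b by blast
  define s where "s = (max r (norm z) + 1) / 2"
  have s: "r < s" "norm z < s" "s < 1" using r(1) z by (auto simp: s_def max_def)
  have s0: "0 < s" using s(2) norm_ge_zero [of z] by linarith
  have "norm (h z) \<le> (1 + norm (h z)) / 2"
  proof (rule maximum_modulus_frontier [of h "cball 0 s"])
    show "h holomorphic_on interior (cball 0 s)"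
      by (rule holomorphic_on_subset [OF h]) (use s in auto)
    show "continuous_on (closure (cball 0 s)) h"
      by (rule continuous_on_subset [OF holomorphic_on_imp_continuous_on [OF h]]) (use s in auto)
    show "norm (h w) \<le> (1 + norm (h z)) / 2" if "w \<in> frontier (cball 0 s)" for w
      using that s s0 r(2) [of w] by simp
    show "z \<in> cball 0 s" using s by simp
  qed auto
  then show False using d by simp
qed

lemma one_minus_cnj_mult_nonzero:
  assumes "norm a < 1" "norm z \<le> 1"
  shows "1 - cnj a * z \<noteq> 0"
proof
  assume "1 - cnj a * z = 0"
  then have "norm (cnj a * z) = 1" by simp
  moreover have "norm (cnj a * z) \<le> norm a * 1"
    unfolding norm_mult complex_mod_cnj using assms by (intro mult_left_mono) auto
  ultimately show False using assms by simp
qed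

lemma norm_mobius_le:
  assumes "norm a < 1" "norm z < 1"
  shows "norm ((z - a) / (1 - cnj a * z)) \<le> 1"
  using Moebius_function_norm_lt_1 [OF assms, of 0] by (simp add: Moebius_function_simple)

lemma norm_mobius_circle:
  assumes "norm a < 1" "norm z = 1"
  shows "norm ((z - a) / (1 - cnj a * z)) = 1"
proof -
  have "z * cnj z = 1" using assms(2) by (simp add: complex_norm_square [symmetric])
  then have "1 - cnj a * z = z * cnj (z - a)" by (simp add: algebra_simps)
  then have "norm (1 - cnj a * z) = norm (z - a)" by (simp add: norm_mult assms(2) del: complex_cnj_diff)
  moreover have "1 - cnj a * z \<noteq> 0" using assms by (intro one_minus_cnj_mult_nonzero) auto
  ultimately show ?thesis by (metis norm_divide divide_self norm_eq_zero)
qed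

text \<open>Let \<open>b\<close> be the finite Blaschke product with the zeros of \<open>f\<close>,
  and write \<open>f = g b\<close>. Both \<open>f\<close> and \<open>b\<close> have modulus tending
  to 1 at the circle, so \<open>g\<close> and \<open>1 / g\<close> are bounded by 1 through the
  boundary maximum principle. Hence \<open>g\<close> is unimodular and constant.\<close>

lemma proper_disk_map_eq_blaschke:
  assumes f: "f holomorphic_on ball 0 1"
    and lt: "\<And>z. norm z < 1 \<Longrightarrow> norm (f z) < 1"
    and proper: "\<And>\<epsilon>. 0 < \<epsilon> \<Longrightarrow> \<exists>r<1. \<forall>z. r < norm z \<and> norm z < 1 \<longrightarrow> 1 - \<epsilon> < norm (f z)"
    and Z_def: "Z = {z \<in> ball 0 1. f z = 0}"
  shows "finite Z" "Z \<noteq> {}"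
    "\<exists>c n. norm c = 1 \<and> (\<forall>a\<in>Z. n a > (0::nat)) \<and>
       (\<forall>z. norm z < 1 \<longrightarrow> f z = c * (\<Prod>a\<in>Z. ((z - a) / (1 - cnj a * z)) ^ n a))"
proof -
  have Zlt: "norm a < 1" if "a \<in> Z" for a using that by (simp add: Z_def)
  have nc: "\<not> f constant_on ball 0 1"
  proof
    assume "f constant_on ball 0 1"
    then obtain k where k: "\<And>z. norm z < 1 \<Longrightarrow> f z = k" by (auto simp: constant_on_def)
    have k1: "norm k < 1" using k [of 0] lt [of 0] by simp
    then obtain r where r: "r < 1" "\<And>z. r < norm z \<and> norm z < 1 \<Longrightarrow> 1 - (1 - norm k) < norm (f z)"
      using proper [of "1 - norm k"] by auto
    define z :: complex where "z = of_real ((max r 0 + 1) / 2)"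
    have "norm z = (max r 0 + 1) / 2" unfolding z_def norm_of_real by simp
    then have "r < norm z \<and> norm z < 1" using r(1) by (cases "r \<le> 0") (auto simp: max_def)
    then show False using r(2) [of z] k [of z] by simp
  qed
  show finZ: "finite Z"
  proof -
    obtain r where r: "r < 1" "\<And>z. r < norm z \<and> norm z < 1 \<Longrightarrow> 1 - 1/2 < norm (f z)"
      using proper [of "1/2"] by auto
    have "finite {z \<in> cball 0 r. f z = 0}"
      using r(1) by (intro holomorphic_compact_finite_zeros [OF f _ _ _ _ nc]) auto
    moreover have "Z \<subseteq> {z \<in> cball 0 r. f z = 0}"
      using r(2) by (force simp: Z_def)
    ultimately show ?thesis by (rule rev_finite_subset)
  qed
  obtain n h where n: "\<And>a. a \<in> Z \<Longrightarrow> n a > (0::nat)" and h: "h holomorphic_on ball 0 1"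
    and h0: "\<And>z. z \<in> ball 0 1 \<Longrightarrow> h z \<noteq> 0"
    and fh: "\<And>z. z \<in> ball 0 1 \<Longrightarrow> f z = h z * (\<Prod>a\<in>Z. (z - a) ^ n a)"
    using holomorphic_factor_zeros [OF finZ f open_ball connected_ball nc Z_def] by blast
  define b where "b = (\<lambda>z. \<Prod>a\<in>Z. ((z - a) / (1 - cnj a * z)) ^ n a)"
  define g where "g = (\<lambda>z. h z * (\<Prod>a\<in>Z. (1 - cnj a * z) ^ n a))"
  have D0: "(\<Prod>a\<in>Z. (1 - cnj a * z) ^ n a) \<noteq> 0" if "norm z \<le> 1" for z
    using finZ that Zlt one_minus_cnj_mult_nonzero by (simp add: prod_zero_iff)
  have fg: "f z = g z * b z" if "norm z < 1" for z
    using fh [of z] that D0 [of z] by (simp add: g_def b_def power_divide prod_dividef)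
  have g: "g holomorphic_on ball 0 1" unfolding g_def by (intro holomorphic_intros h)
  have g0: "g z \<noteq> 0" if "norm z < 1" for z
    using h0 [of z] D0 [of z] that by (simp add: g_def)
  have b_le: "norm (b z) \<le> 1" if "norm z < 1" for z
    unfolding b_def prod_norm [symmetric] norm_power
    by (intro prod_le_1 conjI power_le_one norm_mobius_le Zlt that) auto
  have b_circle: "norm (b z) = 1" if "norm z = 1" for z
    unfolding b_def prod_norm [symmetric] norm_power
    using norm_mobius_circle [OF Zlt that] by (intro prod.neutral) simp
  have cont_b: "continuous_on (cball 0 1) b"
    unfolding b_def by (intro continuous_intros) (use Zlt one_minus_cnj_mult_nonzero in auto)
  have b_proper: "\<exists>r<1. \<forall>z. r < norm z \<and> norm z < 1 \<longrightarrow> 1 - \<epsilon> < norm (b z)" if "0 < \<epsilon>" for \<epsilon>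
  proof -
    let ?K = "{z \<in> cball 0 1. norm (b z) \<in> {..1 - \<epsilon>}}"
    have "closed (cball 0 1 \<inter> (\<lambda>z. norm (b z)) -` {..1 - \<epsilon>})"
      by (intro continuous_closed_preimage continuous_on_norm cont_b) auto
    moreover have "?K = cball 0 1 \<inter> (\<lambda>z. norm (b z)) -` {..1 - \<epsilon>}" by auto
    ultimately have "closed ?K" by simp
    then have "compact ?K"
      using compact_eq_bounded_closed by (metis (no_types, lifting) bounded_cball bounded_subset mem_Collect_eq subsetI)
    moreover have "?K \<subseteq> ball 0 1"
    proof
      fix z assume "z \<in> ?K"
      then show "z \<in> ball 0 1" using b_circle [of z] that by (cases "norm z = 1") auto
    qed
    ultimately obtain r where r: "r < 1" "?K \<subseteq> cball 0 r"
      using compact_subset_unit_ball [of ?K] by metis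
    have "1 - \<epsilon> < norm (b z)" if "r < norm z \<and> norm z < 1" for z
    proof (rule ccontr)
      assume "\<not> 1 - \<epsilon> < norm (b z)"
      then have "z \<in> ?K" using that by auto
      then have "norm z \<le> r" using r(2) by auto
      then show False using that by simp
    qed
    then show ?thesis using r(1) by blast
  qed
  \<comment> \<open>Properness is used with \<epsilon> equal to \<open>1 - inverse \<delta>\<close>,
    so that a modulus above \<open>1 - \<epsilon>\<close> becomes a reciprocal modulus below
    \<delta>.\<close>
  have frac: "0 < 1 - inverse \<delta>" "1 - (1 - inverse \<delta>) = inverse \<delta>" "inverse (inverse \<delta>) = \<delta>" "0 < inverse \<delta>"
    if "1 < \<delta>" for \<delta> :: real
    using that by (auto simp: inverse_less_1_iff)
  have g_le: "norm (g z) \<le> 1" if "norm z < 1" for z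
  proof (rule norm_le_one_of_boundary [OF g _ that])
    fix \<delta> :: real assume d: "1 < \<delta>"
    obtain r where r: "r < 1" "\<And>z. r < norm z \<and> norm z < 1 \<Longrightarrow> inverse \<delta> < norm (b z)"
      using b_proper [OF frac(1) [OF d]] frac(2) [OF d] by auto
    have "norm (g z) \<le> \<delta>" if z: "r < norm z \<and> norm z < 1" for z
    proof -
      have "norm (g z) * inverse \<delta> \<le> norm (g z) * norm (b z)"
        using r(2) [OF z] by (intro mult_left_mono) auto
      also have "\<dots> = norm (f z)" using fg [of z] z by (simp add: norm_mult)
      also have "\<dots> \<le> 1" using lt [of z] z by simp
      finally show ?thesis using d by (simp add: field_simps)
    qed
    then show "\<exists>r<1. \<forall>z. r < norm z \<and> norm z < 1 \<longrightarrow> norm (g z) \<le> \<delta>" using r(1) by blast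
  qed
  have ig_le: "norm (inverse (g z)) \<le> 1" if "norm z < 1" for z
  proof (rule norm_le_one_of_boundary [OF _ _ that])
    show "(\<lambda>z. inverse (g z)) holomorphic_on ball 0 1"
      using g g0 by (intro holomorphic_intros) auto
    fix \<delta> :: real assume d: "1 < \<delta>"
    obtain r where r: "r < 1" "\<And>z. r < norm z \<and> norm z < 1 \<Longrightarrow> inverse \<delta> < norm (f z)"
      using proper [OF frac(1) [OF d]] frac(2) [OF d] by auto
    have "norm (inverse (g z)) \<le> \<delta>" if z: "r < norm z \<and> norm z < 1" for z
    proof -
      have "inverse \<delta> \<le> norm (g z) * norm (b z)" using r(2) [OF z] fg [of z] z by (simp add: norm_mult)
      also have "\<dots> \<le> norm (g z) * 1" using b_le z by (intro mult_left_mono) auto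
      finally have "inverse (norm (g z)) \<le> inverse (inverse \<delta>)"
        using frac(4) [OF d] by (intro le_imp_inverse_le) auto
      then show ?thesis using frac(3) [OF d] by (simp add: norm_inverse)
    qed
    then show "\<exists>r<1. \<forall>z. r < norm z \<and> norm z < 1 \<longrightarrow> norm (inverse (g z)) \<le> \<delta>" using r(1) by blast
  qed
  have g1: "norm (g z) = 1" if "norm z < 1" for z
  proof (rule antisym [OF g_le [OF that]])
    show "1 \<le> norm (g z)" using ig_le [OF that] g0 [OF that] by (simp add: norm_divide field_simps)
  qed
  have "g constant_on ball 0 1"
    by (rule maximum_modulus_principle [OF g, of "ball 0 1" 0]) (use g1 in auto)
  then obtain c where c: "\<And>z. norm z < 1 \<Longrightarrow> g z = c" by (auto simp: constant_on_def)
  have c1: "norm c = 1" using c [of 0] g1 [of 0] by simp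
  have fb: "f z = c * (\<Prod>a\<in>Z. ((z - a) / (1 - cnj a * z)) ^ n a)" if "norm z < 1" for z
    using fg [OF that] c [OF that] by (simp add: b_def)
  \<comment> \<open>Without zeros the product is empty and \<open>f\<close> is the unimodular
    constant \<open>c\<close>, although its values lie in the open disk.\<close>
  show "Z \<noteq> {}"
  proof
    assume "Z = {}"
    then show False using fb [of 0] c1 lt [of 0] by simp
  qed
  show "\<exists>c n. norm c = 1 \<and> (\<forall>a\<in>Z. n a > (0::nat)) \<and>
       (\<forall>z. norm z < 1 \<longrightarrow> f z = c * (\<Prod>a\<in>Z. ((z - a) / (1 - cnj a * z)) ^ n a))"
    using c1 n fb by blast
qed

text \<open>The point \<open>w\<close> ensures that \<open>f\<close> is not identically zero on the
  connected set \<open>S\<close>, so the order at \<open>z\<close> is a genuine one; the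
  nonvanishing factor \<open>k\<close> is absorbed into the local cofactor.\<close>

lemma zorder_mult_nonvanishing:
  assumes "f holomorphic_on S" "k holomorphic_on S" "open S" "connected S" "z \<in> S" "k z \<noteq> 0"
    "w \<in> S" "f w \<noteq> 0" and g: "\<And>u. u \<in> S \<Longrightarrow> g u = f u * k u"
  shows "zorder g z = zorder f z"
proof -
  have "\<exists>w\<in>S. f w \<noteq> 0" using assms by blast
  from zorder_exist_zero [OF assms(1,3-5) this]
  have n: "0 \<le> zorder f z"
    and "\<exists>r>0. cball z r \<subseteq> S \<and> zor_poly f z holomorphic_on cball z r \<and>
      (\<forall>w\<in>cball z r. f w = zor_poly f z w * (w - z) ^ nat (zorder f z) \<and> zor_poly f z w \<noteq> 0)"
    by (auto split: if_splits)
  then obtain r where r: "r > 0" "cball z r \<subseteq> S" "zor_poly f z holomorphic_on cball z r"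
    "\<And>w. w \<in> cball z r \<Longrightarrow> f w = zor_poly f z w * (w - z) ^ nat (zorder f z)"
    "\<And>w. w \<in> cball z r \<Longrightarrow> zor_poly f z w \<noteq> 0" by blast
  show ?thesis
  proof (rule zorder_eqI [of "ball z r" z "\<lambda>u. zor_poly f z u * k u"])
    show "(\<lambda>u. zor_poly f z u * k u) holomorphic_on ball z r"
      by (intro holomorphic_intros holomorphic_on_subset [OF r(3)] holomorphic_on_subset [OF assms(2)])
        (use r(2) ball_subset_cball in auto)
    show "g u = zor_poly f z u * k u * (u - z) powi zorder f z" if "u \<in> ball z r" "u \<noteq> z" for u
    proof -
      have "u \<in> cball z r" "u \<in> S" using that r(2) by auto
      then show ?thesis using g [of u] r(4) [of u] n by (simp add: power_int_def)
    qed
  qed (use r assms in auto)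
qed

text \<open>Up to the positive factor \<open>1 - \<bar>a\<bar>\<^sup>2\<close>, the logarithmic derivative of the factor vanishing at \<open>a\<close>
  is \<open>1 / ((z - a) (1 - cnj a z))\<close>; the sum below is the numerator of the logarithmic derivative of a
  finite Blaschke product. On the unit circle \<open>(z - b) (1 - cnj b z) = z \<bar>z - b\<bar>\<^sup>2\<close>, so
  that the numerator is a positive multiple of \<open>z ^ (card Z - 1)\<close>.\<close>

lemma sum_zorder_blaschke_numerator:
  fixes n :: "complex \<Rightarrow> nat"
  assumes Z: "finite Z" "Z \<noteq> {}" "Z \<subseteq> ball 0 1" and n: "\<And>a. a \<in> Z \<Longrightarrow> 0 < n a"
  defines "R \<equiv> \<lambda>z. \<Sum>a\<in>Z. of_nat (n a) * (1 - a * cnj a) * (\<Prod>b\<in>Z - {a}. (z - b) * (1 - cnj b * z))"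
  shows "finite {z \<in> ball 0 1. R z = 0}"
    and "(\<Sum>z | z \<in> ball 0 1 \<and> R z = 0. zorder R z) = int (card Z) - 1"
proof -
  define q where "q = card Z - 1"
  have q: "card (Z - {a}) = q" if "a \<in> Z" for a using that Z by (simp add: q_def)
  have cZ: "int (card Z) - 1 = int q" using Z by (simp add: q_def card_gt_0_iff Suc_leI of_nat_diff)
  define \<rho> where "\<rho> = (\<lambda>z::complex. \<Sum>a\<in>Z. real (n a) * (1 - (norm a)\<^sup>2) * (\<Prod>b\<in>Z - {a}. (norm (z - b))\<^sup>2))"
  \<comment> \<open>A strict upper bound for \<rho> on the circle: there
    \<open>norm (z - b) \<le> 2\<close>, whence the factors 4, and the final 1 makes it strict. Then
    \<open>R\<close> differs from \<open>K z^q\<close> by a number of modulus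
    \<open>K - \<rho> z\<close>, less than \<open>K\<close>, as Rouche's theorem requires.\<close>
  define K where "K = (\<Sum>a\<in>Z. real (n a) * (1 - (norm a)\<^sup>2) * (\<Prod>b\<in>Z - {a}. 4)) + 1"
  have co: "0 < real (n a) * (1 - (norm a)\<^sup>2)" if "a \<in> Z" for a
  proof -
    have "norm a < 1" using that Z by auto
    then have "(norm a)\<^sup>2 < 1" by (simp add: power_less_one_iff abs_square_less_1)
    then show ?thesis using n [OF that] by simp
  qed
  have circ: "(z - b) * (1 - cnj b * z) = z * of_real ((norm (z - b))\<^sup>2)" if "norm z = 1" for z b :: complex
  proof -
    have zz: "z * cnj z = 1" using that by (simp add: complex_norm_square [symmetric])
    have "z * of_real ((norm (z - b))\<^sup>2) = (z - b) * (z * cnj z - cnj b * z)"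
      unfolding complex_norm_square by (simp add: algebra_simps)
    then show ?thesis by (simp add: zz)
  qed
  have R_circ: "R z = z ^ q * of_real (\<rho> z)" if "norm z = 1" for z
  proof -
    have "R z = (\<Sum>a\<in>Z. of_nat (n a) * (1 - a * cnj a) * (z ^ q * (\<Prod>b\<in>Z - {a}. of_real ((norm (z - b))\<^sup>2))))"
      unfolding R_def using q by (intro sum.cong refl) (simp add: circ [OF that] prod.distrib)
    also have "\<dots> = z ^ q * of_real (\<rho> z)"
      unfolding \<rho>_def of_real_sum sum_distrib_left
      by (intro sum.cong refl) (simp add: complex_norm_square [symmetric] mult_ac)
    finally show ?thesis .
  qed
  have rho_pos: "0 < \<rho> z" if "norm z = 1" for z
    unfolding \<rho>_def
  proof (rule sum_pos [OF Z(1,2)])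
    fix a assume a: "a \<in> Z"
    have "0 < (\<Prod>b\<in>Z - {a}. (norm (z - b))\<^sup>2)"
      using that Z by (intro prod_pos) auto
    then show "0 < real (n a) * (1 - (norm a)\<^sup>2) * (\<Prod>b\<in>Z - {a}. (norm (z - b))\<^sup>2)"
      using co [OF a] by simp
  qed
  have rho_K: "\<rho> z < K" if "norm z = 1" for z
  proof -
    have "\<rho> z \<le> (\<Sum>a\<in>Z. real (n a) * (1 - (norm a)\<^sup>2) * (\<Prod>b\<in>Z - {a}. 4))"
      unfolding \<rho>_def
    proof (intro sum_mono mult_left_mono prod_mono conjI)
      fix a b assume "a \<in> Z" "b \<in> Z - {a}"
      then have "norm (z - b) \<le> 2" using that Z norm_triangle_ineq4 [of z b] by force
      then show "(norm (z - b))\<^sup>2 \<le> 4" using power_mono [of "norm (z - b)" 2 2] by simp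
    qed (use co in \<open>auto simp: less_imp_le\<close>)
    then show ?thesis by (simp add: K_def)
  qed
  have K0: "K > 0" using rho_K [of 1] rho_pos [of 1] by simp
  have holR: "R holomorphic_on S" for S unfolding R_def by (intro holomorphic_intros)
  have R1: "R z \<noteq> 0" if "norm z = 1" for z
  proof -
    have "z ^ q \<noteq> 0" using that by auto
    then show ?thesis using R_circ [OF that] rho_pos [OF that] by simp
  qed
  \<comment> \<open>The radius 2 gives an open region around the unit circle. The case distinction
    is real: for a one-point \<open>Z\<close> the function \<open>R\<close> is a nonzero
    constant.\<close>
  have fin2: "finite {z \<in> ball 0 2. R z = 0}"
  proof (cases "R constant_on UNIV")
    case True
    then have "R z \<noteq> 0" for z using R1 [of 1] by (metis UNIV_I constant_on_def norm_one)
    then show ?thesis by simp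
  next
    case False
    have "finite {z \<in> cball 0 2. R z = 0}"
      by (rule holomorphic_compact_finite_zeros [OF holR _ _ _ _ False]) auto
    then show ?thesis by (rule rev_finite_subset) auto
  qed
  then show fin1: "finite {z \<in> ball 0 1. R z = 0}" by (rule rev_finite_subset) auto
  let ?w = "\<lambda>p. winding_number (circlepath 0 1) p"
  have w1: "?w p = 1" if "norm p < 1" for p
    using that by (intro winding_number_circlepath) simp
  have w0: "?w p = 0" if "norm p > 1" for p
    by (rule winding_number_zero_outside [of _ "cball 0 1"]) (use that in auto)
  have K_sum: "(\<Sum>p | p \<in> ball 0 2 \<and> of_real K * p ^ q = 0. ?w p * zorder (\<lambda>p. of_real K * p ^ q) p) = of_nat q"
  \<comment> \<open>For \<open>q = 0\<close> the comparison function has no zeros at all and the sum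
    is empty; otherwise its only zero is 0, of order \<open>q\<close>.\<close>
  proof (cases "q = 0")
    case True then show ?thesis using K0 by simp
  next
    case False
    then have "{p \<in> ball 0 2. of_real K * p ^ q = 0} = {0::complex}" using K0 by auto
    moreover have "zorder (\<lambda>p. of_real K * p ^ q) (0::complex) = int q"
      by (rule zorder_eqI [of UNIV _ "\<lambda>_. of_real K"]) (use K0 in auto)
    ultimately show ?thesis using w1 [of 0] by simp
  qed
  have eq: "(\<lambda>p. of_real K * p ^ q + (R p - of_real K * p ^ q)) = R" by auto
  let ?f = "\<lambda>p. of_real K * p ^ q" and ?g = "\<lambda>p. R p - of_real K * p ^ q"
  have "(\<Sum>p | p \<in> ball 0 2 \<and> ?f p + ?g p = 0. ?w p * zorder (\<lambda>p. ?f p + ?g p) p) =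
     (\<Sum>p | p \<in> ball 0 2 \<and> ?f p = 0. ?w p * zorder ?f p)"
  proof (rule Rouche_theorem)
    show "finite {p \<in> ball 0 2. of_real K * p ^ q = (0::complex)}"
      by (rule finite_subset [of _ "{0}"]) (use K0 in auto)
    show "\<forall>z\<in>path_image (circlepath 0 1). norm (R z - of_real K * z ^ q) < norm (of_real K * z ^ q)"
    proof
      fix z assume "z \<in> path_image (circlepath (0::complex) 1)"
      then have z: "norm z = 1" by simp
      have "R z - of_real K * z ^ q = z ^ q * of_real (\<rho> z - K)"
        by (simp add: R_circ [OF z] algebra_simps)
      then have "norm (R z - of_real K * z ^ q) = \<bar>\<rho> z - K\<bar>"
        by (simp only: norm_mult norm_power z norm_of_real) simp
      also have "\<dots> < K" using rho_pos [OF z] rho_K [OF z] by simp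
      also have "K = norm (of_real K * z ^ q)" using K0 by (simp add: norm_mult norm_power z)
      finally show "norm (R z - of_real K * z ^ q) < norm (of_real K * z ^ q)" .
    qed
    show "\<forall>z. z \<notin> ball 0 2 \<longrightarrow> ?w z = 0" using w0 by auto
  qed (use fin2 holR in \<open>auto intro!: holomorphic_intros\<close>)
  then have "(\<Sum>p | p \<in> ball 0 2 \<and> R p = 0. ?w p * zorder R p) = of_nat q"
    unfolding K_sum eq by (simp add: eq)
  also have "(\<Sum>p | p \<in> ball 0 2 \<and> R p = 0. ?w p * zorder R p) = (\<Sum>p | p \<in> ball 0 1 \<and> R p = 0. ?w p * zorder R p)"
  proof (rule sum.mono_neutral_right)
    show "\<forall>p\<in>{p \<in> ball 0 2. R p = 0} - {p \<in> ball 0 1. R p = 0}. ?w p * zorder R p = 0"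
    proof
      fix p assume "p \<in> {p \<in> ball 0 2. R p = 0} - {p \<in> ball 0 1. R p = 0}"
      then have "R p = 0" "\<not> norm p < 1" by auto
      then have "norm p > 1" using R1 [of p] by (cases "norm p = 1") auto
      then show "?w p * zorder R p = 0" using w0 by simp
    qed
  qed (use fin2 in auto)
  also have "\<dots> = (\<Sum>p | p \<in> ball 0 1 \<and> R p = 0. of_int (zorder R p))"
    by (intro sum.cong refl) (use w1 in auto)
  finally have "of_int (\<Sum>p | p \<in> ball 0 1 \<and> R p = 0. zorder R p) = (of_int (int q) :: complex)"
    by simp
  then show "(\<Sum>p | p \<in> ball 0 1 \<and> R p = 0. zorder R p) = int (card Z) - 1"
    unfolding cZ by (simp only: of_int_eq_iff)
qed

text \<open>With \<open>f\<close> a finite Blaschke product, \<open>f' D = f R\<close> off the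
  zeros, where \<open>R\<close> is the numerator counted above. Multiplicities of zeros of
  \<open>f\<close> enter \<open>R\<close> only as positive weights, which is why distinct zeros are
  counted on the left.\<close>

lemma card_zeros_proper_disk_map:
  assumes f: "f holomorphic_on ball 0 1"
    and lt: "\<And>z. norm z < 1 \<Longrightarrow> norm (f z) < 1"
    and proper: "\<And>\<epsilon>. 0 < \<epsilon> \<Longrightarrow> \<exists>r<1. \<forall>z. r < norm z \<and> norm z < 1 \<longrightarrow> 1 - \<epsilon> < norm (f z)"
  shows "finite {z \<in> ball 0 1. f z = 0}" "{z \<in> ball 0 1. f z = 0} \<noteq> {}"
    and "finite {z \<in> ball 0 1. deriv f z = 0 \<and> f z \<noteq> 0}"
    and "int (card {z \<in> ball 0 1. f z = 0}) = 1 + (\<Sum>z | z \<in> ball 0 1 \<and> deriv f z = 0 \<and> f z \<noteq> 0. zorder (deriv f) z)"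
proof -
  define Z where "Z = {z \<in> ball 0 1. f z = 0}"
  note blaschke = proper_disk_map_eq_blaschke [OF f lt proper Z_def]
  have fin: "finite Z" and ne: "Z \<noteq> {}" using blaschke(1,2) by simp_all
  obtain c n where c: "norm c = 1" and n: "\<And>a. a \<in> Z \<Longrightarrow> n a > (0::nat)"
    and feq: "\<And>z. norm z < 1 \<Longrightarrow> f z = c * (\<Prod>a\<in>Z. ((z - a) / (1 - cnj a * z)) ^ n a)"
    using blaschke(3) by auto
  have Zb: "Z \<subseteq> ball 0 1" by (auto simp: Z_def)
  define R where "R = (\<lambda>z. \<Sum>a\<in>Z. of_nat (n a) * (1 - a * cnj a) * (\<Prod>b\<in>Z - {a}. (z - b) * (1 - cnj b * z)))"
  define D where "D = (\<lambda>z. \<Prod>b\<in>Z. (z - b) * (1 - cnj b * z))"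
  have ninv: "1 - cnj b * z \<noteq> 0" if "b \<in> Z" "norm z < 1" for b z
    using that Zb one_minus_cnj_mult_nonzero by (auto simp: subset_iff)
  have D0: "D z \<noteq> 0" if "norm z < 1" "z \<notin> Z" for z
    using fin ninv that by (auto simp: D_def prod_zero_iff)
  have deriv_f: "deriv f z * D z = f z * R z" if z: "norm z < 1" "z \<notin> Z" for z
  proof -
    define P where "P = (\<lambda>a z. ((z - a) / (1 - cnj a * z)) ^ n a)"
    define P' where "P' = (\<lambda>a. of_nat (n a) * ((z - a) / (1 - cnj a * z)) ^ (n a - 1) *
        ((1 * (1 - cnj a * z) - (z - a) * (0 - cnj a * 1)) / ((1 - cnj a * z) * (1 - cnj a * z))))"
    have dP: "(P a has_field_derivative P' a) (at z)" if "a \<in> Z" for a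
      unfolding P_def P'_def using ninv [OF that z(1)]
      by (auto intro!: derivative_eq_intros)
    have P0: "P a z \<noteq> 0" if "a \<in> Z" for a using ninv [OF that z(1)] that z by (auto simp: P_def)
    have "((\<lambda>z. c * (\<Prod>a\<in>Z. P a z)) has_field_derivative c * ((\<Prod>a\<in>Z. P a z) * (\<Sum>a\<in>Z. P' a / P a z))) (at z)"
      by (intro DERIV_cmult has_field_derivative_prod' dP P0)
    moreover have "eventually (\<lambda>w. f w = c * (\<Prod>a\<in>Z. P a w)) (nhds z)"
    proof -
      have "eventually (\<lambda>w. w \<in> ball 0 1) (nhds z)" using z by (intro eventually_nhds_in_open) auto
      then show ?thesis by eventually_elim (auto simp: feq P_def)
    qed
    ultimately have "(f has_field_derivative c * ((\<Prod>a\<in>Z. P a z) * (\<Sum>a\<in>Z. P' a / P a z))) (at z)"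
      by (subst DERIV_cong_ev [OF refl _ refl])
    then have "deriv f z = f z * (\<Sum>a\<in>Z. P' a / P a z)"
      using feq [OF z(1)] by (simp add: DERIV_imp_deriv P_def)
    moreover have "(\<Sum>a\<in>Z. P' a / P a z) * D z = R z"
      unfolding R_def sum_distrib_right
    proof (intro sum.cong refl)
      fix a assume a: "a \<in> Z"
      have za: "z - a \<noteq> 0" "1 - cnj a * z \<noteq> 0" using a z ninv by auto
      have Da: "D z = (z - a) * (1 - cnj a * z) * (\<Prod>b\<in>Z - {a}. (z - b) * (1 - cnj b * z))"
        unfolding D_def by (rule prod.remove [OF fin a])
      define y where "y = (z - a) / (1 - cnj a * z)"
      have y: "y \<noteq> 0" using za by (simp add: y_def)
      have "y ^ n a = y * y ^ (n a - 1)" using n [OF a] by (cases "n a") auto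
      moreover have "P' a / P a z = of_nat (n a) * (1 - a * cnj a) / ((1 - cnj a * z) * (1 - cnj a * z)) / y" if "y ^ n a = y * y ^ (n a - 1)"
      proof -
        have num: "1 * (1 - cnj a * z) - (z - a) * (0 - cnj a * 1) = 1 - a * cnj a" by (simp add: algebra_simps)
        have "y ^ (n a - 1) \<noteq> 0" using y by simp
        then show ?thesis
          unfolding P'_def P_def y_def [symmetric] num that using y by simp
      qed
      ultimately have "P' a / P a z = of_nat (n a) * (1 - a * cnj a) / ((1 - cnj a * z) * (1 - cnj a * z)) / y"
        by blast
      also have "\<dots> = of_nat (n a) * (1 - a * cnj a) / ((z - a) * (1 - cnj a * z))"
        unfolding y_def using za by simp
      finally show "P' a / P a z * D z = of_nat (n a) * (1 - a * cnj a) * (\<Prod>b\<in>Z - {a}. (z - b) * (1 - cnj b * z))"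
        unfolding Da using za by simp
    qed
    ultimately show ?thesis by (simp add: mult.assoc)
  qed
  \<comment> \<open>At \<open>a\<close> every summand but that of \<open>a\<close> contains a
    vanishing factor. Thus multiple zeros of \<open>f\<close>, though critical, contribute nothing
    to the zeros of \<open>R\<close>.\<close>
  have RZ: "R a \<noteq> 0" if a: "a \<in> Z" for a
  proof -
    have "R a = of_nat (n a) * (1 - a * cnj a) * (\<Prod>b\<in>Z - {a}. (a - b) * (1 - cnj b * a))
      + (\<Sum>a'\<in>Z - {a}. of_nat (n a') * (1 - a' * cnj a') * (\<Prod>b\<in>Z - {a'}. (a - b) * (1 - cnj b * a)))"
      unfolding R_def by (rule sum.remove [OF fin a])
    also have "(\<Sum>a'\<in>Z - {a}. of_nat (n a') * (1 - a' * cnj a') * (\<Prod>b\<in>Z - {a'}. (a - b) * (1 - cnj b * a))) = 0"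
    proof (rule sum.neutral, rule ballI)
      fix a' assume "a' \<in> Z - {a}"
      then have "(\<Prod>b\<in>Z - {a'}. (a - b) * (1 - cnj b * a)) = 0"
        using fin a by (intro prod_zero) auto
      then show "of_nat (n a') * (1 - a' * cnj a') * (\<Prod>b\<in>Z - {a'}. (a - b) * (1 - cnj b * a)) = 0" by simp
    qed
    finally have Ra: "R a = of_nat (n a) * (1 - cnj a * a) * (\<Prod>b\<in>Z - {a}. (a - b) * (1 - cnj b * a))"
      by (simp add: mult.commute)
    have a1: "norm a < 1" using a Zb by auto
    have "(\<Prod>b\<in>Z - {a}. (a - b) * (1 - cnj b * a)) \<noteq> 0"
      using fin ninv [OF _ a1] by (auto simp: prod_zero_iff)
    then show ?thesis unfolding Ra using n [OF a] ninv [OF a a1] by simp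
  qed
  have set_eq: "{z \<in> ball 0 1. deriv f z = 0 \<and> f z \<noteq> 0} = {z \<in> ball 0 1. R z = 0}"
  proof -
    have "deriv f z = 0 \<and> f z \<noteq> 0 \<longleftrightarrow> R z = 0" if z: "norm z < 1" for z
    proof (cases "z \<in> Z")
      case True then show ?thesis using RZ [of z] by (auto simp: Z_def)
    next
      case False
      then have "f z \<noteq> 0" using z by (simp add: Z_def)
      then show ?thesis using deriv_f [OF z False] D0 [OF z False] by auto
    qed
    then show ?thesis by auto
  qed
  \<comment> \<open>An infinite disk against finitely many excluded points yields a witness that
    \<open>R\<close> is not identically zero, needed to transfer orders from \<open>R\<close> to
    \<open>deriv f\<close>.\<close>
  have "infinite (ball (0::complex) 1)" using uncountable_ball [of 1 "0::complex"] uncountable_infinite by auto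
  moreover have "finite (Z \<union> {z \<in> ball 0 1. R z = 0})"
    using fin sum_zorder_blaschke_numerator(1) [OF fin ne Zb n] by (simp add: R_def)
  ultimately have "\<not> ball 0 1 \<subseteq> Z \<union> {z \<in> ball 0 1. R z = 0}" using finite_subset by blast
  then obtain w where w: "w \<in> ball 0 1 - Z" "R w \<noteq> 0" by blast
  have zo: "zorder (deriv f) z = zorder R z" if z: "z \<in> ball 0 1" "f z \<noteq> 0" for z
  proof (rule zorder_mult_nonvanishing [of R "ball 0 1 - Z" "\<lambda>z. f z / D z"])
    have hD: "D holomorphic_on ball 0 1 - Z" unfolding D_def by (intro holomorphic_intros)
    show "R holomorphic_on ball 0 1 - Z" unfolding R_def by (intro holomorphic_intros)
    show "(\<lambda>z. f z / D z) holomorphic_on ball 0 1 - Z"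
      by (intro holomorphic_intros hD holomorphic_on_subset [OF f]) (use D0 in auto)
    show "open (ball 0 1 - Z)" using fin by (intro open_Diff finite_imp_closed) auto
    show "connected (ball 0 1 - Z)"
      using fin by (intro connected_open_diff_countable countable_finite) auto
    show zS: "z \<in> ball 0 1 - Z" using z by (simp add: Z_def)
    show "f z / D z \<noteq> 0" using D0 [of z] zS z by auto
    show "deriv f u = R u * (f u / D u)" if "u \<in> ball 0 1 - Z" for u
      using deriv_f [of u] D0 [of u] that by (simp add: field_simps)
    show "w \<in> ball 0 1 - Z" "R w \<noteq> 0" by (fact w)+
  qed
  show "finite {z \<in> ball 0 1. f z = 0}" "{z \<in> ball 0 1. f z = 0} \<noteq> {}"
    using fin ne by (simp_all add: Z_def)
  show "finite {z \<in> ball 0 1. deriv f z = 0 \<and> f z \<noteq> 0}"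
    unfolding set_eq using sum_zorder_blaschke_numerator(1) [OF fin ne Zb n] by (simp add: R_def)
  have "(\<Sum>z | z \<in> ball 0 1 \<and> deriv f z = 0 \<and> f z \<noteq> 0. zorder (deriv f) z) = (\<Sum>z | z \<in> ball 0 1 \<and> deriv f z = 0 \<and> f z \<noteq> 0. zorder R z)"
    by (intro sum.cong refl zo) auto
  also have "\<dots> = int (card Z) - 1"
    unfolding set_eq using sum_zorder_blaschke_numerator(2) [OF fin ne Zb n] by (simp add: R_def)
  finally show "int (card {z \<in> ball 0 1. f z = 0}) = 1 + (\<Sum>z | z \<in> ball 0 1 \<and> deriv f z = 0 \<and> f z \<noteq> 0. zorder (deriv f) z)"
    by (simp add: Z_def)
qed

section \<open>Zeros and critical points in a component\<close>

text \<open>The Riemann map \<phi> of \<open>C\<close> turns \<open>B\<close> into the proper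
  self-map \<open>f\<close> of the disk, rescaled by \<theta>. Since \<phi> is injective with
  nonvanishing derivative, it carries zeros, critical points and the orders of the derivative over
  unchanged.\<close>

lemma card_zeros_component_sublevel:
  assumes B: "B holomorphic_on ball 0 1" and nc: "\<not> B constant_on ball 0 1" and \<theta>: "0 < \<theta>"
    and C: "C \<in> components {z \<in> ball 0 1. norm (B z) < \<theta>}" and cl: "closure C \<subseteq> ball 0 1"
  shows "finite {z \<in> C. B z = 0}" "{z \<in> C. B z = 0} \<noteq> {}"
    and "finite {z \<in> C. deriv B z = 0 \<and> B z \<noteq> 0}"
    and "int (card {z \<in> C. B z = 0}) = 1 + (\<Sum>z | z \<in> C \<and> deriv B z = 0 \<and> B z \<noteq> 0. zorder (deriv B) z)"
proof -
  let ?O = "{z \<in> ball 0 1. norm (B z) < \<theta>}"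
  have contB: "continuous_on (ball 0 1) B" using B by (rule holomorphic_on_imp_continuous_on)
  have "open (ball 0 1 \<inter> B -` ball 0 \<theta>)"
    by (intro continuous_open_preimage contB) auto
  moreover have "?O = ball 0 1 \<inter> B -` ball 0 \<theta>" by auto
  ultimately have O: "open ?O" by simp
  have oC: "open C" using C O open_components by blast
  have CO: "C \<subseteq> ?O" using C in_components_subset by blast
  then have C1: "C \<subseteq> ball 0 1" by blast
  have neC: "C \<noteq> {}" using C in_components_nonempty by blast
  have bC: "bounded C" using C1 bounded_ball bounded_subset by blast
  have "simply_connected C"
    by (rule simply_connected_component_sublevel [OF B _ _ nc C cl bC]) auto
  moreover have "C \<noteq> UNIV" using bC not_bounded_UNIV by blast
  ultimately have "\<exists>g \<phi>. g holomorphic_on C \<and> \<phi> holomorphic_on ball 0 1 \<and>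
      (\<forall>z\<in>C. g z \<in> ball 0 1 \<and> \<phi> (g z) = z) \<and> (\<forall>z\<in>ball 0 1. \<phi> z \<in> C \<and> g (\<phi> z) = z)"
    using Riemann_mapping_theorem [of C] oC neC by blast
  then obtain g \<phi> where g: "g holomorphic_on C" and \<phi>: "\<phi> holomorphic_on ball 0 1"
    and g\<phi>: "\<And>z. z \<in> C \<Longrightarrow> g z \<in> ball 0 1 \<and> \<phi> (g z) = z"
    and \<phi>g: "\<And>z. z \<in> ball 0 1 \<Longrightarrow> \<phi> z \<in> C \<and> g (\<phi> z) = z"
    by blast
  have fr: "norm (B w) = \<theta>" if "w \<in> closure C" "w \<notin> C" for w
    by (rule frontier_component_sublevel [OF contB _ C]) (use that cl oC in \<open>auto simp: frontier_def interior_open\<close>)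
  have B\<theta>: "norm (B w) < \<theta>" if "w \<in> C" for w using CO that by auto
  define f where "f = (\<lambda>w. B (\<phi> w) / of_real \<theta>)"
  have comp: "(\<lambda>w. B (\<phi> w)) holomorphic_on ball 0 1"
  proof -
    have "\<phi> ` ball 0 1 \<subseteq> ball 0 1" using \<phi>g C1 by blast
    then show ?thesis using holomorphic_on_compose_gen [OF \<phi> B] by (simp add: o_def)
  qed
  have f: "f holomorphic_on ball 0 1"
    unfolding f_def using \<theta> by (intro holomorphic_intros comp) auto
  have lt: "norm (f z) < 1" if "norm z < 1" for z
    using B\<theta> [of "\<phi> z"] \<phi>g [of z] that \<theta> by (simp add: f_def norm_divide)
  have proper: "\<exists>r<1. \<forall>z. r < norm z \<and> norm z < 1 \<longrightarrow> 1 - \<epsilon> < norm (f z)" if "0 < \<epsilon>" for \<epsilon>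
  proof -
    \<comment> \<open>Properness comes from this compact set: the modulus of \<open>B\<close> is
      \<theta> on the frontier of \<open>C\<close>, so \<open>K\<close> stays inside
      \<open>C\<close>, and its image under \<open>g\<close> lies in a smaller disk.\<close>
    define K where "K = closure C \<inter> (\<lambda>z. norm (B z)) -` {..\<theta> * (1 - \<epsilon>)}"
    have "closed K"
      unfolding K_def
      by (intro continuous_closed_preimage continuous_on_norm continuous_on_subset [OF contB] cl) auto
    moreover have "bounded K" using bounded_closure [OF bC] by (auto simp: K_def intro: bounded_subset)
    ultimately have cK: "compact K" by (simp add: compact_eq_bounded_closed)
    have KC: "K \<subseteq> C"
    proof
      fix w assume w: "w \<in> K"
      have "\<theta> * (1 - \<epsilon>) < \<theta>" using \<theta> that by (simp add: algebra_simps)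
      then show "w \<in> C" using w fr [of w] by (fastforce simp: K_def)
    qed
    have "compact (g ` K)"
      by (intro compact_continuous_image cK continuous_on_subset [OF holomorphic_on_imp_continuous_on [OF g] KC])
    moreover have "g ` K \<subseteq> ball 0 1" using g\<phi> KC by blast
    ultimately obtain r where r: "r < 1" "g ` K \<subseteq> cball 0 r"
      using compact_subset_unit_ball by metis
    have "1 - \<epsilon> < norm (f z)" if z: "r < norm z \<and> norm z < 1" for z
    proof (rule ccontr)
      assume "\<not> 1 - \<epsilon> < norm (f z)"
      then have "norm (B (\<phi> z)) \<le> \<theta> * (1 - \<epsilon>)"
        using \<theta> by (simp add: f_def norm_divide field_simps)
      moreover have "\<phi> z \<in> closure C" using \<phi>g [of z] z closure_subset by auto
      ultimately have "\<phi> z \<in> K" by (simp add: K_def)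
      then have "g (\<phi> z) \<in> cball 0 r" using r(2) by blast
      then show False using \<phi>g [of z] z by simp
    qed
    then show ?thesis using r(1) by blast
  qed
  note card = card_zeros_proper_disk_map [OF f lt proper]
  have hol': "deriv B holomorphic_on ball 0 1" using B by (simp add: holomorphic_deriv)
  have hol\<phi>': "deriv \<phi> holomorphic_on ball 0 1" using \<phi> by (simp add: holomorphic_deriv)
  have inj: "inj_on \<phi> (ball 0 1)" using \<phi>g by (metis inj_onI)
  have \<phi>'0: "deriv \<phi> z \<noteq> 0" if "z \<in> ball 0 1" for z
    using holomorphic_injective_imp_regular [OF \<phi> _ inj that] by simp
  have deriv_f: "deriv f z = deriv B (\<phi> z) * (deriv \<phi> z / of_real \<theta>)" if z: "z \<in> ball 0 1" for z
  proof -
    have "(B has_field_derivative deriv B (\<phi> z)) (at (\<phi> z))"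
      using B \<phi>g [OF z] C1 by (intro holomorphic_derivI [OF B]) auto
    moreover have "(\<phi> has_field_derivative deriv \<phi> z) (at z)"
      using z by (intro holomorphic_derivI [OF \<phi>]) auto
    ultimately have "((\<lambda>z. B (\<phi> z)) has_field_derivative deriv B (\<phi> z) * deriv \<phi> z) (at z)"
      by (rule DERIV_chain2)
    then have "(f has_field_derivative deriv B (\<phi> z) * deriv \<phi> z / of_real \<theta>) (at z)"
      unfolding f_def by (rule DERIV_cdivide)
    then show ?thesis by (simp add: DERIV_imp_deriv)
  qed
  obtain w0 where w0: "w0 \<in> ball 0 1" "deriv B w0 \<noteq> 0"
  proof -
    have "\<not> (\<forall>x\<in>ball 0 1. deriv B x = 0)"
    proof
      assume "\<forall>x\<in>ball 0 1. deriv B x = 0"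
      then have "\<And>x. x \<in> ball 0 1 \<Longrightarrow> (B has_field_derivative 0) (at x)"
        using holomorphic_derivI [OF B] by (metis open_ball)
      then have "B constant_on ball 0 1"
        using DERIV_zero_connected_constant_on [of "ball 0 1" "{}" B] contB by simp
      then show False using nc by blast
    qed
    then show thesis using that by blast
  qed
  have ev: "\<forall>\<^sub>F w in at p. deriv B w \<noteq> 0 \<and> w \<in> ball 0 1" if "p \<in> ball 0 1" for p
    by (rule non_zero_neighbour_alt [OF hol' _ _ that w0]) auto
  \<comment> \<open>A noncritical point inside \<open>C\<close>, found because the zeros of
    \<open>deriv B\<close> are isolated; its image under \<open>g\<close> shows that
    \<open>deriv B \<circ> \<phi>\<close> is not identically zero.\<close>
  obtain v where v: "v \<in> C" "deriv B v \<noteq> 0"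
  proof -
    obtain p where p: "p \<in> C" using neC by blast
    have "\<forall>\<^sub>F w in at p. w \<in> C" using oC p by (intro eventually_at_in_open') auto
    moreover have "\<forall>\<^sub>F w in at p. deriv B w \<noteq> 0 \<and> w \<in> ball 0 1" using p C1 by (intro ev) blast
    ultimately have "\<forall>\<^sub>F w in at p. w \<in> C \<and> deriv B w \<noteq> 0" by eventually_elim simp
    then have "\<exists>w. w \<in> C \<and> deriv B w \<noteq> 0" by (rule eventually_happens' [OF at_neq_bot])
    then show thesis using that by blast
  qed
  have zo: "zorder (deriv f) z = zorder (deriv B) (\<phi> z)" if z: "z \<in> ball 0 1" for z
  proof -
    have pz: "\<phi> z \<in> ball 0 1" using \<phi>g z C1 by blast
    have "zorder (deriv f) z = zorder (deriv B \<circ> \<phi>) z"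
    proof (rule zorder_mult_nonvanishing)
      show "(deriv B \<circ> \<phi>) holomorphic_on ball 0 1"
        using holomorphic_on_compose_gen [OF \<phi> hol'] \<phi>g C1 by blast
      show "(\<lambda>z. deriv \<phi> z / of_real \<theta>) holomorphic_on ball 0 1"
        using \<theta> by (intro holomorphic_intros hol\<phi>') auto
      show "(deriv B \<circ> \<phi>) (g v) \<noteq> 0" "g v \<in> ball 0 1" using v g\<phi> by auto
      show "deriv \<phi> z / of_real \<theta> \<noteq> 0" using \<phi>'0 z \<theta> by simp
    qed (use z deriv_f in auto)
    \<comment> \<open>Composition multiplies orders, and \<open>\<phi> x - \<phi> z\<close> vanishes
      to first order only.\<close>
    also have "\<dots> = zorder (deriv B) (\<phi> z) * zorder (\<lambda>x. \<phi> x - \<phi> z) z"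
    proof (rule zorder_compose')
      have an: "deriv B analytic_on {\<phi> z}" using hol' pz analytic_at open_ball by blast
      then show "isolated_singularity_at (deriv B) (\<phi> z)" by (rule isolated_singularity_at_analytic)
      show "not_essential (deriv B) (\<phi> z)" using an by (rule not_essential_analytic)
      show "\<phi> analytic_on {z}" using \<phi> z analytic_at open_ball by blast
      show "\<forall>\<^sub>F w in at (\<phi> z). deriv B w \<noteq> 0" using ev [OF pz] by (rule eventually_mono) simp
      have "\<forall>\<^sub>F w in at z. w \<in> ball 0 1 - {z}"
        using z by (intro eventually_at_in_open) auto
      then show "\<forall>\<^sub>F w in at z. \<phi> w \<noteq> \<phi> z"
        by eventually_elim (use inj z in \<open>auto simp: inj_on_def\<close>)
    qed
    also have "zorder (\<lambda>x. \<phi> x - \<phi> z) z = 1"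
    proof (rule zorder_zero_eqI [of _ "ball 0 1"])
      show "(\<lambda>x. \<phi> x - \<phi> z) holomorphic_on ball 0 1" by (intro holomorphic_intros \<phi>)
      have "((\<lambda>x. \<phi> x - \<phi> z) has_field_derivative deriv \<phi> z - 0) (at z)"
        using z by (intro DERIV_diff holomorphic_derivI [OF \<phi>] DERIV_const) auto
      then have "deriv (\<lambda>x. \<phi> x - \<phi> z) z = deriv \<phi> z" by (simp add: DERIV_imp_deriv)
      then show "(deriv ^^ nat 1) (\<lambda>x. \<phi> x - \<phi> z) z \<noteq> 0" using \<phi>'0 z by simp
    qed (use z in auto)
    finally show ?thesis by simp
  qed
  have f0: "f z = 0 \<longleftrightarrow> B (\<phi> z) = 0" for z using \<theta> by (simp add: f_def)
  have f'0: "deriv f z = 0 \<longleftrightarrow> deriv B (\<phi> z) = 0" if "z \<in> ball 0 1" for z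
    using deriv_f [OF that] \<phi>'0 [OF that] \<theta> by simp
  have zeros: "{z \<in> C. B z = 0} = \<phi> ` {z \<in> ball 0 1. f z = 0}"
    (is "?M = ?N")
  proof
    show "?M \<subseteq> ?N"
    proof
      fix z assume z: "z \<in> ?M"
      then have "g z \<in> ball 0 1" "\<phi> (g z) = z" using g\<phi> by auto
      then show "z \<in> ?N" using z f0 [of "g z"] by (intro image_eqI [of _ _ "g z"]) auto
    qed
    show "?N \<subseteq> ?M" using \<phi>g f0 by auto
  qed
  have crits: "{z \<in> C. deriv B z = 0 \<and> B z \<noteq> 0} = \<phi> ` {z \<in> ball 0 1. deriv f z = 0 \<and> f z \<noteq> 0}"
    (is "?L = ?R")
  proof
    show "?L \<subseteq> ?R"
    proof
      fix z assume z: "z \<in> ?L"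
      then have "g z \<in> ball 0 1" "\<phi> (g z) = z" using g\<phi> by auto
      then show "z \<in> ?R" using z f0 [of "g z"] f'0 [of "g z"] by (intro image_eqI [of _ _ "g z"]) auto
    qed
    show "?R \<subseteq> ?L" using \<phi>g f0 f'0 by auto
  qed
  have inj': "inj_on \<phi> S" if "S \<subseteq> ball 0 1" for S using inj that by (rule inj_on_subset)
  show "finite {z \<in> C. B z = 0}" "{z \<in> C. B z = 0} \<noteq> {}" "finite ?L"
    unfolding zeros crits using card(1,2,3) by auto
  have "int (card {z \<in> C. B z = 0}) = int (card {z \<in> ball 0 1. f z = 0})"
    unfolding zeros by (subst card_image) (auto intro!: inj')
  also have "\<dots> = 1 + (\<Sum>z | z \<in> ball 0 1 \<and> deriv f z = 0 \<and> f z \<noteq> 0. zorder (deriv f) z)" by (rule card(4))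
  also have "(\<Sum>z | z \<in> ball 0 1 \<and> deriv f z = 0 \<and> f z \<noteq> 0. zorder (deriv f) z) = (\<Sum>z\<in>?L. zorder (deriv B) z)"
    unfolding crits by (subst sum.reindex) (auto intro!: inj' sum.cong zo)
  finally show "int (card {z \<in> C. B z = 0}) = 1 + (\<Sum>z | z \<in> C \<and> deriv B z = 0 \<and> B z \<noteq> 0. zorder (deriv B) z)" .
qed

section \<open>Blaschke products are bounded by one\<close>

lemma norm_blaschke_factor_le:
  assumes "a \<in> ball 0 1 - {0}" "norm z < 1"
  shows "norm (blaschke_factor a z) \<le> 1"
proof -
  have "norm (blaschke_factor a z) = norm ((z - a) / (1 - cnj a * z))"
    using assms by (simp add: blaschke_factor_def norm_mult norm_divide norm_minus_commute)
  also have "\<dots> \<le> 1" using assms by (intro norm_mobius_le) auto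
  finally show ?thesis .
qed

text \<open>For fixed \<open>z\<close> the deviation from 1 is a constant times
  \<open>1 - norm a\<close>, so the summability condition on the zeros gives absolute convergence of
  the infinite product.\<close>

lemma norm_blaschke_factor_diff_le:
  assumes a: "a \<in> ball 0 1 - {0}" and z: "norm z < 1"
  shows "norm (blaschke_factor a z - 1) \<le> (1 - norm a) * (2 / (1 - norm z))"
proof -
  have a0: "a \<noteq> 0" and a1: "norm a < 1" using a by auto
  have D: "1 - cnj a * z \<noteq> 0" using one_minus_cnj_mult_nonzero a1 z by (simp add: less_imp_le)
  have "of_real (norm a) * of_real (norm a) = a * cnj a"
    by (simp add: complex_norm_square [symmetric] power2_eq_square [symmetric])
  then have "of_real (norm a) * (a - z) - a * (1 - cnj a * z) = - of_real (1 - norm a) * (a + of_real (norm a) * z)"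
    by (simp add: algebra_simps)
  moreover have "blaschke_factor a z - 1 = (of_real (norm a) * (a - z) - a * (1 - cnj a * z)) / (a * (1 - cnj a * z))"
    using a0 D by (simp add: blaschke_factor_def divide_simps)
  ultimately have "norm (blaschke_factor a z - 1) = (1 - norm a) * norm (a + of_real (norm a) * z) / (norm a * norm (1 - cnj a * z))"
    using a1 by (simp add: norm_mult norm_divide del: of_real_diff)
  also have "\<dots> \<le> (1 - norm a) * (norm a * 2) / (norm a * (1 - norm z))"
  proof (rule frac_le)
    have "norm (a + of_real (norm a) * z) \<le> norm a + norm a * norm z"
      using norm_triangle_ineq [of a "of_real (norm a) * z"] by (simp add: norm_mult)
    also have "\<dots> \<le> norm a + norm a * 1" using z by (intro add_left_mono mult_left_mono) auto
    finally show "(1 - norm a) * norm (a + of_real (norm a) * z) \<le> (1 - norm a) * (norm a * 2)"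
      using a1 by (intro mult_left_mono) auto
    have "norm (cnj a * z) \<le> 1 * norm z"
      unfolding norm_mult complex_mod_cnj using a1 by (intro mult_right_mono) auto
    then have "1 - norm z \<le> norm (1 - cnj a * z)"
      using norm_triangle_ineq2 [of 1 "cnj a * z"] by simp
    then show "norm a * (1 - norm z) \<le> norm a * norm (1 - cnj a * z)" by (intro mult_left_mono) auto
  qed (use a0 a1 z in auto)
  also have "\<dots> = (1 - norm a) * (2 / (1 - norm z))" using a0 by simp
  finally show ?thesis .
qed

text \<open>Partial products are bounded by 1 factor by factor, and the bound passes to the limit.
  Equality at one interior point would make \<open>B\<close> constant by the maximum
  principle.\<close>

lemma norm_blaschke_product_less:
  assumes B: "blaschke_product B" and nc: "\<not> B constant_on ball 0 1" and z: "norm z < 1"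
  shows "norm (B z) < 1"
proof -
  have hol: "B holomorphic_on ball 0 1" using B by (simp add: blaschke_product_def inner_function_def)
  have le: "norm (B z) \<le> 1" if z: "norm z < 1" for z
  proof -
    obtain c m \<alpha> where c: "norm (c::complex) = 1" and
      cases: "(\<exists>N::nat. (\<forall>n<N. \<alpha> n \<in> ball 0 1 - {0}) \<and>
          (\<forall>z\<in>ball 0 1. B z = c * z ^ m * (\<Prod>n<N. blaschke_factor (\<alpha> n) z))) \<or>
       ((\<forall>n. \<alpha> n \<in> ball 0 1 - {0}) \<and> summable (\<lambda>n. 1 - norm (\<alpha> n)) \<and>
          (\<forall>z\<in>ball 0 1. B z = c * z ^ m * prodinf (\<lambda>n. blaschke_factor (\<alpha> n) z)))"
      using B unfolding blaschke_product_def by (elim exE conjE) (rule that)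
    have "\<exists>p. norm p \<le> 1 \<and> B z = c * z ^ m * p"
      using cases
    proof
      assume "\<exists>N::nat. (\<forall>n<N. \<alpha> n \<in> ball 0 1 - {0}) \<and>
          (\<forall>z\<in>ball 0 1. B z = c * z ^ m * (\<Prod>n<N. blaschke_factor (\<alpha> n) z))"
      then obtain N where "\<forall>n<N. \<alpha> n \<in> ball 0 1 - {0}"
          "\<forall>z\<in>ball 0 1. B z = c * z ^ m * (\<Prod>n<N. blaschke_factor (\<alpha> n) z)" by (elim exE conjE)
      then have N: "\<And>n. n < N \<Longrightarrow> \<alpha> n \<in> ball 0 1 - {0}"
        "B z = c * z ^ m * (\<Prod>n<N. blaschke_factor (\<alpha> n) z)"
        using z by auto
      moreover have "norm (\<Prod>n<N. blaschke_factor (\<alpha> n) z) \<le> 1"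
        unfolding prod_norm [symmetric]
        by (intro prod_le_1 conjI norm_blaschke_factor_le z N) auto
      ultimately show ?thesis by blast
    next
      assume *: "(\<forall>n. \<alpha> n \<in> ball 0 1 - {0}) \<and> summable (\<lambda>n. 1 - norm (\<alpha> n)) \<and>
          (\<forall>z\<in>ball 0 1. B z = c * z ^ m * prodinf (\<lambda>n. blaschke_factor (\<alpha> n) z))"
      let ?f = "\<lambda>n. blaschke_factor (\<alpha> n) z"
      \<comment> \<open>Convergence has to be proved before \<open>prodinf\<close> may be treated as
        the limit of the partial products.\<close>
      have "summable (\<lambda>n. norm (?f n - 1))"
      proof (rule summable_comparison_test')
        show "summable (\<lambda>n. (1 - norm (\<alpha> n)) * (2 / (1 - norm z)))"
          using * by (intro summable_mult2) simp
        show "norm (norm (?f n - 1)) \<le> (1 - norm (\<alpha> n)) * (2 / (1 - norm z))" if "n \<ge> 0" for n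
          using norm_blaschke_factor_diff_le [OF _ z] * by simp
      qed
      then have "convergent_prod ?f"
        by (intro abs_convergent_prod_imp_convergent_prod summable_imp_abs_convergent_prod)
      then have "(\<lambda>n. norm (\<Prod>i\<le>n. ?f i)) \<longlonglongrightarrow> norm (prodinf ?f)"
        by (intro tendsto_norm convergent_prod_LIMSEQ)
      moreover have "norm (\<Prod>i\<le>n. ?f i) \<le> 1" for n
        unfolding prod_norm [symmetric]
        using * by (intro prod_le_1 conjI norm_blaschke_factor_le z) auto
      ultimately have "norm (prodinf ?f) \<le> 1" by (intro LIMSEQ_le_const2) auto
      then show ?thesis using * z by (intro exI [of _ "prodinf ?f"]) auto
    qed
    then obtain p where p: "norm p \<le> 1" "B z = c * z ^ m * p" by blast
    have "norm (B z) = norm z ^ m * norm p" using p(2) c by (simp add: norm_mult norm_power)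
    also have "\<dots> \<le> 1 * 1" using z p by (intro mult_mono power_le_one) auto
    finally show ?thesis by simp
  qed
  show ?thesis
  proof (rule ccontr)
    assume "\<not> norm (B z) < 1"
    then have "norm (B w) \<le> norm (B z)" if "w \<in> ball 0 1" for w using le [of w] that by auto
    then have "B constant_on ball 0 1"
      using z by (intro maximum_modulus_principle [OF hol, of "ball 0 1" z]) auto
    then show False using nc by blast
  qed
qed

section \<open>The elder rule\<close>

text \<open>Equal cardinalities of the whole sets would say too little, as these may be infinite.
  Bijections between finite fibres over common labels are glued, so that labels are
  preserved.\<close>

lemma bij_betw_of_fibres:
  assumes p: "p ` A \<subseteq> K" and q: "q ` B \<subseteq> K"
    and f: "\<And>k. k \<in> K \<Longrightarrow> \<exists>f. bij_betw f {a\<in>A. p a = k} {b\<in>B. q b = k}"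
  shows "\<exists>f. bij_betw f A B \<and> (\<forall>a\<in>A. q (f a) = p a)"
proof -
  obtain F where F: "\<And>k. k \<in> K \<Longrightarrow> bij_betw (F k) {a\<in>A. p a = k} {b\<in>B. q b = k}"
    using f by metis
  have FB: "F (p a) a \<in> B \<and> q (F (p a) a) = p a" if "a \<in> A" for a
    using bij_betwE [OF F [of "p a"]] p that by auto
  have "inj_on (\<lambda>a. F (p a) a) A"
  proof (rule inj_onI)
    fix x y assume x: "x \<in> A" and y: "y \<in> A" and e: "F (p x) x = F (p y) y"
    then have "p x = p y" using FB by metis
    then show "x = y"
      using bij_betw_imp_inj_on [OF F [of "p x"]] x y e p by (auto simp: inj_on_def)
  qed
  moreover have "b \<in> (\<lambda>a. F (p a) a) ` A" if "b \<in> B" for b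
  proof -
    have "b \<in> F (q b) ` {a\<in>A. p a = q b}"
      using bij_betw_imp_surj_on [OF F [of "q b"]] q that by auto
    then obtain a where "a \<in> A" "p a = q b" "b = F (q b) a" by blast
    then show ?thesis by (intro image_eqI [of _ _ a]) simp_all
  qed
  ultimately have "bij_betw (\<lambda>a. F (p a) a) A B" using FB by (auto simp: bij_betw_def)
  then show ?thesis using FB by blast
qed

text \<open>\<open>R t\<close> is the relation of lying in the same component at time \<open>t\<close>, \<open>Z\<close> is a set of points
  born at time \<open>0\<close>, and \<open>pt i\<close> for \<open>i \<in> I\<close> are the merging points, repeated according to multiplicity.\<close>

locale merging_components =
  fixes R :: "real \<Rightarrow> 'a \<Rightarrow> 'a \<Rightarrow> bool" and Z :: "'a set" and idx :: "'a \<Rightarrow> nat"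
    and I :: "'i set" and pt :: "'i \<Rightarrow> 'a" and sv :: "'i \<Rightarrow> real"
  assumes R_sym: "\<And>t x y. R t x y \<Longrightarrow> R t y x"
    and R_trans: "\<And>t x y z. R t x y \<Longrightarrow> R t y z \<Longrightarrow> R t x z"
    and R_mono: "\<And>s t x y. s \<le> t \<Longrightarrow> R s x y \<Longrightarrow> R t x y"
    and R_left: "\<And>t x y. 0 < t \<Longrightarrow> R t x y \<Longrightarrow> \<exists>s. 0 < s \<and> s < t \<and> R s x y"
    and Z_R: "\<And>t z. 0 < t \<Longrightarrow> z \<in> Z \<Longrightarrow> R t z z"
    and R_Z: "\<And>t x. 0 < t \<Longrightarrow> R t x x \<Longrightarrow> \<exists>z\<in>Z. R t x z"
    and Z_connected: "\<And>z z'. z \<in> Z \<Longrightarrow> z' \<in> Z \<Longrightarrow> \<exists>t>0. R t z z'"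
    and Z_nonempty: "Z \<noteq> {}"
    and idx_inj: "inj_on idx Z"
    and sv_pos: "\<And>i. i \<in> I \<Longrightarrow> 0 < sv i"
    and R_pt: "\<And>t i. i \<in> I \<Longrightarrow> 0 < t \<Longrightarrow> R t (pt i) (pt i) \<longleftrightarrow> sv i < t"
    and finite_zeros: "\<And>t x. 0 < t \<Longrightarrow> R t x x \<Longrightarrow> finite {z\<in>Z. R t x z}"
    and finite_pts: "\<And>t x. 0 < t \<Longrightarrow> R t x x \<Longrightarrow> finite {i\<in>I. R t x (pt i)}"
    and card_zeros: "\<And>t x. 0 < t \<Longrightarrow> R t x x \<Longrightarrow> card {z\<in>Z. R t x z} = Suc (card {i\<in>I. R t x (pt i)})"
begin

definition root :: 'a where "root = arg_min idx (\<lambda>z. z \<in> Z)"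

text \<open>All zeros are born at time 0, so age cannot decide; the enumeration \<open>idx\<close>
  breaks the tie, and \<open>z\<close> is alive while it has the least index in its
  component.\<close>

definition alive :: "real \<Rightarrow> 'a \<Rightarrow> bool"
  where "alive t z \<longleftrightarrow> (\<forall>z'\<in>Z. R t z z' \<longrightarrow> idx z \<le> idx z')"

text \<open>For \<open>root\<close> the set is empty and the infimum carries no information, hence
  its exclusion wherever \<open>death\<close> is used.\<close>

definition death :: "'a \<Rightarrow> real" where "death z = Inf {t. 0 < t \<and> \<not> alive t z}"

lemma root_in_Z: "root \<in> Z"
  unfolding root_def using Z_nonempty by (metis arg_min_natI equals0I)

lemma idx_root_le: "z \<in> Z \<Longrightarrow> idx root \<le> idx z"
  unfolding root_def by (rule arg_min_nat_le)

lemma alive_root: "alive t root"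
  by (simp add: alive_def idx_root_le)

text \<open>The set of times at which \<open>z\<close> is dead is nonempty, because \<open>z\<close>
  eventually meets \<open>root\<close>; it is upward closed, and \<open>R_left\<close> shows that it
  has no least element. This is why the bars contain their right endpoint.\<close>

lemma alive_iff_le_death:
  assumes z: "z \<in> Z - {root}" and t: "0 < t"
  shows "alive t z \<longleftrightarrow> t \<le> death z"
proof -
  define D where "D = {t. 0 < t \<and> \<not> alive t z}"
  have bdd: "bdd_below D" unfolding bdd_below_def D_def by (auto intro!: exI [of _ 0])
  obtain t0 where "t0 > 0" "R t0 z root" using Z_connected z root_in_Z by blast
  moreover have "idx root < idx z"
    using idx_root_le [of z] z root_in_Z idx_inj by (metis DiffD1 DiffD2 inj_on_eq_iff le_neq_implies_less singletonI)
  ultimately have D0: "D \<noteq> {}" using root_in_Z by (fastforce simp: D_def alive_def)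
  have up: "s \<in> D" if d: "d \<in> D" "d \<le> s" for d s
  proof -
    obtain z' where "z' \<in> Z" "R d z z'" "\<not> idx z \<le> idx z'" using d by (auto simp: D_def alive_def)
    then show ?thesis using R_mono [OF d(2)] d unfolding D_def alive_def by fastforce
  qed
  have left: "\<exists>s<d. s \<in> D" if d: "d \<in> D" for d
  proof -
    obtain z' where z': "z' \<in> Z" "R d z z'" "\<not> idx z \<le> idx z'" using d by (auto simp: D_def alive_def)
    then obtain s where "0 < s" "s < d" "R s z z'" using R_left [of d z z'] d by (auto simp: D_def)
    then show ?thesis using z' by (auto simp: D_def alive_def)
  qed
  show ?thesis
  proof
    assume a: "alive t z"
    have "t \<le> d" if "d \<in> D" for d
      using up [OF that, of t] a by (force simp: D_def)
    then show "t \<le> death z" unfolding death_def D_def [symmetric] using D0 by (intro cInf_greatest) auto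
  next
    assume le: "t \<le> death z"
    show "alive t z"
    proof (rule ccontr)
      assume "\<not> alive t z"
      then have "t \<in> D" using t by (simp add: D_def)
      then obtain s where "s < t" "s \<in> D" using left by blast
      then have "Inf D \<le> s" using bdd by (intro cInf_lower)
      then show False using le \<open>s < t\<close> by (simp add: death_def D_def)
    qed
  qed
qed

lemma ex_alive:
  assumes "0 < t" "R t x x"
  shows "\<exists>z\<in>Z. R t x z \<and> alive t z"
proof -
  have "\<exists>z. z \<in> Z \<and> R t x z" using R_Z [OF assms] by blast
  from ex_has_least_nat [of "\<lambda>z. z \<in> Z \<and> R t x z" _ idx] this
  obtain z where z: "z \<in> Z" "R t x z" "\<And>y. y \<in> Z \<Longrightarrow> R t x y \<Longrightarrow> idx z \<le> idx y" by blast
  then show ?thesis unfolding alive_def using R_trans by blast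
qed

lemma alive_unique:
  assumes "R t z z'" "z \<in> Z" "z' \<in> Z" "alive t z" "alive t z'"
  shows "z = z'"
proof -
  have "idx z = idx z'" using assms R_sym unfolding alive_def by (meson antisym)
  then show ?thesis using idx_inj assms by (meson inj_onD)
qed

text \<open>Each component holds exactly one living zero, which accounts for the \<open>Suc\<close>
  in \<open>card_zeros\<close>; the remaining zeros are the dead ones.\<close>

lemma card_dead:
  assumes t: "0 < t" and x: "R t x x"
  shows "card {z\<in>Z - {root}. R t x z \<and> death z < t} = card {i\<in>I. R t x (pt i)}"
proof -
  obtain z0 where z0: "z0 \<in> Z" "R t x z0" "alive t z0" using ex_alive [OF t x] by blast
  have "{z\<in>Z. R t x z} = insert z0 {z\<in>Z - {root}. R t x z \<and> death z < t}"
  proof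
    show "{z\<in>Z. R t x z} \<subseteq> insert z0 {z\<in>Z - {root}. R t x z \<and> death z < t}"
    proof
      fix z assume z: "z \<in> {z\<in>Z. R t x z}"
      show "z \<in> insert z0 {z\<in>Z - {root}. R t x z \<and> death z < t}"
      proof (cases "alive t z")
        case True
        then have "z = z0" using z z0 R_sym R_trans by (intro alive_unique [of t]) blast+
        then show ?thesis by simp
      next
        case False
        then have "z \<noteq> root" using alive_root by auto
        then show ?thesis using False z alive_iff_le_death [of z t] t by auto
      qed
    qed
  qed (use z0 in auto)
  moreover have "z0 \<notin> {z\<in>Z - {root}. R t x z \<and> death z < t}"
    using z0 alive_iff_le_death [of z0 t] t by auto
  moreover have "finite {z\<in>Z - {root}. R t x z \<and> death z < t}"
    by (rule finite_subset [OF _ finite_zeros [OF t x]]) auto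
  ultimately have "card {z\<in>Z. R t x z} = Suc (card {z\<in>Z - {root}. R t x z \<and> death z < t})" by simp
  then show ?thesis using card_zeros [OF t x] by simp
qed

text \<open>The count at the earlier time \<open>t\<close> is applied in every
  \<open>t\<close>-component inside the \<open>T\<close>-component of \<open>x\<close> and summed up
  by fibres. A merging point with \<open>sv i \<ge> t\<close> lies in none of these components, so
  it is correctly left out.\<close>

lemma card_dead_before:
  assumes t: "0 < t" "t \<le> T" and x: "R T x x"
  shows "card {z\<in>Z - {root}. R T x z \<and> death z < t} = card {i\<in>I. R T x (pt i) \<and> sv i < t}"
    (is "card ?A = card ?B")
proof -
  let ?K = "{{y. R t x' y} | x'. R t x' x' \<and> R T x x'}"
  have eq: "{y. R t z y} = {y. R t x' y} \<longleftrightarrow> R t x' z" if "R t x' x'" "R t z z" for x' z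
    using that R_sym R_trans by blast
  have "\<exists>f. bij_betw f ?A ?B \<and> (\<forall>z\<in>?A. {y. R t (pt (f z)) y} = {y. R t z y})"
  proof (rule bij_betw_of_fibres [of _ _ ?K])
    show "(\<lambda>z. {y. R t z y}) ` ?A \<subseteq> ?K" using Z_R [OF t(1)] by blast
    show "(\<lambda>i. {y. R t (pt i) y}) ` ?B \<subseteq> ?K" using R_pt t(1) by blast
    fix k assume "k \<in> ?K"
    then obtain x' where k: "k = {y. R t x' y}" and x': "R t x' x'" "R T x x'" by blast
    have TT: "R T x y" if "R t x' y" for y using x' R_mono [OF t(2) that] R_trans by blast
    have A: "{z\<in>?A. {y. R t z y} = k} = {z\<in>Z - {root}. R t x' z \<and> death z < t}"
      unfolding k using eq [OF x'(1)] Z_R [OF t(1)] TT by blast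
    have B: "{i\<in>?B. {y. R t (pt i) y} = k} = {i\<in>I. R t x' (pt i)}"
    proof -
      have "sv i < t \<and> R t (pt i) (pt i)" if "i \<in> I" "R t x' (pt i)" for i
        using R_pt [OF that(1) t(1)] that(2) R_sym R_trans by blast
      then show ?thesis unfolding k using eq [OF x'(1)] R_pt t(1) TT by blast
    qed
    show "\<exists>f. bij_betw f {z\<in>?A. {y. R t z y} = k} {i\<in>?B. {y. R t (pt i) y} = k}"
      unfolding A B
    proof (rule finite_same_card_bij)
      show "finite {z\<in>Z - {root}. R t x' z \<and> death z < t}"
        by (rule finite_subset [OF _ finite_zeros [OF t(1) x'(1)]]) auto
      show "finite {i\<in>I. R t x' (pt i)}" by (rule finite_pts [OF t(1) x'(1)])
      show "card {z\<in>Z - {root}. R t x' z \<and> death z < t} = card {i\<in>I. R t x' (pt i)}"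
        by (rule card_dead [OF t(1) x'(1)])
    qed
  qed
  then show ?thesis using bij_betw_same_card by blast
qed

lemma finite_dead: "0 < t \<Longrightarrow> R t x x \<Longrightarrow> finite {z\<in>Z - {root}. R t x z \<and> P z}"
  by (rule finite_subset [OF _ finite_zeros]) auto

lemma finite_pts': "0 < t \<Longrightarrow> R t x x \<Longrightarrow> finite {i\<in>I. R t x (pt i) \<and> P i}"
  by (rule finite_subset [OF _ finite_pts]) auto

text \<open>As an infimum of positive times, \<open>death z\<close> might be 0. Only finitely many
  merging points belong to the component of \<open>z\<close> at time 1, so before the smallest of
  their values nothing dies there.\<close>

lemma death_pos:
  assumes z: "z \<in> Z - {root}"
  shows "0 < death z"
proof (rule ccontr)
  assume d: "\<not> 0 < death z"
  have z1: "R 1 z z" using z by (intro Z_R) auto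
  define t where "t = Min (insert 1 (sv ` {i\<in>I. R 1 z (pt i)}))"
  have fin: "finite (insert 1 (sv ` {i\<in>I. R 1 z (pt i)}))" using finite_pts [OF _ z1] by simp
  have t: "0 < t" "t \<le> 1" unfolding t_def using fin sv_pos by (auto simp del: finite_insert)
  have "\<And>i. i \<in> I \<Longrightarrow> R 1 z (pt i) \<Longrightarrow> t \<le> sv i" unfolding t_def using fin by (intro Min_le) auto
  then have "{i\<in>I. R 1 z (pt i) \<and> sv i < t} = {}" by force
  then have "card {y\<in>Z - {root}. R 1 z y \<and> death y < t} = 0" using card_dead_before [OF t z1] by (simp only: card.empty)
  moreover have "z \<in> {y\<in>Z - {root}. R 1 z y \<and> death y < t}" using z z1 d t by auto
  ultimately show False using finite_dead [OF _ z1, of "\<lambda>y. death y < t"] by auto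
qed

text \<open>A difference of two counts up to times \<open>d\<close> and slightly beyond
  \<open>d\<close>, both made in the component of \<open>x\<close> at one fixed later time. Any
  later time would do; \<open>d + 1\<close> is merely convenient.\<close>

lemma card_death_eq:
  assumes d: "0 < d" and x: "R (d + 1) x x"
  shows "card {z\<in>Z - {root}. R (d + 1) x z \<and> death z = d} = card {i\<in>I. R (d + 1) x (pt i) \<and> sv i = d}"
proof -
  let ?T = "d + 1"
  let ?V = "death ` {z\<in>Z - {root}. R ?T x z} \<union> sv ` {i\<in>I. R ?T x (pt i)}"
  have T: "0 < ?T" using d by simp
  have "finite {z\<in>Z - {root}. R ?T x z}"
    by (rule finite_subset [OF _ finite_zeros [OF T x]]) auto
  then have fin: "finite (insert ?T {v\<in>?V. d < v})" using finite_pts [OF T x] by simp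
  \<comment> \<open>The next event after \<open>d\<close> in this component, capped at
    \<open>d + 1\<close>: between \<open>d\<close> and \<open>t\<close> there is neither a death nor
    a merging value.\<close>
  define t where "t = Min (insert ?T {v\<in>?V. d < v})"
  have t: "d < t" "t \<le> ?T" unfolding t_def using fin by (auto simp del: finite_insert)
  have le: "v \<le> d" if "v \<in> ?V" "v < t" for v
  proof (rule ccontr)
    assume "\<not> v \<le> d"
    then have "t \<le> v" unfolding t_def using that(1) fin by (intro Min_le) auto
    then show False using that(2) by simp
  qed
  have A: "{z\<in>Z - {root}. R ?T x z \<and> death z = d} =
     {z\<in>Z - {root}. R ?T x z \<and> death z < t} - {z\<in>Z - {root}. R ?T x z \<and> death z < d}"
  proof -
    have "death z = d \<longleftrightarrow> death z < t \<and> \<not> death z < d" if "z \<in> Z - {root}" "R ?T x z" for z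
      using le [of "death z"] that t by force
    then show ?thesis by blast
  qed
  have B: "{i\<in>I. R ?T x (pt i) \<and> sv i = d} =
     {i\<in>I. R ?T x (pt i) \<and> sv i < t} - {i\<in>I. R ?T x (pt i) \<and> sv i < d}"
  proof -
    have "sv i = d \<longleftrightarrow> sv i < t \<and> \<not> sv i < d" if "i \<in> I" "R ?T x (pt i)" for i
      using le [of "sv i"] that t by force
    then show ?thesis by blast
  qed
  have "card {z\<in>Z - {root}. R ?T x z \<and> death z = d} =
     card {z\<in>Z - {root}. R ?T x z \<and> death z < t} - card {z\<in>Z - {root}. R ?T x z \<and> death z < d}"
    unfolding A by (rule card_Diff_subset [OF finite_dead [OF T x]]) (use t in auto)
  also have "\<dots> = card {i\<in>I. R ?T x (pt i) \<and> sv i < t} - card {i\<in>I. R ?T x (pt i) \<and> sv i < d}"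
    using card_dead_before [OF _ t(2) x] card_dead_before [of d ?T x] d t x by simp
  also have "\<dots> = card {i\<in>I. R ?T x (pt i) \<and> sv i = d}"
    unfolding B by (rule card_Diff_subset [OF finite_pts' [OF T x], symmetric]) (use t in auto)
  finally show ?thesis .
qed

lemma ex_bij_death:
  "\<exists>\<beta>. bij_betw \<beta> I (Z - {root}) \<and> (\<forall>i\<in>I. death (\<beta> i) = sv i)"
proof -
  let ?p = "\<lambda>i. (sv i, {y. R (sv i + 1) (pt i) y})"
  let ?q = "\<lambda>z. (death z, {y. R (death z + 1) z y})"
  \<comment> \<open>Components are taken later than \<open>d\<close> because at time
    \<open>d\<close> itself a merging point of value \<open>d\<close> does not yet belong to the
    sublevel set.\<close>
  let ?K = "{(d, {y. R (d + 1) x y}) | d x. 0 < d \<and> R (d + 1) x x}"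
  have eq: "{y. R t z y} = {y. R t x' y} \<longleftrightarrow> R t x' z" if "R t x' x'" "R t z z" for t x' z
    using that R_sym R_trans by blast
  have pt1: "R (sv i + 1) (pt i) (pt i)" if "i \<in> I" for i
    using R_pt [OF that, of "sv i + 1"] sv_pos [OF that] by simp
  have z1: "R (death z + 1) z z" if "z \<in> Z - {root}" for z
    using death_pos [OF that] that by (intro Z_R) auto
  have "\<exists>\<beta>. bij_betw \<beta> I (Z - {root}) \<and> (\<forall>i\<in>I. ?q (\<beta> i) = ?p i)"
  proof (rule bij_betw_of_fibres [of _ _ ?K])
    show "?p ` I \<subseteq> ?K" using pt1 sv_pos by blast
    show "?q ` (Z - {root}) \<subseteq> ?K" using z1 death_pos by blast
    fix k assume "k \<in> ?K"
    then obtain d x where k: "k = (d, {y. R (d + 1) x y})" and d: "0 < d" and x: "R (d + 1) x x" by blast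
    have A: "{i\<in>I. ?p i = k} = {i\<in>I. R (d + 1) x (pt i) \<and> sv i = d}"
      unfolding k using eq [OF x] pt1 by auto
    have B: "{z\<in>Z - {root}. ?q z = k} = {z\<in>Z - {root}. R (d + 1) x z \<and> death z = d}"
      unfolding k using eq [OF x] z1 by auto
    have "0 < d + 1" using d by simp
    then show "\<exists>f. bij_betw f {i\<in>I. ?p i = k} {z\<in>Z - {root}. ?q z = k}"
      unfolding A B using finite_dead [OF _ x] finite_pts' [OF _ x] card_death_eq [OF d x]
      by (intro finite_same_card_bij) simp_all
  qed
  then show ?thesis by auto
qed

text \<open>The component of \<open>z\<close> at the moment before it merges into an older one.\<close>

definition basin :: "'a \<Rightarrow> 'a \<Rightarrow> bool" where "basin z x \<longleftrightarrow> z = root \<or> R (death z) z x"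

text \<open>While \<open>z\<close> is alive, the time has not passed \<open>death z\<close>, so
  every current component is either inside the basin or disjoint from it. This lets the mass in the
  basin descend to homology.\<close>

lemma basin_cong:
  assumes "z \<in> Z" "0 < t" "alive t z" "R t x y"
  shows "basin z x \<longleftrightarrow> basin z y"
proof (cases "z = root")
  case False
  then have "t \<le> death z" using assms alive_iff_le_death by simp
  then have "R (death z) x y" using R_mono assms(4) by blast
  then show ?thesis using R_sym R_trans unfolding basin_def by blast
qed (simp add: basin_def)

lemma basin_self: "z \<in> Z \<Longrightarrow> basin z z"
  unfolding basin_def using Z_R death_pos by blast

text \<open>The source of triangularity: \<open>z\<close> is still alive at its own death time,
  hence oldest in its basin.\<close>

lemma idx_le_of_basin:
  assumes "z \<in> Z" "z' \<in> Z" "basin z z'"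
  shows "idx z \<le> idx z'"
proof (cases "z = root")
  case False
  then have "alive (death z) z" using assms alive_iff_le_death death_pos by simp
  then show ?thesis using assms False unfolding basin_def alive_def by blast
qed (use assms idx_root_le in simp)

text \<open>A zero \<open>y\<close> in the component of \<open>x\<close> lies in each of these
  basins, and only finitely many zeros have index at most \<open>idx y\<close>.\<close>

lemma finite_basin:
  assumes t: "0 < t" and x: "R t x x"
  shows "finite {z\<in>Z. alive t z \<and> basin z x}"
proof -
  obtain y where y: "y \<in> Z" "R t x y" using R_Z [OF t x] by blast
  have "finite {z\<in>Z. idx z \<le> idx y}"
    by (rule finite_imageD [of idx]) (use idx_inj in \<open>auto intro: finite_subset [of _ "{..idx y}"] inj_on_subset\<close>)
  moreover have "{z\<in>Z. alive t z \<and> basin z x} \<subseteq> {z\<in>Z. idx z \<le> idx y}"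
    using y basin_cong [OF _ t] idx_le_of_basin by blast
  ultimately show ?thesis by (rule rev_finite_subset)
qed

end

section \<open>Persistence modules presented by filtered modules\<close>

text \<open>The module axioms pass to any surjective image respecting the operations, so neither
  homology nor the bar spaces need them checked directly.\<close>

lemma module_surj_image:
  assumes M: "module F M"
    and car: "carrier Q = q ` carrier M"
    and add: "\<And>x y. x \<in> carrier M \<Longrightarrow> y \<in> carrier M \<Longrightarrow> q (x \<oplus>\<^bsub>M\<^esub> y) = q x \<oplus>\<^bsub>Q\<^esub> q y"
    and zero: "q \<zero>\<^bsub>M\<^esub> = \<zero>\<^bsub>Q\<^esub>"
    and smult: "\<And>a x. a \<in> carrier F \<Longrightarrow> x \<in> carrier M \<Longrightarrow> q (a \<odot>\<^bsub>M\<^esub> x) = a \<odot>\<^bsub>Q\<^esub> q x"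
  shows "module F Q"
proof -
  interpret module F M by (rule M)
  note simps = add [symmetric] zero [symmetric] smult [symmetric]
  show ?thesis
  proof (rule moduleI)
    show "cring F" by (rule R.is_cring)
    show "abelian_group Q"
    proof (rule abelian_groupI)
      show "\<exists>y\<in>carrier Q. y \<oplus>\<^bsub>Q\<^esub> x = \<zero>\<^bsub>Q\<^esub>" if x: "x \<in> carrier Q" for x
      proof -
        obtain u where u: "u \<in> carrier M" "x = q u" using x car by blast
        have "q (\<ominus>\<^bsub>M\<^esub> u) \<oplus>\<^bsub>Q\<^esub> x = \<zero>\<^bsub>Q\<^esub>" using u by (simp add: simps M.l_neg)
        moreover have "q (\<ominus>\<^bsub>M\<^esub> u) \<in> carrier Q" using u car by simp
        ultimately show ?thesis by blast
      qed
    qed (auto simp: car simps M.a_ac)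
  qed (auto simp: car simps smult_l_distr smult_r_distr smult_assoc1)
qed

lemma quotient_module_projection:
  fixes M :: "('f, 'v, 'm) module_scheme"
  assumes M: "module F M" and N: "submodule N F M"
  defines "q \<equiv> \<lambda>x. N +>\<^bsub>M\<^esub> x" and "Q \<equiv> quotient_module M N"
  shows "carrier Q = q ` carrier M"
    and "\<And>x y. x \<in> carrier M \<Longrightarrow> y \<in> carrier M \<Longrightarrow> q (x \<oplus>\<^bsub>M\<^esub> y) = q x \<oplus>\<^bsub>Q\<^esub> q y"
    and "q \<zero>\<^bsub>M\<^esub> = \<zero>\<^bsub>Q\<^esub>"
    and "\<And>a x. a \<in> carrier F \<Longrightarrow> x \<in> carrier M \<Longrightarrow> q (a \<odot>\<^bsub>M\<^esub> x) = a \<odot>\<^bsub>Q\<^esub> q x"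
    and "\<And>x y. x \<in> carrier M \<Longrightarrow> y \<in> carrier M \<Longrightarrow> q x = q y \<longleftrightarrow> x \<ominus>\<^bsub>M\<^esub> y \<in> N"
proof -
  interpret module F M by (rule M)
  have sub: "additive_subgroup N M"
    using N submodule.axioms(1) additive_subgroupI by blast
  interpret abelian_subgroup N M
    by (rule abelian_subgroupI3 [OF sub]) (rule M.abelian_group_axioms)
  note E = submoduleE [OF N]
  show "carrier Q = q ` carrier M"
    by (auto simp: Q_def q_def quotient_module_def A_RCOSETS_def')
  show "q (x \<oplus>\<^bsub>M\<^esub> y) = q x \<oplus>\<^bsub>Q\<^esub> q y" if "x \<in> carrier M" "y \<in> carrier M" for x y
    using a_rcos_sum [OF that] by (simp add: Q_def q_def quotient_module_def)
  show "q \<zero>\<^bsub>M\<^esub> = \<zero>\<^bsub>Q\<^esub>"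
    using M.a_coset_add_zero [of N] E(1) by (simp add: Q_def q_def quotient_module_def)
  show "q (a \<odot>\<^bsub>M\<^esub> x) = a \<odot>\<^bsub>Q\<^esub> q x" if a: "a \<in> carrier F" and x: "x \<in> carrier M" for a x
  proof -
    have eq: "n \<oplus>\<^bsub>M\<^esub> a \<odot>\<^bsub>M\<^esub> (n' \<oplus>\<^bsub>M\<^esub> x) = (n \<oplus>\<^bsub>M\<^esub> a \<odot>\<^bsub>M\<^esub> n') \<oplus>\<^bsub>M\<^esub> a \<odot>\<^bsub>M\<^esub> x"
      if "n \<in> N" "n' \<in> N" for n n'
      using that E(1) a x by (simp add: subsetD smult_r_distr M.a_assoc)
    \<comment> \<open>The summand \<open>N\<close> matters for the zero scalar, where the scaled
      coset alone would shrink to a single element.\<close>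
    have "N <+>\<^bsub>M\<^esub> (\<lambda>x. a \<odot>\<^bsub>M\<^esub> x) ` (N +>\<^bsub>M\<^esub> x) = N +>\<^bsub>M\<^esub> (a \<odot>\<^bsub>M\<^esub> x)"
    proof
      show "N <+>\<^bsub>M\<^esub> (\<lambda>x. a \<odot>\<^bsub>M\<^esub> x) ` (N +>\<^bsub>M\<^esub> x) \<subseteq> N +>\<^bsub>M\<^esub> (a \<odot>\<^bsub>M\<^esub> x)"
      proof
        fix u assume "u \<in> N <+>\<^bsub>M\<^esub> (\<lambda>x. a \<odot>\<^bsub>M\<^esub> x) ` (N +>\<^bsub>M\<^esub> x)"
        then obtain n n' where n: "n \<in> N" "n' \<in> N" "u = n \<oplus>\<^bsub>M\<^esub> a \<odot>\<^bsub>M\<^esub> (n' \<oplus>\<^bsub>M\<^esub> x)"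
          unfolding set_add_def' a_r_coset_def' by blast
        have "n \<oplus>\<^bsub>M\<^esub> a \<odot>\<^bsub>M\<^esub> n' \<in> N" by (rule E(5) [OF n(1) E(4) [OF a n(2)]])
        then show "u \<in> N +>\<^bsub>M\<^esub> (a \<odot>\<^bsub>M\<^esub> x)" unfolding a_r_coset_def' using n eq by blast
      qed
      show "N +>\<^bsub>M\<^esub> (a \<odot>\<^bsub>M\<^esub> x) \<subseteq> N <+>\<^bsub>M\<^esub> (\<lambda>x. a \<odot>\<^bsub>M\<^esub> x) ` (N +>\<^bsub>M\<^esub> x)"
      proof
        fix u assume "u \<in> N +>\<^bsub>M\<^esub> (a \<odot>\<^bsub>M\<^esub> x)"
        then obtain n where n: "n \<in> N" "u = n \<oplus>\<^bsub>M\<^esub> a \<odot>\<^bsub>M\<^esub> x" unfolding a_r_coset_def' by blast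
        then have "u = n \<oplus>\<^bsub>M\<^esub> a \<odot>\<^bsub>M\<^esub> (\<zero>\<^bsub>M\<^esub> \<oplus>\<^bsub>M\<^esub> x)" using x by simp
        moreover have "\<zero>\<^bsub>M\<^esub> \<in> N" by (rule zero_closed)
        ultimately show "u \<in> N <+>\<^bsub>M\<^esub> (\<lambda>x. a \<odot>\<^bsub>M\<^esub> x) ` (N +>\<^bsub>M\<^esub> x)"
          unfolding set_add_def' a_r_coset_def' using n(1) by blast
      qed
    qed
    then show ?thesis by (simp add: Q_def q_def quotient_module_def)
  qed
  show "q x = q y \<longleftrightarrow> x \<ominus>\<^bsub>M\<^esub> y \<in> N" if x: "x \<in> carrier M" and y: "y \<in> carrier M" for x y
  proof
    assume "q x = q y"
    then have "x \<in> N +>\<^bsub>M\<^esub> y" using a_rcos_self [OF x] by (simp add: q_def)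
    then obtain n where "n \<in> N" "x = n \<oplus>\<^bsub>M\<^esub> y" unfolding a_r_coset_def' by blast
    then show "x \<ominus>\<^bsub>M\<^esub> y \<in> N" using y E(1) by (simp add: M.minus_eq M.a_assoc M.r_neg subsetD)
  next
    assume n: "x \<ominus>\<^bsub>M\<^esub> y \<in> N"
    have "x = (x \<ominus>\<^bsub>M\<^esub> y) \<oplus>\<^bsub>M\<^esub> y" using x y by (simp add: M.minus_eq M.a_assoc M.l_neg)
    then have "x \<in> N +>\<^bsub>M\<^esub> y" unfolding a_r_coset_def' using n by blast
    then show "q x = q y" unfolding q_def using y a_repr_independence' by simp
  qed
qed

text \<open>The spaces increase inside one type with common operations, so a chain existing at time
  \<open>s\<close> is literally the same element at all later times.\<close>

locale module_filtration = field F
  for F :: "('f, 'r) ring_scheme" and C :: "real \<Rightarrow> ('f, 'v) module" +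
  assumes module_C: "module F (C t)"
    and carrier_mono: "s \<le> t \<Longrightarrow> carrier (C s) \<subseteq> carrier (C t)"
    and add_eq: "s \<le> t \<Longrightarrow> add (C s) = add (C t)"
    and smult_eq: "s \<le> t \<Longrightarrow> smult (C s) = smult (C t)"
    and trivial_below: "\<exists>t0. \<forall>t\<le>t0. carrier (C t) = {\<zero>\<^bsub>C t\<^esub>}"
begin

text \<open>A presentation of \<open>V\<close> as a levelwise quotient of the filtration: the last
  clause says that the structure maps are induced by the inclusions.\<close>

definition covers :: "('f, 'w) persistence \<Rightarrow> (real \<Rightarrow> 'v \<Rightarrow> 'w) \<Rightarrow> bool"
  where "covers V q \<longleftrightarrow>
    (\<forall>t. carrier (space_at V t) = q t ` carrier (C t)) \<and>
    (\<forall>t. \<forall>x\<in>carrier (C t). \<forall>y\<in>carrier (C t). q t (x \<oplus>\<^bsub>C t\<^esub> y) = q t x \<oplus>\<^bsub>space_at V t\<^esub> q t y) \<and>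
    (\<forall>t. q t \<zero>\<^bsub>C t\<^esub> = \<zero>\<^bsub>space_at V t\<^esub>) \<and>
    (\<forall>t. \<forall>a\<in>carrier F. \<forall>x\<in>carrier (C t). q t (a \<odot>\<^bsub>C t\<^esub> x) = a \<odot>\<^bsub>space_at V t\<^esub> q t x) \<and>
    (\<forall>s t. s \<le> t \<longrightarrow> (\<forall>x\<in>carrier (C s). map_at V s t (q s x) = q t x))"

lemma coversD:
  assumes "covers V q"
  shows "carrier (space_at V t) = q t ` carrier (C t)"
    and "x \<in> carrier (C t) \<Longrightarrow> y \<in> carrier (C t) \<Longrightarrow> q t (x \<oplus>\<^bsub>C t\<^esub> y) = q t x \<oplus>\<^bsub>space_at V t\<^esub> q t y"
    and "q t \<zero>\<^bsub>C t\<^esub> = \<zero>\<^bsub>space_at V t\<^esub>"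
    and "a \<in> carrier F \<Longrightarrow> x \<in> carrier (C t) \<Longrightarrow> q t (a \<odot>\<^bsub>C t\<^esub> x) = a \<odot>\<^bsub>space_at V t\<^esub> q t x"
    and "s \<le> t \<Longrightarrow> x \<in> carrier (C s) \<Longrightarrow> map_at V s t (q s x) = q t x"
  using assms unfolding covers_def by simp_all

lemma add_closed: "x \<in> carrier (C t) \<Longrightarrow> y \<in> carrier (C t) \<Longrightarrow> x \<oplus>\<^bsub>C t\<^esub> y \<in> carrier (C t)"
  using module_C [of t] by (simp add: module_def abelian_group_def abelian_monoid.a_closed)

lemma persistence_module_of_covers:
  assumes V: "covers V q"
  shows "persistence_module F V"
proof (intro persistence_module.intro persistence_module_axioms.intro)
  show "field F" by unfold_locales
  note V = coversD [OF V]
  show "module F (space_at V t)" for t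
    using V(2,3,4) by (intro module_surj_image [OF module_C V(1)]) auto
  fix s t r :: real
  assume st: "s \<le> t"
  have C: "x \<in> carrier (C t)" if "x \<in> carrier (C s)" for x using carrier_mono [OF st] that by blast
  show "map_at V s t \<in> linear_maps F (space_at V s) (space_at V t)"
    unfolding linear_maps_def
  proof (intro CollectI conjI ballI)
    show "map_at V s t \<in> carrier (space_at V s) \<rightarrow> carrier (space_at V t)"
      using V(1) V(5) [OF st] C by auto
    fix v assume "v \<in> carrier (space_at V s)"
    then obtain x where x: "x \<in> carrier (C s)" "v = q s x" using V(1) by blast
    {
      fix w assume "w \<in> carrier (space_at V s)"
      then obtain y where y: "y \<in> carrier (C s)" "w = q s y" using V(1) by blast
      have "map_at V s t (v \<oplus>\<^bsub>space_at V s\<^esub> w) = q t (x \<oplus>\<^bsub>C s\<^esub> y)"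
        using V(5) [OF st] x y add_closed by (simp add: V(2) [symmetric])
      then show "map_at V s t (v \<oplus>\<^bsub>space_at V s\<^esub> w) = map_at V s t v \<oplus>\<^bsub>space_at V t\<^esub> map_at V s t w"
        using V(5) [OF st] x y C by (simp add: V(2) add_eq [OF st])
    }
    fix a assume a: "a \<in> carrier F"
    have "map_at V s t (a \<odot>\<^bsub>space_at V s\<^esub> v) = q t (a \<odot>\<^bsub>C s\<^esub> x)"
      using V(5) [OF st] x a module.smult_closed [OF module_C] by (simp add: V(4) [symmetric])
    then show "map_at V s t (a \<odot>\<^bsub>space_at V s\<^esub> v) = a \<odot>\<^bsub>space_at V t\<^esub> map_at V s t v"
      using V(5) [OF st] x a C by (simp add: V(4) smult_eq [OF st])
  qed
  show "map_at V s r x = map_at V t r (map_at V s t x)" if "t \<le> r" "x \<in> carrier (space_at V s)" for x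
    using that st V(1) V(5) C by auto
next
  note V = coversD [OF V]
  show "map_at V t t x = x" if "x \<in> carrier (space_at V t)" for t x
    using that V(1,5) by auto
  obtain t0 where t0: "\<And>t. t \<le> t0 \<Longrightarrow> carrier (C t) = {\<zero>\<^bsub>C t\<^esub>}" using trivial_below by blast
  have "carrier (space_at V t) = {\<zero>\<^bsub>space_at V t\<^esub>}" if "t \<le> t0" for t
    using V(1,3) t0 [OF that] by simp
  then show "\<exists>t0. \<forall>t\<le>t0. carrier (space_at V t) = {\<zero>\<^bsub>space_at V t\<^esub>}" by blast
qed

text \<open>Two presentations that identify the same elements differ by a levelwise bijection;
  linearity and naturality are inherited from the common source.\<close>

lemma persistence_isomorphic_of_covers:
  assumes V: "covers V q" and W: "covers W p"
    and eq: "\<And>t x y. x \<in> carrier (C t) \<Longrightarrow> y \<in> carrier (C t) \<Longrightarrow> q t x = q t y \<longleftrightarrow> p t x = p t y"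
  shows "persistence_isomorphic F V W"
proof -
  note VD = coversD [OF V] and WD = coversD [OF W]
  \<comment> \<open>An arbitrary representative is chosen; \<open>eq\<close> makes the result
    independent of it.\<close>
  define \<phi> where "\<phi> = (\<lambda>t v. p t (SOME x. x \<in> carrier (C t) \<and> q t x = v))"
  have \<phi>: "\<phi> t (q t x) = p t x" if "x \<in> carrier (C t)" for t x
  proof -
    let ?y = "SOME y. y \<in> carrier (C t) \<and> q t y = q t x"
    have y: "?y \<in> carrier (C t) \<and> q t ?y = q t x"
      by (rule someI [of "\<lambda>y. y \<in> carrier (C t) \<and> q t y = q t x" x]) (use that in simp)
    then show ?thesis unfolding \<phi>_def using eq [of ?y t x] y that by blast
  qed
  have "persistence_morphism F V W \<phi>"
    unfolding persistence_morphism_def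
  proof (intro conjI allI impI ballI)
    fix t
    show "\<phi> t \<in> linear_maps F (space_at V t) (space_at W t)"
      unfolding linear_maps_def
    proof (intro CollectI conjI ballI)
      show "\<phi> t \<in> carrier (space_at V t) \<rightarrow> carrier (space_at W t)"
        using VD(1) WD(1) \<phi> by auto
      fix v assume "v \<in> carrier (space_at V t)"
      then obtain x where x: "x \<in> carrier (C t)" "v = q t x" using VD(1) by blast
      {
        fix w assume "w \<in> carrier (space_at V t)"
        then obtain y where y: "y \<in> carrier (C t)" "w = q t y" using VD(1) by blast
        show "\<phi> t (v \<oplus>\<^bsub>space_at V t\<^esub> w) = \<phi> t v \<oplus>\<^bsub>space_at W t\<^esub> \<phi> t w"
          using x y add_closed [OF x(1) y(1)] by (simp add: VD(2) [symmetric] \<phi> WD(2))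
      }
      fix a assume "a \<in> carrier F"
      then show "\<phi> t (a \<odot>\<^bsub>space_at V t\<^esub> v) = a \<odot>\<^bsub>space_at W t\<^esub> \<phi> t v"
        using x module.smult_closed [OF module_C, of a x t] by (simp add: VD(4) [symmetric] \<phi> WD(4))
    qed
  next
    fix s t :: real and v assume st: "s \<le> t" and "v \<in> carrier (space_at V s)"
    then obtain x where x: "x \<in> carrier (C s)" "v = q s x" using VD(1) by blast
    moreover have "x \<in> carrier (C t)" using carrier_mono [OF st] x by blast
    ultimately show "\<phi> t (map_at V s t v) = map_at W s t (\<phi> s v)"
      by (simp add: \<phi> VD(5) [OF st] WD(5) [OF st])
  qed
  moreover have "bij_betw (\<phi> t) (carrier (space_at V t)) (carrier (space_at W t))" for t
    unfolding bij_betw_def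
  proof
    show "inj_on (\<phi> t) (carrier (space_at V t))"
      unfolding VD(1) by (auto intro!: inj_onI simp: \<phi> eq)
    show "\<phi> t ` carrier (space_at V t) = carrier (space_at W t)"
      unfolding VD(1) WD(1) image_image using \<phi> by (auto intro!: image_cong)
  qed
  ultimately show ?thesis
    unfolding persistence_isomorphic_def
    using persistence_module_of_covers [OF V] persistence_module_of_covers [OF W] by blast
qed

end

section \<open>Chains of degree zero\<close>

context cring
begin

definition fsupp :: "('s \<Rightarrow> 'a) \<Rightarrow> bool"
  where "fsupp c \<longleftrightarrow> (\<forall>\<sigma>. c \<sigma> \<in> carrier R) \<and> finite {\<sigma>. c \<sigma> \<noteq> \<zero>}"

text \<open>The total coefficient on the simplices satisfying \<open>Q\<close>. Both
  \<open>push_chain\<close> and the bar coordinates are of this form, so linearity is proved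
  once.\<close>

definition csum :: "('s \<Rightarrow> bool) \<Rightarrow> ('s \<Rightarrow> 'a) \<Rightarrow> 'a"
  where "csum Q c = (\<Oplus>\<sigma>\<in>{\<sigma>. c \<sigma> \<noteq> \<zero> \<and> Q \<sigma>}. c \<sigma>)"

lemma csum_superset:
  assumes "fsupp c" "finite S" "{\<sigma>. c \<sigma> \<noteq> \<zero>} \<subseteq> S"
  shows "csum Q c = (\<Oplus>\<sigma>\<in>S. if Q \<sigma> then c \<sigma> else \<zero>)"
  unfolding csum_def
  by (rule add.finprod_mono_neutral_cong_left) (use assms in \<open>auto simp: fsupp_def\<close>)

lemma csum_closed [simp]: "fsupp c \<Longrightarrow> csum Q c \<in> carrier R"
  unfolding csum_def by (intro finsum_closed) (auto simp: fsupp_def)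

lemma csum_zero [simp]: "csum Q (\<lambda>_. \<zero>) = \<zero>"
  by (simp add: csum_def)

lemma fsupp_zero [simp]: "fsupp (\<lambda>_. \<zero>)"
  by (simp add: fsupp_def)

lemma fsupp_add [simp]:
  assumes "fsupp c" "fsupp d"
  shows "fsupp (\<lambda>\<sigma>. c \<sigma> \<oplus> d \<sigma>)"
proof -
  have "{\<sigma>. c \<sigma> \<oplus> d \<sigma> \<noteq> \<zero>} \<subseteq> {\<sigma>. c \<sigma> \<noteq> \<zero>} \<union> {\<sigma>. d \<sigma> \<noteq> \<zero>}"
    using assms by (auto simp: fsupp_def)
  then show ?thesis
    using assms finite_subset unfolding fsupp_def by (blast intro: a_closed)
qed

lemma fsupp_smult [simp]:
  assumes "fsupp c" "a \<in> carrier R"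
  shows "fsupp (\<lambda>\<sigma>. a \<otimes> c \<sigma>)"
proof -
  have "{\<sigma>. a \<otimes> c \<sigma> \<noteq> \<zero>} \<subseteq> {\<sigma>. c \<sigma> \<noteq> \<zero>}" using assms by (auto simp: fsupp_def)
  then show ?thesis
    using assms finite_subset unfolding fsupp_def by (blast intro: m_closed)
qed

lemma fsupp_upd [simp]:
  assumes "fsupp c" "a \<in> carrier R"
  shows "fsupp (c(\<sigma> := a))"
proof -
  have "{\<tau>. (c(\<sigma> := a)) \<tau> \<noteq> \<zero>} \<subseteq> insert \<sigma> {\<tau>. c \<tau> \<noteq> \<zero>}" by auto
  then have "finite {\<tau>. (c(\<sigma> := a)) \<tau> \<noteq> \<zero>}"
    by (rule finite_subset) (use assms in \<open>simp add: fsupp_def\<close>)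
  then show ?thesis using assms by (simp add: fsupp_def)
qed

lemma csum_add:
  assumes c: "fsupp c" and d: "fsupp d"
  shows "csum Q (\<lambda>\<sigma>. c \<sigma> \<oplus> d \<sigma>) = csum Q c \<oplus> csum Q d"
proof -
  let ?S = "{\<sigma>. c \<sigma> \<noteq> \<zero>} \<union> {\<sigma>. d \<sigma> \<noteq> \<zero>}"
  have fin: "finite ?S" using c d by (simp add: fsupp_def)
  have S: "{\<sigma>. c \<sigma> \<oplus> d \<sigma> \<noteq> \<zero>} \<subseteq> ?S" using c d by (auto simp: fsupp_def)
  have car: "c \<sigma> \<in> carrier R" "d \<sigma> \<in> carrier R" for \<sigma> using c d by (auto simp: fsupp_def)
  have "csum Q (\<lambda>\<sigma>. c \<sigma> \<oplus> d \<sigma>) = (\<Oplus>\<sigma>\<in>?S. (if Q \<sigma> then c \<sigma> else \<zero>) \<oplus> (if Q \<sigma> then d \<sigma> else \<zero>))"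
    unfolding csum_superset [OF fsupp_add [OF c d] fin S]
    by (rule finsum_cong') (auto simp: car)
  also have "\<dots> = (\<Oplus>\<sigma>\<in>?S. if Q \<sigma> then c \<sigma> else \<zero>) \<oplus> (\<Oplus>\<sigma>\<in>?S. if Q \<sigma> then d \<sigma> else \<zero>)"
    by (rule finsum_addf) (auto simp: car)
  also have "\<dots> = csum Q c \<oplus> csum Q d"
    by (subst (1 2) csum_superset [OF _ fin]) (use c d in auto)
  finally show ?thesis .
qed

lemma csum_smult:
  assumes c: "fsupp c" and a: "a \<in> carrier R"
  shows "csum Q (\<lambda>\<sigma>. a \<otimes> c \<sigma>) = a \<otimes> csum Q c"
proof -
  let ?S = "{\<sigma>. c \<sigma> \<noteq> \<zero>}"
  have fin: "finite ?S" using c by (simp add: fsupp_def)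
  have S: "{\<sigma>. a \<otimes> c \<sigma> \<noteq> \<zero>} \<subseteq> ?S" using a by auto
  have car: "c \<sigma> \<in> carrier R" for \<sigma> using c by (auto simp: fsupp_def)
  have "csum Q (\<lambda>\<sigma>. a \<otimes> c \<sigma>) = (\<Oplus>\<sigma>\<in>?S. a \<otimes> (if Q \<sigma> then c \<sigma> else \<zero>))"
    unfolding csum_superset [OF fsupp_smult [OF c a] fin S]
    by (rule finsum_cong') (use a in \<open>auto simp: car\<close>)
  also have "\<dots> = a \<otimes> csum Q c"
    unfolding csum_superset [OF c fin order_refl]
    by (rule finsum_rdistr [symmetric]) (use fin a car in auto)
  finally show ?thesis .
qed

lemma csum_cong:
  "(\<And>\<sigma>. c \<sigma> \<noteq> \<zero> \<Longrightarrow> Q \<sigma> \<longleftrightarrow> Q' \<sigma>) \<Longrightarrow> csum Q c = csum Q' c"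
  unfolding csum_def by (metis (mono_tags, lifting) Collect_cong)

lemma csum_delta:
  assumes "a \<in> carrier R"
  shows "csum Q (\<lambda>\<tau>. if \<tau> = \<sigma> then a else \<zero>) = (if Q \<sigma> then a else \<zero>)"
proof (cases "Q \<sigma> \<and> a \<noteq> \<zero>")
  case True
  then have "{\<tau>. (if \<tau> = \<sigma> then a else \<zero>) \<noteq> \<zero> \<and> Q \<tau>} = {\<sigma>}" by auto
  then show ?thesis using True assms by (simp add: csum_def)
next
  case False
  then have "{\<tau>. (if \<tau> = \<sigma> then a else \<zero>) \<noteq> \<zero> \<and> Q \<tau>} = {}" by auto
  then show ?thesis using False by (simp add: csum_def del: Collect_empty_eq)
qed

lemma fsupp_delta [simp]: "a \<in> carrier R \<Longrightarrow> fsupp (\<lambda>\<tau>. if \<tau> = \<sigma> then a else \<zero>)"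
  using fsupp_upd [OF fsupp_zero, of a \<sigma>] by (simp add: fun_upd_def)

text \<open>A finitely supported chain is built up one simplex at a time, so a linear identity needs
  checking only on a single simplex.\<close>

lemma fsupp_induct [consumes 1, case_names zero add]:
  assumes "fsupp c" and "P (\<lambda>_. \<zero>)"
    and step: "\<And>c \<sigma> a. fsupp c \<Longrightarrow> a \<in> carrier R \<Longrightarrow> P c \<Longrightarrow> P (\<lambda>\<tau>. (if \<tau> = \<sigma> then a else \<zero>) \<oplus> c \<tau>)"
  shows "P c"
proof -
  have "\<forall>c. fsupp c \<and> {\<sigma>. c \<sigma> \<noteq> \<zero>} \<subseteq> S \<longrightarrow> P c" if "finite S" for S
    using that
  proof (induction S rule: finite_induct)
    case empty
    then show ?case using assms(2) by (auto simp: fun_eq_iff [symmetric])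
  next
    case (insert \<sigma> S)
    show ?case
    proof (intro allI impI, elim conjE)
      fix c assume c: "fsupp c" and S: "{\<sigma>. c \<sigma> \<noteq> \<zero>} \<subseteq> insert \<sigma> S"
      let ?d = "c(\<sigma> := \<zero>)"
      have d: "fsupp ?d" using c by simp
      moreover have "{\<tau>. ?d \<tau> \<noteq> \<zero>} \<subseteq> S" using S by auto
      ultimately have Pd: "P ?d" using insert.IH by blast
      have "P (\<lambda>\<tau>. (if \<tau> = \<sigma> then c \<sigma> else \<zero>) \<oplus> ?d \<tau>)"
        by (rule step [OF d _ Pd]) (use c in \<open>simp add: fsupp_def\<close>)
      moreover have "(\<lambda>\<tau>. (if \<tau> = \<sigma> then c \<sigma> else \<zero>) \<oplus> ?d \<tau>) = c"
        using c by (auto simp: fsupp_def)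
      ultimately show "P c" by simp
    qed
  qed
  then show ?thesis using assms(1) unfolding fsupp_def by blast
qed

lemma push_chain_eq: "push_chain R h c = (\<lambda>\<tau>. csum (\<lambda>\<sigma>. h \<sigma> = \<tau>) c)"
  by (simp add: push_chain_def csum_def)

lemma push_chain_nonzero:
  assumes "push_chain R h c \<tau> \<noteq> \<zero>"
  obtains \<sigma> where "c \<sigma> \<noteq> \<zero>" "h \<sigma> = \<tau>"
proof (cases "\<exists>\<sigma>. c \<sigma> \<noteq> \<zero> \<and> h \<sigma> = \<tau>")
  case False
  then have "{\<sigma>. c \<sigma> \<noteq> \<zero> \<and> h \<sigma> = \<tau>} = {}" by blast
  then have "push_chain R h c \<tau> = \<zero>" unfolding push_chain_def by (simp only: finsum_empty)
  then show ?thesis using assms by blast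
qed (use that in blast)

lemma fsupp_push [simp]:
  assumes "fsupp c"
  shows "fsupp (push_chain R h c)"
proof -
  have "{\<tau>. push_chain R h c \<tau> \<noteq> \<zero>} \<subseteq> h ` {\<sigma>. c \<sigma> \<noteq> \<zero>}"
    using push_chain_nonzero by blast
  moreover have "push_chain R h c \<tau> \<in> carrier R" for \<tau>
    using assms by (simp add: push_chain_eq)
  ultimately show ?thesis using assms finite_subset unfolding fsupp_def by blast
qed

lemma push_zero [simp]: "push_chain R h (\<lambda>_. \<zero>) = (\<lambda>_. \<zero>)"
  by (simp add: push_chain_eq)

lemma push_add:
  "fsupp c \<Longrightarrow> fsupp d \<Longrightarrow>
    push_chain R h (\<lambda>\<sigma>. c \<sigma> \<oplus> d \<sigma>) = (\<lambda>\<tau>. push_chain R h c \<tau> \<oplus> push_chain R h d \<tau>)"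
  by (simp add: push_chain_eq csum_add)

lemma push_smult:
  "fsupp c \<Longrightarrow> a \<in> carrier R \<Longrightarrow>
    push_chain R h (\<lambda>\<sigma>. a \<otimes> c \<sigma>) = (\<lambda>\<tau>. a \<otimes> push_chain R h c \<tau>)"
  by (simp add: push_chain_eq csum_smult)

lemma push_delta:
  assumes "a \<in> carrier R"
  shows "push_chain R h (\<lambda>\<tau>. if \<tau> = \<sigma> then a else \<zero>) = (\<lambda>\<tau>. if \<tau> = h \<sigma> then a else \<zero>)"
  using assms by (auto simp: push_chain_eq csum_delta)

lemma csum_push:
  assumes "fsupp c"
  shows "csum Q (push_chain R h c) = csum (\<lambda>\<sigma>. Q (h \<sigma>)) c"
  using assms
proof (induction rule: fsupp_induct)
  case (add c \<sigma> a)
  then show ?case by (simp add: push_add push_delta csum_add csum_delta)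
qed simp

lemma push_push:
  "fsupp c \<Longrightarrow> push_chain R h (push_chain R k c) = push_chain R (\<lambda>\<sigma>. h (k \<sigma>)) c"
  by (subst push_chain_eq, subst csum_push) (simp_all add: push_chain_eq)

lemma push_ident:
  assumes c: "fsupp c" and h: "\<And>\<sigma>. c \<sigma> \<noteq> \<zero> \<Longrightarrow> h \<sigma> = \<sigma>"
  shows "push_chain R h c = c"
proof
  fix \<tau>
  have "push_chain R h c \<tau> = csum (\<lambda>\<sigma>. \<sigma> = \<tau>) c"
    unfolding push_chain_eq using h by (intro csum_cong) auto
  also have "\<dots> = c \<tau>"
    using c
  proof (induction rule: fsupp_induct)
    case (add c \<sigma> a)
    then show ?case by (auto simp: csum_add csum_delta)
  qed simp
  finally show "push_chain R h c \<tau> = c \<tau>" .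
qed

lemma boundary_map_1:
  assumes "fsupp d"
  shows "boundary_map R (Suc 0) d =
    (\<lambda>\<tau>. push_chain R (singular_face 1 0) d \<tau> \<oplus> \<ominus> \<one> \<otimes> push_chain R (singular_face 1 1) d \<tau>)"
proof
  fix \<tau>
  have car: "push_chain R (singular_face (Suc 0) k) d \<tau> \<in> carrier R" for k
    using assms fsupp_push unfolding fsupp_def by blast
  have "{..Suc 0} = {0, Suc 0}" by auto
  then show "boundary_map R (Suc 0) d \<tau> =
      push_chain R (singular_face 1 0) d \<tau> \<oplus> \<ominus> \<one> \<otimes> push_chain R (singular_face 1 1) d \<tau>"
    using car by (simp add: boundary_map_def a_comm)
qed

end

text \<open>The argument is the only point of the standard 0-simplex, so evaluation there identifies
  singular 0-simplices with points.\<close>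

definition vertex :: "((nat \<Rightarrow> real) \<Rightarrow> 'b) \<Rightarrow> 'b"
  where "vertex \<sigma> = \<sigma> (\<lambda>j. if j = 0 then 1 else 0)"

text \<open>The restriction supplies the extensionality demanded of singular simplices, making this
  the exact inverse of \<open>vertex\<close> on them.\<close>

definition point_simplex :: "'b \<Rightarrow> (nat \<Rightarrow> real) \<Rightarrow> 'b"
  where "point_simplex x = restrict (\<lambda>_. x) (standard_simplex 0)"

lemma vertex_point_simplex [simp]: "vertex (point_simplex x) = x"
  by (simp add: vertex_def point_simplex_def)

lemma singular_simplex_point_simplex:
  "x \<in> topspace X \<Longrightarrow> singular_simplex 0 X (point_simplex x)"
  by (auto simp: singular_simplex_def point_simplex_def intro: continuous_map_eq [of _ _ "\<lambda>_. x"])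

lemma singular_simplex_0D:
  assumes "singular_simplex 0 X \<sigma>"
  shows "vertex \<sigma> \<in> topspace X" "point_simplex (vertex \<sigma>) = \<sigma>"
proof -
  have "(\<lambda>j. if j = 0 then 1 else 0) \<in> standard_simplex 0" by simp
  then show "vertex \<sigma> \<in> topspace X"
    using assms by (auto simp: singular_simplex_def vertex_def continuous_map_def)
  show "point_simplex (vertex \<sigma>) = \<sigma>"
  proof
    fix v :: "nat \<Rightarrow> real"
    show "point_simplex (vertex \<sigma>) v = \<sigma> v"
    proof (cases "v \<in> standard_simplex 0")
      case True
      then have "v = (\<lambda>j. if j = 0 then 1 else 0)" by (simp add: standard_simplex_0)
      then show ?thesis using True by (simp add: point_simplex_def vertex_def)
    next
      case False
      then show ?thesis using assms by (simp add: point_simplex_def singular_simplex_def extensional_def)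
    qed
  qed
qed

lemma vertex_singular_face:
  "vertex (singular_face 1 0 \<sigma>) = \<sigma> (\<lambda>j. if j = 1 then 1 else 0)"
  "vertex (singular_face 1 1 \<sigma>) = \<sigma> (\<lambda>j. if j = 0 then 1 else 0)"
proof -
  have "simplical_face 0 (\<lambda>j. if j = 0 then 1 else 0) = (\<lambda>j. if j = (1::nat) then 1 else (0::real))"
    "simplical_face 1 (\<lambda>j. if j = 0 then 1 else 0) = (\<lambda>j. if j = (0::nat) then 1 else (0::real))"
    by (auto simp: simplical_face_def)
  then show "vertex (singular_face 1 0 \<sigma>) = \<sigma> (\<lambda>j. if j = 1 then 1 else 0)"
    "vertex (singular_face 1 1 \<sigma>) = \<sigma> (\<lambda>j. if j = 0 then 1 else 0)"
    by (simp_all add: vertex_def singular_face_def)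
qed

lemma singular_simplex_mono:
  "singular_simplex p (top_of_set S) \<sigma> \<Longrightarrow> S \<subseteq> T \<Longrightarrow> singular_simplex p (top_of_set T) \<sigma>"
  by (auto simp: singular_simplex_def continuous_map_in_subtopology)

lemma connected_component_faces:
  assumes "singular_simplex 1 (top_of_set S) \<sigma>"
  shows "connected_component S (vertex (singular_face 1 0 \<sigma>)) (vertex (singular_face 1 1 \<sigma>))"
proof -
  have cont: "continuous_map (subtopology (powertop_real UNIV) (standard_simplex 1)) (top_of_set S) \<sigma>"
    using assms by (simp add: singular_simplex_def)
  have "connectedin (subtopology (powertop_real UNIV) (standard_simplex 1)) (standard_simplex 1)"
    using connectedin_standard_simplex by (simp add: connectedin_subtopology)
  then have "connectedin (top_of_set S) (\<sigma> ` standard_simplex 1)"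
    by (rule connectedin_continuous_map_image [OF cont])
  then have "connected (\<sigma> ` standard_simplex 1)" "\<sigma> ` standard_simplex 1 \<subseteq> S"
    by (simp_all add: connectedin_subtopology)
  moreover have "(\<lambda>j. if j = 1 then 1 else 0) \<in> standard_simplex 1" "(\<lambda>j. if j = 0 then 1 else 0) \<in> standard_simplex 1"
    by simp_all
  ultimately show ?thesis
    unfolding vertex_singular_face connected_component_def by blast
qed

text \<open>On the standard 1-simplex the coordinate \<open>v 1\<close> serves as path parameter.
  Face 0 omits the vertex where it is 0, which leaves the end of the path.\<close>

lemma path_simplex:
  assumes g: "path g" "path_image g \<subseteq> S"
  defines "\<sigma> \<equiv> restrict (\<lambda>v. g (v 1)) (standard_simplex 1)"
  shows "singular_simplex 1 (top_of_set S) \<sigma>"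
    and "singular_face 1 0 \<sigma> = point_simplex (pathfinish g)"
    and "singular_face 1 1 \<sigma> = point_simplex (pathstart g)"
proof -
  have "continuous_map (subtopology (powertop_real UNIV) (standard_simplex 1)) (top_of_set {0..1}) (\<lambda>v. v 1)"
    by (auto simp: continuous_map_in_subtopology standard_simplex_def
        intro: continuous_map_from_subtopology continuous_map_product_projection)
  moreover have "continuous_map (top_of_set {0..1}) (top_of_set S) g"
    using g by (auto simp: path_def path_image_def continuous_map_in_subtopology)
  ultimately have "continuous_map (subtopology (powertop_real UNIV) (standard_simplex 1)) (top_of_set S) (g \<circ> (\<lambda>v. v 1))"
    by (rule continuous_map_compose)
  then show "singular_simplex 1 (top_of_set S) \<sigma>"
    unfolding singular_simplex_def \<sigma>_def
    by (auto intro: continuous_map_eq)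
  then have faces: "singular_simplex 0 (top_of_set S) (singular_face 1 k \<sigma>)" if "k \<le> 1" for k
    using singular_simplex_singular_face [of 1 _ \<sigma> k] that by simp
  show "singular_face 1 0 \<sigma> = point_simplex (pathfinish g)"
    using singular_simplex_0D(2) [OF faces [of 0]]
    by (simp add: vertex_singular_face [unfolded One_nat_def] \<sigma>_def pathfinish_def)
  show "singular_face 1 1 \<sigma> = point_simplex (pathstart g)"
    using singular_simplex_0D(2) [OF faces [of 1]]
    by (simp add: vertex_singular_face [unfolded One_nat_def] \<sigma>_def pathstart_def)
qed

section \<open>Chain modules and boundaries in degree zero\<close>

context cring
begin

lemma in_chain_module_iff:
  "c \<in> carrier (chain_module R p X) \<longleftrightarrow> fsupp c \<and> (\<forall>\<sigma>. c \<sigma> \<noteq> \<zero> \<longrightarrow> singular_simplex p X \<sigma>)"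
  by (auto simp: chain_module_def fsupp_def)

lemma chain_module_simps [simp]:
  "add (chain_module R p X) = (\<lambda>c d \<sigma>. c \<sigma> \<oplus> d \<sigma>)"
  "zero (chain_module R p X) = (\<lambda>_. \<zero>)"
  "smult (chain_module R p X) = (\<lambda>a c \<sigma>. a \<otimes> c \<sigma>)"
  by (simp_all add: chain_module_def)

lemma module_chain_module: "module R (chain_module R p X)" (is "module R ?M")
proof -
  have car: "c \<sigma> \<in> carrier R" if "c \<in> carrier ?M" for c \<sigma>
    using that by (simp add: in_chain_module_iff fsupp_def)
  show ?thesis
  proof (rule moduleI)
  show "cring R" by unfold_locales
  show smult_closed: "a \<odot>\<^bsub>?M\<^esub> x \<in> carrier ?M" if a: "a \<in> carrier R" and x: "x \<in> carrier ?M" for a x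
  proof -
    have "x \<sigma> \<noteq> \<zero>" if "a \<otimes> x \<sigma> \<noteq> \<zero>" for \<sigma> using that a by auto
    then show ?thesis using a x by (auto simp: in_chain_module_iff)
  qed
  show "abelian_group ?M"
  proof (rule abelian_groupI)
    show "x \<oplus>\<^bsub>?M\<^esub> y \<in> carrier ?M" if xy: "x \<in> carrier ?M" "y \<in> carrier ?M" for x y
    proof -
      have "singular_simplex p X \<sigma>" if nz: "x \<sigma> \<oplus> y \<sigma> \<noteq> \<zero>" for \<sigma>
      proof -
        have "x \<sigma> \<noteq> \<zero> \<or> y \<sigma> \<noteq> \<zero>" using nz by auto
        then show ?thesis using xy unfolding in_chain_module_iff by blast
      qed
      then show ?thesis using xy by (simp add: in_chain_module_iff)
    qed
    show "\<exists>y\<in>carrier ?M. y \<oplus>\<^bsub>?M\<^esub> x = \<zero>\<^bsub>?M\<^esub>" if x: "x \<in> carrier ?M" for x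
    proof (rule bexI)
      show "(\<ominus> \<one> \<odot>\<^bsub>?M\<^esub> x) \<oplus>\<^bsub>?M\<^esub> x = \<zero>\<^bsub>?M\<^esub>" using car [OF x] by (simp add: l_minus l_neg)
      show "\<ominus> \<one> \<odot>\<^bsub>?M\<^esub> x \<in> carrier ?M" using x by (intro smult_closed) auto
    qed
    show "\<zero>\<^bsub>?M\<^esub> \<in> carrier ?M" by (simp add: in_chain_module_iff)
  qed (simp_all add: car a_ac)
  qed (simp_all add: car l_distr r_distr m_assoc)
qed

lemma in_boundaries_0_iff:
  "c \<in> boundaries R 0 X \<longleftrightarrow> (\<exists>d\<in>carrier (chain_module R 1 X).
    c = (\<lambda>\<tau>. push_chain R (singular_face 1 0) d \<tau> \<oplus> \<ominus> \<one> \<otimes> push_chain R (singular_face 1 1) d \<tau>))"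
  unfolding boundaries_def using boundary_map_1 by (force simp: in_chain_module_iff)

lemma push_in_chain_module:
  assumes c: "c \<in> carrier (chain_module R p X)"
    and h: "\<And>\<sigma>. singular_simplex p X \<sigma> \<Longrightarrow> singular_simplex p' Y (h \<sigma>)"
  shows "push_chain R h c \<in> carrier (chain_module R p' Y)"
  unfolding in_chain_module_iff
proof (intro conjI allI impI)
  show "fsupp (push_chain R h c)" using c by (simp add: in_chain_module_iff)
  fix \<tau> assume "push_chain R h c \<tau> \<noteq> \<zero>"
  then obtain \<sigma> where "c \<sigma> \<noteq> \<zero>" "h \<sigma> = \<tau>" by (rule push_chain_nonzero)
  then show "singular_simplex p' Y \<tau>" using c h by (auto simp: in_chain_module_iff)
qed

lemma submodule_boundaries_0: "submodule (boundaries R 0 X) R (chain_module R 0 X)"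
proof -
  interpret C0: module R "chain_module R 0 X" by (rule module_chain_module)
  interpret C1: module R "chain_module R 1 X" by (rule module_chain_module)
  let ?f = "\<lambda>k. push_chain R (singular_face 1 k)"
  have face: "?f k d \<in> carrier (chain_module R 0 X)" if "d \<in> carrier (chain_module R 1 X)" "k \<le> 1" for k d
    by (rule push_in_chain_module [OF that(1)])
      (use singular_simplex_singular_face [of 1 X _ k] that(2) in simp)
  have closed: "?f k d \<tau> \<in> carrier R" if "d \<in> carrier (chain_module R 1 X)" for k d \<tau>
    using that fsupp_push unfolding in_chain_module_iff fsupp_def by blast
  have sub: "boundaries R 0 X \<subseteq> carrier (chain_module R 0 X)"
  proof
    fix c assume "c \<in> boundaries R 0 X"
    then obtain d where d: "d \<in> carrier (chain_module R 1 X)"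
      "c = (\<lambda>\<tau>. ?f 0 d \<tau> \<oplus> \<ominus> \<one> \<otimes> ?f 1 d \<tau>)"
      unfolding in_boundaries_0_iff by blast
    have "?f 0 d \<oplus>\<^bsub>chain_module R 0 X\<^esub> (\<ominus> \<one> \<odot>\<^bsub>chain_module R 0 X\<^esub> ?f 1 d) \<in> carrier (chain_module R 0 X)"
      by (intro C0.M.a_closed C0.smult_closed face [OF d(1)] a_inv_closed one_closed order_refl zero_le)
    then show "c \<in> carrier (chain_module R 0 X)"
      unfolding d(2) by (simp only: chain_module_simps)
  qed
  have smult: "a \<odot>\<^bsub>chain_module R 0 X\<^esub> c \<in> boundaries R 0 X" if a: "a \<in> carrier R" and c: "c \<in> boundaries R 0 X" for a c
  proof -
    obtain d where d: "d \<in> carrier (chain_module R 1 X)" "c = (\<lambda>\<tau>. ?f 0 d \<tau> \<oplus> \<ominus> \<one> \<otimes> ?f 1 d \<tau>)"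
      using c unfolding in_boundaries_0_iff by blast
    have "a \<odot>\<^bsub>chain_module R 1 X\<^esub> d \<in> carrier (chain_module R 1 X)" using a d(1) by (rule C1.smult_closed)
    moreover have "fsupp d" using d(1) by (simp add: in_chain_module_iff)
    ultimately show ?thesis
      unfolding in_boundaries_0_iff d(2) using a closed [OF d(1)]
      by (intro bexI [of _ "a \<odot>\<^bsub>chain_module R 1 X\<^esub> d"]) (simp_all add: push_smult r_distr m_lcomm fun_eq_iff)
  qed
  show ?thesis
  proof (rule C0.submoduleI [OF sub _ _ _ smult])
    show "\<zero>\<^bsub>chain_module R 0 X\<^esub> \<in> boundaries R 0 X"
      unfolding in_boundaries_0_iff by (rule bexI [of _ "\<lambda>_. \<zero>"]) (auto simp: in_chain_module_iff)
    show "\<ominus>\<^bsub>chain_module R 0 X\<^esub> c \<in> boundaries R 0 X" if "c \<in> boundaries R 0 X" for c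
    proof -
      have "c \<in> carrier (chain_module R 0 X)" using that sub by blast
      then have "\<ominus>\<^bsub>chain_module R 0 X\<^esub> c = \<ominus> \<one> \<odot>\<^bsub>chain_module R 0 X\<^esub> c"
        by (simp only: C0.smult_l_minus [OF one_closed] C0.smult_one)
      then show ?thesis using smult [OF _ that, of "\<ominus> \<one>"] by simp
    qed
    show "c \<oplus>\<^bsub>chain_module R 0 X\<^esub> c' \<in> boundaries R 0 X" if c: "c \<in> boundaries R 0 X" "c' \<in> boundaries R 0 X" for c c'
    proof -
      obtain d where d: "d \<in> carrier (chain_module R 1 X)" "c = (\<lambda>\<tau>. ?f 0 d \<tau> \<oplus> \<ominus> \<one> \<otimes> ?f 1 d \<tau>)"
        using c(1) unfolding in_boundaries_0_iff by blast
      obtain d' where d': "d' \<in> carrier (chain_module R 1 X)" "c' = (\<lambda>\<tau>. ?f 0 d' \<tau> \<oplus> \<ominus> \<one> \<otimes> ?f 1 d' \<tau>)"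
        using c(2) unfolding in_boundaries_0_iff by blast
      have "d \<oplus>\<^bsub>chain_module R 1 X\<^esub> d' \<in> carrier (chain_module R 1 X)" using d(1) d'(1) by (rule C1.M.a_closed)
      moreover have "fsupp d" "fsupp d'" using d(1) d'(1) by (simp_all add: in_chain_module_iff)
      ultimately show ?thesis
        unfolding in_boundaries_0_iff d(2) d'(2) using closed [OF d(1)] closed [OF d'(1)]
        by (intro bexI [of _ "d \<oplus>\<^bsub>chain_module R 1 X\<^esub> d'"]) (simp_all add: push_add r_distr a_ac fun_eq_iff)
    qed
  qed
qed

text \<open>The two faces of a 1-simplex have vertices in one component, so a property constant on
  components gives them equal masses, which cancel.\<close>

lemma csum_boundary:
  assumes c: "c \<in> boundaries R 0 (top_of_set S)"
    and Q: "\<And>x y. connected_component S x y \<Longrightarrow> Q x \<longleftrightarrow> Q y"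
  shows "csum (\<lambda>\<sigma>. Q (vertex \<sigma>)) c = \<zero>"
proof -
  obtain d where d: "d \<in> carrier (chain_module R 1 (top_of_set S))"
    "c = (\<lambda>\<tau>. push_chain R (singular_face 1 0) d \<tau> \<oplus> \<ominus> \<one> \<otimes> push_chain R (singular_face 1 1) d \<tau>)"
    using c unfolding in_boundaries_0_iff by blast
  have f: "fsupp d" using d(1) by (simp add: in_chain_module_iff)
  have "csum (\<lambda>\<sigma>. Q (vertex (singular_face 1 0 \<sigma>))) d = csum (\<lambda>\<sigma>. Q (vertex (singular_face 1 1 \<sigma>))) d"
  proof (rule csum_cong)
    fix \<sigma> assume "d \<sigma> \<noteq> \<zero>"
    then have "singular_simplex 1 (top_of_set S) \<sigma>" using d(1) unfolding in_chain_module_iff by blast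
    then show "Q (vertex (singular_face 1 0 \<sigma>)) \<longleftrightarrow> Q (vertex (singular_face 1 1 \<sigma>))"
      by (intro Q connected_component_faces)
  qed
  then show ?thesis
    unfolding d(2) using f by (simp add: csum_add csum_smult csum_push l_minus r_neg)
qed

text \<open>Components of an open set are path connected. A path from each \<open>x\<close> to
  \<open>h x\<close>, read as a 1-simplex, yields a 1-chain whose boundary is the moved chain minus
  the original.\<close>

lemma push_homologous:
  fixes S :: "'p::real_normed_vector set"
  assumes c: "c \<in> carrier (chain_module R 0 (top_of_set S))" and S: "open S"
    and h: "\<And>x. x \<in> S \<Longrightarrow> connected_component S x (h x)"
  shows "(\<lambda>\<tau>. push_chain R (\<lambda>\<sigma>. point_simplex (h (vertex \<sigma>))) c \<tau> \<oplus> \<ominus> \<one> \<otimes> c \<tau>) \<in> boundaries R 0 (top_of_set S)"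
proof -
  have "\<exists>g. path g \<and> path_image g \<subseteq> S \<and> pathstart g = x \<and> pathfinish g = h x" if "x \<in> S" for x
    using h [OF that] S unfolding path_component_eq_connected_component [OF open_imp_locally_path_connected [OF S], symmetric] path_component_def by blast
  then obtain g where g: "\<And>x. x \<in> S \<Longrightarrow> path (g x) \<and> path_image (g x) \<subseteq> S \<and> pathstart (g x) = x \<and> pathfinish (g x) = h x"
    by metis
  define k where "k = (\<lambda>\<sigma>::(nat \<Rightarrow> real) \<Rightarrow> 'p. restrict (\<lambda>v. g (vertex \<sigma>) (v 1)) (standard_simplex 1))"
  have f: "fsupp c" using c by (simp add: in_chain_module_iff)
  have vS: "vertex \<sigma> \<in> S" if "singular_simplex 0 (top_of_set S) \<sigma>" for \<sigma>
    using singular_simplex_0D(1) [OF that] by simp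
  have k: "singular_simplex 1 (top_of_set S) (k \<sigma>)"
    "singular_face 1 0 (k \<sigma>) = point_simplex (h (vertex \<sigma>))"
    "singular_face 1 1 (k \<sigma>) = \<sigma>" if "singular_simplex 0 (top_of_set S) \<sigma>" for \<sigma>
    using path_simplex [of "g (vertex \<sigma>)" S] g [OF vS [OF that]] singular_simplex_0D(2) [OF that]
    by (simp_all add: k_def)
  have d: "push_chain R k c \<in> carrier (chain_module R 1 (top_of_set S))"
    by (rule push_in_chain_module [OF c k(1)])
  have sup: "singular_simplex 0 (top_of_set S) \<sigma>" if "c \<sigma> \<noteq> \<zero>" for \<sigma>
    using c that by (simp add: in_chain_module_iff)
  have "push_chain R (singular_face 1 1) (push_chain R k c) = c"
    unfolding push_push [OF f] using k(3) sup by (intro push_ident f) auto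
  moreover have "push_chain R (singular_face 1 0) (push_chain R k c) = push_chain R (\<lambda>\<sigma>. point_simplex (h (vertex \<sigma>))) c"
    unfolding push_push [OF f] unfolding push_chain_eq using k(2) sup by (intro ext csum_cong) auto
  ultimately show ?thesis
    unfolding in_boundaries_0_iff by (intro bexI [OF _ d]) simp
qed

end

section \<open>The persistence module of sublevel sets\<close>

lemma level_less_one: "level t < 1"
proof -
  have "0 < exp t + 1" using exp_gt_zero [of t] by linarith
  then show ?thesis by (simp add: level_def)
qed

lemma level_eq: "level t = 1 - 2 / (exp t + 1)"
proof -
  have "exp t + 1 \<noteq> 0" using exp_gt_zero [of t] by linarith
  then show ?thesis by (simp add: level_def field_simps)
qed

lemma level_less_iff [simp]: "level s < level t \<longleftrightarrow> s < t"
proof -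
  have "0 < exp s + 1" "0 < exp t + 1" using exp_gt_zero [of t] exp_gt_zero [of s] by linarith+
  then have "level s < level t \<longleftrightarrow> exp s < exp t" by (simp add: level_eq field_simps)
  then show ?thesis by simp
qed

lemma level_0 [simp]: "level 0 = 0"
  by (simp add: level_def)

lemma level_pos_iff [simp]: "0 < level t \<longleftrightarrow> 0 < t"
  using level_less_iff [of 0 t] by simp

lemma level_ln:
  assumes "0 \<le> x" "x < 1"
  shows "level (ln ((1 + x) / (1 - x))) = x"
proof -
  have "0 < (1 + x) / (1 - x)" using assms by simp
  then have "exp (ln ((1 + x) / (1 - x))) = (1 + x) / (1 - x)" by (rule exp_ln)
  then show ?thesis using assms by (simp add: level_def field_simps)
qed

lemma sublevel_mono: "\<theta> \<le> \<theta>' \<Longrightarrow> sublevel u \<theta> \<subseteq> sublevel u \<theta>'"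
  by (auto simp: sublevel_def)

lemma sublevel_level_mono: "s \<le> t \<Longrightarrow> sublevel u (level s) \<subseteq> sublevel u (level t)"
  by (rule sublevel_mono) (use level_less_iff [of t s] in linarith)

lemma sublevel_level_empty:
  assumes "t \<le> 0"
  shows "sublevel u (level t) = {}"
proof -
  have "\<not> norm (u z) < level t" for z
    using level_pos_iff [of t] assms norm_ge_zero [of "u z"] by linarith
  then show ?thesis by (simp add: sublevel_def)
qed

context cring
begin

lemma chain_module_sigma_space_trivial:
  assumes "t \<le> 0"
  shows "carrier (chain_module R 0 (sigma_space u t)) = {\<lambda>_. \<zero>}"
proof -
  have no: "\<not> singular_simplex 0 (sigma_space u t) \<sigma>" for \<sigma>
    using singular_simplex_0D(1) [of "sigma_space u t" \<sigma>] sublevel_level_empty [OF assms, of u]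
    by (auto simp: sigma_space_def)
  then show ?thesis by (auto simp: in_chain_module_iff fun_eq_iff)
qed

lemma boundaries_0_mono:
  assumes "s \<le> t"
  shows "boundaries R 0 (sigma_space u s) \<subseteq> boundaries R 0 (sigma_space u t)"
proof
  fix c assume "c \<in> boundaries R 0 (sigma_space u s)"
  then obtain d where d: "d \<in> carrier (chain_module R 1 (sigma_space u s))"
    "c = (\<lambda>\<tau>. push_chain R (singular_face 1 0) d \<tau> \<oplus> \<ominus> \<one> \<otimes> push_chain R (singular_face 1 1) d \<tau>)"
    unfolding in_boundaries_0_iff by blast
  have "d \<in> carrier (chain_module R 1 (sigma_space u t))"
    using d(1) singular_simplex_mono [OF _ sublevel_level_mono [OF assms]]
    unfolding in_chain_module_iff sigma_space_def by blast
  then show "c \<in> boundaries R 0 (sigma_space u t)" unfolding in_boundaries_0_iff using d(2) by blast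
qed

lemma homology_module_0:
  "homology_module R 0 X = quotient_module (chain_module R 0 X) (boundaries R 0 X)"
proof -
  have "cycles R 0 X = carrier (chain_module R 0 X)"
    by (auto simp: cycles_def boundary_map_def)
  then show ?thesis by (simp add: homology_module_def)
qed

end

context field
begin

lemma sublevel_filtration: "module_filtration R (\<lambda>t. chain_module R 0 (sigma_space u t))"
proof (intro module_filtration.intro module_filtration_axioms.intro)
  show "field R" by unfold_locales
  show "module R (chain_module R 0 (sigma_space u t))" for t by (rule module_chain_module)
  show "carrier (chain_module R 0 (sigma_space u s)) \<subseteq> carrier (chain_module R 0 (sigma_space u t))"
    if "s \<le> t" for s t
    using singular_simplex_mono [OF _ sublevel_level_mono [OF that]]
    unfolding sigma_space_def by (auto simp: in_chain_module_iff)
  show "\<exists>t0. \<forall>t\<le>t0. carrier (chain_module R 0 (sigma_space u t)) = {\<zero>\<^bsub>chain_module R 0 (sigma_space u t)\<^esub>}"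
    using chain_module_sigma_space_trivial by (intro exI [of _ 0]) simp
qed simp_all

text \<open>At nonpositive times the value \<open>{}\<close> is the sole element of the zero module
  used in \<open>inner_persistence\<close>.\<close>

definition homology_class :: "(complex \<Rightarrow> complex) \<Rightarrow> real \<Rightarrow> (complex, 'a) coeff_chain \<Rightarrow> (complex, 'a) coeff_chain set"
  where "homology_class u t c =
    (if t > 0 then boundaries R 0 (sigma_space u t) +>\<^bsub>chain_module R 0 (sigma_space u t)\<^esub> c else {})"

text \<open>Pushing along the identity fixes every chain, and adding the later boundaries to an
  earlier coset absorbs the earlier boundaries, which are among them.\<close>

lemma homology_map_class:
  assumes st: "s \<le> t" and s: "0 < s" and c: "c \<in> carrier (chain_module R 0 (sigma_space u s))"
  shows "homology_map R 0 (\<lambda>z. z) (sigma_space u t) (homology_class u s c) = homology_class u t c"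
proof -
  let ?M = "chain_module R 0 (sigma_space u t)"
  let ?Ns = "boundaries R 0 (sigma_space u s)" and ?Nt = "boundaries R 0 (sigma_space u t)"
  interpret Ms: module R "chain_module R 0 (sigma_space u s)" by (rule module_chain_module)
  interpret Mt: module R ?M by (rule module_chain_module)
  have sub_s: "submodule ?Ns R (chain_module R 0 (sigma_space u s))"
    and sub_t: "submodule ?Nt R ?M" by (rule submodule_boundaries_0)+
  note Es = Ms.submoduleE [OF sub_s] and Et = Mt.submoduleE [OF sub_t]
  have zero: "(\<lambda>_. \<zero>) \<in> ?Ns"
    using additive_subgroup.zero_closed [OF additive_subgroupI [OF submodule.axioms(1) [OF sub_s]]] by simp
  have cls: "homology_class u s c = {\<lambda>\<sigma>. n \<sigma> \<oplus> c \<sigma> | n. n \<in> ?Ns}"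
    using s by (auto simp: homology_class_def a_r_coset_def')
  have clt: "homology_class u t c = {\<lambda>\<sigma>. n \<sigma> \<oplus> c \<sigma> | n. n \<in> ?Nt}"
    using s st by (auto simp: homology_class_def a_r_coset_def')
  have push: "push_chain R (simplex_map 0 (\<lambda>z. z)) e = e" if "e \<in> carrier (chain_module R 0 (sigma_space u s))" for e
  proof (rule push_ident)
    show "fsupp e" using that by (simp add: in_chain_module_iff)
    show "simplex_map 0 (\<lambda>z. z) \<sigma> = \<sigma>" if "e \<sigma> \<noteq> \<zero>" for \<sigma>
    proof -
      have "\<sigma> \<in> extensional (standard_simplex 0)"
        using that \<open>e \<in> _\<close> by (auto simp: in_chain_module_iff singular_simplex_def)
      then show ?thesis by (simp add: simplex_map_def o_def extensional_restrict)
    qed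
  qed
  have "homology_class u s c \<subseteq> carrier (chain_module R 0 (sigma_space u s))"
  proof
    fix e assume "e \<in> homology_class u s c"
    then obtain n where n: "n \<in> ?Ns" "e = n \<oplus>\<^bsub>chain_module R 0 (sigma_space u s)\<^esub> c" unfolding cls by auto
    show "e \<in> carrier (chain_module R 0 (sigma_space u s))"
      unfolding n(2) using Es(1) n(1) c by (intro Ms.M.a_closed) auto
  qed
  then have "push_chain R (simplex_map 0 (\<lambda>z. z)) ` homology_class u s c = homology_class u s c"
    using push by (intro image_cong [OF refl, of _ _ "\<lambda>x. x", simplified]) auto
  then have "homology_map R 0 (\<lambda>z. z) (sigma_space u t) (homology_class u s c) =
      {\<lambda>\<sigma>. n \<sigma> \<oplus> (n' \<sigma> \<oplus> c \<sigma>) | n n'. n \<in> ?Nt \<and> n' \<in> ?Ns}"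
    unfolding homology_map_def set_add_def' cls by auto
  also have "\<dots> = homology_class u t c"
    unfolding clt
  proof (intro subset_antisym subsetI)
    have car: "e \<sigma> \<in> carrier R" if "e \<in> carrier ?M \<or> e \<in> carrier (chain_module R 0 (sigma_space u s))" for e \<sigma>
      using that by (auto simp: in_chain_module_iff fsupp_def)
    fix e assume "e \<in> {\<lambda>\<sigma>. n \<sigma> \<oplus> (n' \<sigma> \<oplus> c \<sigma>) | n n'. n \<in> ?Nt \<and> n' \<in> ?Ns}"
    then obtain n n' where n: "n \<in> ?Nt" "n' \<in> ?Ns" "e = (\<lambda>\<sigma>. n \<sigma> \<oplus> (n' \<sigma> \<oplus> c \<sigma>))" by blast
    have n': "n' \<in> ?Nt" using boundaries_0_mono [OF st] n(2) by blast
    have "(\<lambda>\<sigma>. n \<sigma> \<oplus> n' \<sigma>) \<in> ?Nt" using Et(5) [OF n(1) n'] by simp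
    moreover have "e = (\<lambda>\<sigma>. (n \<sigma> \<oplus> n' \<sigma>) \<oplus> c \<sigma>)"
      using n(3) car [of n] car [of n'] car [of c] Et(1) n(1) n' c by (auto simp: a_assoc subset_iff)
    ultimately show "e \<in> {\<lambda>\<sigma>. n \<sigma> \<oplus> c \<sigma> | n. n \<in> ?Nt}"
      by (intro CollectI exI [of _ "\<lambda>\<sigma>. n \<sigma> \<oplus> n' \<sigma>"]) simp
  next
    fix e assume "e \<in> {\<lambda>\<sigma>. n \<sigma> \<oplus> c \<sigma> | n. n \<in> ?Nt}"
    then obtain n where n: "n \<in> ?Nt" "e = (\<lambda>\<sigma>. n \<sigma> \<oplus> c \<sigma>)" by blast
    have "e = (\<lambda>\<sigma>. n \<sigma> \<oplus> (\<zero> \<oplus> c \<sigma>))" using n(2) c by (auto simp: in_chain_module_iff fsupp_def)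
    then show "e \<in> {\<lambda>\<sigma>. n \<sigma> \<oplus> (n' \<sigma> \<oplus> c \<sigma>) | n n'. n \<in> ?Nt \<and> n' \<in> ?Ns}"
      using n(1) zero by (intro CollectI exI [of _ n] exI [of _ "\<lambda>_. \<zero>"]) simp
  qed
  finally show ?thesis .
qed

lemma covers_inner_persistence:
  "module_filtration.covers R (\<lambda>t. chain_module R 0 (sigma_space u t)) (inner_persistence R u) (homology_class u)"
proof -
  interpret module_filtration R "\<lambda>t. chain_module R 0 (sigma_space u t)" by (rule sublevel_filtration)
  note proj = quotient_module_projection [OF module_chain_module submodule_boundaries_0]
  show ?thesis
    unfolding covers_def
  proof (intro conjI allI ballI impI)
    fix t :: real
    show "carrier (space_at (inner_persistence R u) t) = homology_class u t ` carrier (chain_module R 0 (sigma_space u t))"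
      using proj(1) chain_module_sigma_space_trivial [of t u]
      by (auto simp: inner_persistence_def homology_class_def homology_module_0 zero_module_def)
    show "homology_class u t \<zero>\<^bsub>chain_module R 0 (sigma_space u t)\<^esub> = \<zero>\<^bsub>space_at (inner_persistence R u) t\<^esub>"
      using proj(3) by (auto simp: inner_persistence_def homology_class_def homology_module_0 zero_module_def)
    fix x assume x: "x \<in> carrier (chain_module R 0 (sigma_space u t))"
    show "homology_class u t (x \<oplus>\<^bsub>chain_module R 0 (sigma_space u t)\<^esub> y) =
        homology_class u t x \<oplus>\<^bsub>space_at (inner_persistence R u) t\<^esub> homology_class u t y"
      if "y \<in> carrier (chain_module R 0 (sigma_space u t))" for y
      using proj(2) [OF x that] by (auto simp: inner_persistence_def homology_class_def homology_module_0 zero_module_def)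
    show "homology_class u t (a \<odot>\<^bsub>chain_module R 0 (sigma_space u t)\<^esub> x) =
        a \<odot>\<^bsub>space_at (inner_persistence R u) t\<^esub> homology_class u t x" if "a \<in> carrier R" for a
      using proj(4) [OF that x] by (auto simp: inner_persistence_def homology_class_def homology_module_0 zero_module_def)
  next
    fix s t :: real and x
    assume st: "s \<le> t" and x: "x \<in> carrier (chain_module R 0 (sigma_space u s))"
    show "map_at (inner_persistence R u) s t (homology_class u s x) = homology_class u t x"
    proof (cases "s > 0")
      case True
      then show ?thesis using homology_map_class [OF st True x] by (simp add: inner_persistence_def)
    next
      case False
      then have "x = (\<lambda>_. \<zero>)" using x chain_module_sigma_space_trivial [of s u] by simp
      then show ?thesis using False proj(3) [of "sigma_space u t"]
        by (auto simp: inner_persistence_def homology_class_def homology_module_0)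
    qed
  qed
qed

end

section \<open>Bar coordinates\<close>

text \<open>The abstract relation now becomes connectedness in sets \<open>S t\<close>; their
  openness provides the paths needed to relate chains to components.\<close>

locale merging_chains = merging_components R Z idx I pt sv + F: field F
  for R :: "real \<Rightarrow> 'a::real_normed_vector \<Rightarrow> 'a \<Rightarrow> bool" and Z idx
    and I :: "'i set" and pt sv and F :: "('f, 'r) ring_scheme" +
  fixes S :: "real \<Rightarrow> 'a set"
  assumes R_eq: "R t = connected_component (S t)"
    and open_S: "open (S t)"
begin

abbreviation "zero_chains t \<equiv> chain_module F 0 (top_of_set (S t))"

definition basin_sum :: "'a \<Rightarrow> ('a, 'f) coeff_chain \<Rightarrow> 'f"
  where "basin_sum z = F.csum (\<lambda>\<sigma>. basin z (vertex \<sigma>))"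

lemma R_refl_iff: "R t x x \<longleftrightarrow> x \<in> S t"
  by (simp add: R_eq connected_component_refl_eq)

lemma basin_sum_boundary:
  assumes "z \<in> Z" "0 < t" "alive t z" "c \<in> boundaries F 0 (top_of_set (S t))"
  shows "basin_sum z c = \<zero>\<^bsub>F\<^esub>"
  unfolding basin_sum_def
proof (rule F.csum_boundary [OF assms(4)])
  fix x y assume "connected_component (S t) x y"
  then have "R t x y" by (simp only: R_eq)
  then show "basin z x \<longleftrightarrow> basin z y" by (rule basin_cong [OF assms(1-3)])
qed

text \<open>Moving every simplex to the oldest zero of its component reduces the statement to chains
  supported on oldest zeros. There the matrix of \<^const>\<open>basin\<close> is unitriangular for the age.\<close>

lemma boundary_of_basin_sum_zero:
  assumes t: "0 < t" and c: "c \<in> carrier (zero_chains t)"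
    and zero: "\<And>z. z \<in> Z \<Longrightarrow> alive t z \<Longrightarrow> basin_sum z c = \<zero>\<^bsub>F\<^esub>"
  shows "c \<in> boundaries F 0 (top_of_set (S t))"
proof -
  have fc: "F.fsupp c" using c by (simp add: F.in_chain_module_iff)
  have vS: "vertex \<sigma> \<in> S t" if "c \<sigma> \<noteq> \<zero>\<^bsub>F\<^esub>" for \<sigma>
    using singular_simplex_0D(1) [of "top_of_set (S t)" \<sigma>] c that by (simp add: F.in_chain_module_iff)
  have "\<exists>z\<in>Z. R t x z \<and> alive t z" if "x \<in> S t" for x
    using ex_alive [OF t] that by (simp add: R_refl_iff)
  then obtain h where h: "\<And>x. x \<in> S t \<Longrightarrow> h x \<in> Z \<and> R t x (h x) \<and> alive t (h x)" by metis
  define c' where "c' = push_chain F (\<lambda>\<sigma>. point_simplex (h (vertex \<sigma>))) c"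
  have fc': "F.fsupp c'" using fc by (simp add: c'_def)
  have supp: "vertex \<tau> \<in> Z \<and> alive t (vertex \<tau>) \<and> point_simplex (vertex \<tau>) = \<tau>" if nz: "c' \<tau> \<noteq> \<zero>\<^bsub>F\<^esub>" for \<tau>
  proof -
    obtain \<sigma> where "c \<sigma> \<noteq> \<zero>\<^bsub>F\<^esub>" "point_simplex (h (vertex \<sigma>)) = \<tau>"
      by (rule F.push_chain_nonzero [OF nz [unfolded c'_def]])
    then show ?thesis using h [OF vS] by auto
  qed
  have sum': "basin_sum z c' = \<zero>\<^bsub>F\<^esub>" if z: "z \<in> Z" "alive t z" for z
  proof -
    have "basin_sum z c' = F.csum (\<lambda>\<sigma>. basin z (h (vertex \<sigma>))) c"
      unfolding basin_sum_def c'_def using fc by (simp add: F.csum_push)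
    also have "\<dots> = basin_sum z c"
      unfolding basin_sum_def
      by (rule F.csum_cong) (use basin_cong [OF z(1) t z(2)] h vS in blast)
    finally show ?thesis using zero z by simp
  qed
  have "c' = (\<lambda>_. \<zero>\<^bsub>F\<^esub>)"
  proof (rule ccontr)
    assume "c' \<noteq> (\<lambda>_. \<zero>\<^bsub>F\<^esub>)"
    then have ne: "{\<tau>. c' \<tau> \<noteq> \<zero>\<^bsub>F\<^esub>} \<noteq> {}" by auto
    have fin: "finite {\<tau>. c' \<tau> \<noteq> \<zero>\<^bsub>F\<^esub>}" using fc' by (simp add: F.fsupp_def)
    \<comment> \<open>The youngest zero in the support. Its basin contains only zeros at least as
      young, hence no other point of the support, and its coordinate reads off the coefficient of
      \<tau>.\<close>
    obtain \<tau> where \<tau>: "c' \<tau> \<noteq> \<zero>\<^bsub>F\<^esub>" and max: "\<And>\<tau>'. c' \<tau>' \<noteq> \<zero>\<^bsub>F\<^esub> \<Longrightarrow> idx (vertex \<tau>') \<le> idx (vertex \<tau>)"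
    proof -
      let ?M = "(\<lambda>\<tau>. idx (vertex \<tau>)) ` {\<tau>. c' \<tau> \<noteq> \<zero>\<^bsub>F\<^esub>}"
      have "Max ?M \<in> ?M" using fin ne by (intro Max_in) auto
      then obtain \<tau> where "c' \<tau> \<noteq> \<zero>\<^bsub>F\<^esub>" "Max ?M = idx (vertex \<tau>)" by blast
      moreover have "idx (vertex \<tau>') \<le> Max ?M" if "c' \<tau>' \<noteq> \<zero>\<^bsub>F\<^esub>" for \<tau>'
        using fin that by (intro Max_ge) auto
      ultimately show thesis by (intro that) auto
    qed
    let ?z = "vertex \<tau>"
    have eq: "\<tau>' = \<tau>" if "c' \<tau>' \<noteq> \<zero>\<^bsub>F\<^esub>" "basin ?z (vertex \<tau>')" for \<tau>'
    proof -
      have "idx ?z = idx (vertex \<tau>')"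
        using idx_le_of_basin [of ?z "vertex \<tau>'"] supp [OF \<tau>] supp [OF that(1)] that(2) max [OF that(1)] by simp
      then have "?z = vertex \<tau>'" using idx_inj supp [OF \<tau>] supp [OF that(1)] by (auto dest: inj_onD)
      then show ?thesis using supp [OF \<tau>] supp [OF that(1)] by metis
    qed
    then have "{\<sigma>. c' \<sigma> \<noteq> \<zero>\<^bsub>F\<^esub> \<and> basin ?z (vertex \<sigma>)} = {\<tau>}"
      using \<tau> basin_self supp [OF \<tau>] by blast
    moreover have "c' \<tau> \<in> carrier F" using fc' by (simp add: F.fsupp_def)
    ultimately have "basin_sum ?z c' = c' \<tau>" by (simp add: basin_sum_def F.csum_def)
    then show False using sum' [of ?z] supp [OF \<tau>] \<tau> by simp
  qed
  moreover have "(\<lambda>\<tau>. c' \<tau> \<oplus>\<^bsub>F\<^esub> \<ominus>\<^bsub>F\<^esub> \<one>\<^bsub>F\<^esub> \<otimes>\<^bsub>F\<^esub> c \<tau>) \<in> boundaries F 0 (top_of_set (S t))"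
    unfolding c'_def by (rule F.push_homologous [OF c open_S]) (use h in \<open>simp add: R_eq\<close>)
  \<comment> \<open>With \<open>c'\<close> zero, the boundary \<open>c' - c\<close> is simply
    \<open>- c\<close>.\<close>
  ultimately have b: "(\<lambda>\<tau>. \<ominus>\<^bsub>F\<^esub> \<one>\<^bsub>F\<^esub> \<otimes>\<^bsub>F\<^esub> c \<tau>) \<in> boundaries F 0 (top_of_set (S t))"
    using fc by (simp add: F.fsupp_def)
  interpret M: module F "zero_chains t" by (rule F.module_chain_module)
  have "\<ominus>\<^bsub>F\<^esub> \<one>\<^bsub>F\<^esub> \<odot>\<^bsub>zero_chains t\<^esub> (\<lambda>\<tau>. \<ominus>\<^bsub>F\<^esub> \<one>\<^bsub>F\<^esub> \<otimes>\<^bsub>F\<^esub> c \<tau>) \<in> boundaries F 0 (top_of_set (S t))"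
    by (rule M.submoduleE(4) [OF F.submodule_boundaries_0 _ b]) simp
  moreover have "\<ominus>\<^bsub>F\<^esub> \<one>\<^bsub>F\<^esub> \<odot>\<^bsub>zero_chains t\<^esub> (\<lambda>\<tau>. \<ominus>\<^bsub>F\<^esub> \<one>\<^bsub>F\<^esub> \<otimes>\<^bsub>F\<^esub> c \<tau>) = c"
    using fc by (simp add: F.fsupp_def F.l_minus F.r_minus)
  ultimately show ?thesis by simp
qed

text \<open>Back substitution in a unitriangular system, from the youngest prescribed zero to the
  oldest. Only coordinates of living zeros are prescribed, as the others have no meaning at time
  \<open>t\<close>.\<close>

lemma ex_chain_basin_sum:
  assumes t: "0 < t" and y: "\<And>z. y z \<in> carrier F" and fin: "finite {z\<in>Z. y z \<noteq> \<zero>\<^bsub>F\<^esub>}"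
  shows "\<exists>c\<in>carrier (zero_chains t). \<forall>z\<in>Z. alive t z \<longrightarrow> basin_sum z c = y z"
proof -
  have "\<exists>c\<in>carrier (zero_chains t). \<forall>z\<in>Z. alive t z \<longrightarrow> basin_sum z c = y z"
    if "\<And>z. y z \<in> carrier F" "\<And>z. z \<in> Z \<Longrightarrow> alive t z \<Longrightarrow> y z \<noteq> \<zero>\<^bsub>F\<^esub> \<Longrightarrow> idx z < n" for n y
    using that
  proof (induction n arbitrary: y)
    case 0
    then have "y z = \<zero>\<^bsub>F\<^esub>" if "z \<in> Z" "alive t z" for z using that by blast
    then show ?case
      by (intro bexI [of _ "\<lambda>_. \<zero>\<^bsub>F\<^esub>"]) (simp_all add: basin_sum_def F.in_chain_module_iff)
  next
    case (Suc n)
    show ?case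
    proof (cases "\<exists>z0\<in>Z. alive t z0 \<and> idx z0 = n")
      case False
      then show ?thesis using Suc.prems by (intro Suc.IH) (auto simp: less_Suc_eq)
    next
      case True
      then obtain z0 where z0: "z0 \<in> Z" "alive t z0" "idx z0 = n" by blast
      \<comment> \<open>Placing the coefficient \<open>y z0\<close> at \<open>z0\<close> changes the
        coordinates of all basins containing \<open>z0\<close>. These belong to zeros no younger
        than \<open>z0\<close>, so the corrected target involves only indices below
        \<open>n\<close>.\<close>
      define y' where "y' = (\<lambda>z. y z \<ominus>\<^bsub>F\<^esub> (if basin z z0 then y z0 else \<zero>\<^bsub>F\<^esub>))"
      have y': "y' z \<in> carrier F" for z using Suc.prems(1) by (simp add: y'_def)
      have lt: "idx z < n" if z: "z \<in> Z" "alive t z" "y' z \<noteq> \<zero>\<^bsub>F\<^esub>" for z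
      proof (cases "z = z0")
        case True
        then show ?thesis using z(3) basin_self [OF z0(1)] Suc.prems(1) by (simp add: y'_def F.r_neg F.minus_eq)
      next
        case False
        then have "idx z \<noteq> n" using idx_inj z z0 by (auto dest: inj_onD)
        moreover have "idx z \<le> n"
        proof (cases "basin z z0")
          case True then show ?thesis using idx_le_of_basin z z0 by blast
        next
          case False
          then have "y z \<noteq> \<zero>\<^bsub>F\<^esub>" using z(3) Suc.prems(1) by (auto simp: y'_def F.minus_eq)
          then show ?thesis using Suc.prems(2) [OF z(1,2)] by simp
        qed
        ultimately show ?thesis by simp
      qed
      have "\<exists>c\<in>carrier (zero_chains t). \<forall>z\<in>Z. alive t z \<longrightarrow> basin_sum z c = y' z"
        by (intro Suc.IH y' lt)
      then obtain c where c: "c \<in> carrier (zero_chains t)" "\<And>z. z \<in> Z \<Longrightarrow> alive t z \<Longrightarrow> basin_sum z c = y' z"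
        by blast
      interpret M: module F "zero_chains t" by (rule F.module_chain_module)
      let ?d = "\<lambda>\<tau>. if \<tau> = point_simplex z0 then y z0 else \<zero>\<^bsub>F\<^esub>"
      have d: "?d \<in> carrier (zero_chains t)"
        using Suc.prems(1) Z_R [OF t z0(1)]
        by (auto simp: F.in_chain_module_iff R_refl_iff intro: singular_simplex_point_simplex)
      have fc: "F.fsupp c" and fd: "F.fsupp ?d" using c(1) d unfolding F.in_chain_module_iff by blast+
      have "basin_sum z (\<lambda>\<sigma>. c \<sigma> \<oplus>\<^bsub>F\<^esub> ?d \<sigma>) = y z" if "z \<in> Z" "alive t z" for z
      proof -
        have "basin_sum z (\<lambda>\<sigma>. c \<sigma> \<oplus>\<^bsub>F\<^esub> ?d \<sigma>) = y' z \<oplus>\<^bsub>F\<^esub> (if basin z z0 then y z0 else \<zero>\<^bsub>F\<^esub>)"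
          using c(2) [OF that] Suc.prems(1) unfolding basin_sum_def
          by (simp add: F.csum_add [OF fc fd] F.csum_delta)
        then show ?thesis using Suc.prems(1) by (auto simp: y'_def F.minus_eq F.a_assoc F.l_neg)
      qed
      moreover have "(\<lambda>\<sigma>. c \<sigma> \<oplus>\<^bsub>F\<^esub> ?d \<sigma>) \<in> carrier (zero_chains t)"
        using M.M.a_closed [OF c(1) d] by simp
      ultimately show ?thesis by blast
    qed
  qed
  moreover have "\<exists>n. \<forall>z\<in>{z\<in>Z. y z \<noteq> \<zero>\<^bsub>F\<^esub>}. idx z < n"
    using fin finite_nat_set_iff_bounded [of "idx ` {z\<in>Z. y z \<noteq> \<zero>\<^bsub>F\<^esub>}"] by simp
  ultimately show ?thesis using y by blast
qed

end

section \<open>Bars indexed by critical points with multiplicity\<close>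

locale sublevel_merging = merging_chains R Z idx "SIGMA j:J. {..<m j}" pt "\<lambda>p. s (fst p)" F "\<lambda>t. sublevel u (level t)"
  for R Z idx and J :: "nat set" and m :: "nat \<Rightarrow> nat" and pt :: "nat \<times> nat \<Rightarrow> complex" and s :: "nat \<Rightarrow> real"
    and F :: "('f, 'r) ring_scheme" and u
begin

definition bar_zero :: "nat \<times> nat \<Rightarrow> complex"
  where "bar_zero = (SOME b. bij_betw b (SIGMA j:J. {..<m j}) (Z - {root}) \<and> (\<forall>p\<in>SIGMA j:J. {..<m j}. death (b p) = s (fst p)))"

lemma bar_zero: "bij_betw bar_zero (SIGMA j:J. {..<m j}) (Z - {root})" "\<And>p. p \<in> (SIGMA j:J. {..<m j}) \<Longrightarrow> death (bar_zero p) = s (fst p)"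
proof -
  have "bij_betw bar_zero (SIGMA j:J. {..<m j}) (Z - {root}) \<and> (\<forall>p\<in>SIGMA j:J. {..<m j}. death (bar_zero p) = s (fst p))"
    unfolding bar_zero_def by (rule someI_ex [OF ex_bij_death])
  then show "bij_betw bar_zero (SIGMA j:J. {..<m j}) (Z - {root})" "\<And>p. p \<in> (SIGMA j:J. {..<m j}) \<Longrightarrow> death (bar_zero p) = s (fst p)"
    by blast+
qed

lemma bar_zero_in: "j \<in> J \<Longrightarrow> i < m j \<Longrightarrow> bar_zero (j, i) \<in> Z - {root}"
  using bij_betwE [OF bar_zero(1)] by blast

lemma alive_bar_zero_iff: "j \<in> J \<Longrightarrow> i < m j \<Longrightarrow> 0 < t \<Longrightarrow> alive t (bar_zero (j, i)) \<longleftrightarrow> t \<le> s j"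
  using alive_iff_le_death [OF bar_zero_in] bar_zero(2) [of "(j, i)"] by simp

lemma Z_cases:
  assumes "z \<in> Z"
  obtains "z = root" | j i where "j \<in> J" "i < m j" "z = bar_zero (j, i)"
proof (cases "z = root")
  case False
  then have "z \<in> bar_zero ` (SIGMA j:J. {..<m j})" using assms bij_betw_imp_surj_on [OF bar_zero(1)] by simp
  then show ?thesis using that(2) by auto
qed (use that in simp)

abbreviation "C t \<equiv> chain_module F 0 (sigma_space u t)"

abbreviation "bars \<equiv> persistence_sum (interval_persistence F {0<..})
      (persistence_dsum J (\<lambda>j. persistence_power (m j) (interval_persistence F {0<..s j})))"

text \<open>Within the lifetime of a bar the coordinate does not mention \<open>t\<close>; outside
  it the interval module is zero and so is the entry. The root needs no condition, since chains at
  nonpositive times vanish.\<close>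

definition coords :: "real \<Rightarrow> (complex, 'f) coeff_chain \<Rightarrow> 'f \<times> (nat \<Rightarrow> nat \<Rightarrow> 'f)"
  where "coords t c = (basin_sum root c,
    \<lambda>j\<in>J. \<lambda>i\<in>{..<m j}. if 0 < t \<and> t \<le> s j then basin_sum (bar_zero (j, i)) c else \<zero>\<^bsub>F\<^esub>)"

lemma space_bars: "space_at bars t =
    prod_module (if 0 < t then line_module F else zero_module \<zero>\<^bsub>F\<^esub>)
      (dsum_module J (\<lambda>j. dsum_module {..<m j} (\<lambda>_. if 0 < t \<and> t \<le> s j then line_module F else zero_module \<zero>\<^bsub>F\<^esub>)))"
  by (simp add: persistence_sum_def interval_persistence_def persistence_dsum_def persistence_power_def)

lemma map_bars: "map_at bars t t' = map_prod (\<lambda>x. if 0 < t \<and> 0 < t' then x else \<zero>\<^bsub>F\<^esub>)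
    (\<lambda>x. \<lambda>j\<in>J. \<lambda>i\<in>{..<m j}. if (0 < t \<and> t \<le> s j) \<and> (0 < t' \<and> t' \<le> s j) then x j i else \<zero>\<^bsub>F\<^esub>)"
  by (simp add: persistence_sum_def interval_persistence_def persistence_dsum_def persistence_power_def)

lemma carrier_bars: "carrier (space_at bars t) =
    (if 0 < t then carrier F else {\<zero>\<^bsub>F\<^esub>}) \<times>
    {y \<in> \<Pi>\<^sub>E j\<in>J. \<Pi>\<^sub>E i\<in>{..<m j}. if 0 < t \<and> t \<le> s j then carrier F else {\<zero>\<^bsub>F\<^esub>}.
      finite {j\<in>J. y j \<noteq> (\<lambda>i\<in>{..<m j}. \<zero>\<^bsub>F\<^esub>)}}"
proof -
  have zero: "zero (if b then line_module F else zero_module \<zero>\<^bsub>F\<^esub>) = \<zero>\<^bsub>F\<^esub>"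
    and car: "carrier (if b then line_module F else zero_module \<zero>\<^bsub>F\<^esub>) = (if b then carrier F else {\<zero>\<^bsub>F\<^esub>})" for b
    by (simp_all add: line_module_def zero_module_def)
  have fin: "finite {i \<in> {..<n}. P i}" for n :: nat and P by simp
  show ?thesis
    unfolding space_bars prod_module_def dsum_module_def partial_object.simps ring.simps zero car
    using fin by simp
qed

lemma fsupp_C: "c \<in> carrier (C t) \<Longrightarrow> F.fsupp c"
  by (simp add: F.in_chain_module_iff)

lemma basin_sum_closed: "F.fsupp c \<Longrightarrow> basin_sum z c \<in> carrier F"
  by (simp add: basin_sum_def)

text \<open>Only finite support is at stake: each of the finitely many simplices of \<open>c\<close>
  lies in the basins of finitely many living zeros, and distinct bars have distinct zeros.\<close>

lemma coords_in_carrier: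
  assumes c: "c \<in> carrier (C t)"
  shows "coords t c \<in> carrier (space_at bars t)"
proof -
  have f: "F.fsupp c" using c by (rule fsupp_C)
  let ?zero = "\<lambda>j. \<lambda>i\<in>{..<m j}. \<zero>\<^bsub>F\<^esub>"
  have "finite {j\<in>J. snd (coords t c) j \<noteq> ?zero j}"
  proof (cases "0 < t")
    case False
    then have "{j\<in>J. snd (coords t c) j \<noteq> ?zero j} = {}" by (auto simp: coords_def)
    then show ?thesis by (simp only: finite.emptyI)
  next
    case True
    let ?A = "\<Union>\<sigma>\<in>{\<sigma>. c \<sigma> \<noteq> \<zero>\<^bsub>F\<^esub>}. {z\<in>Z. alive t z \<and> basin z (vertex \<sigma>)}"
    have "finite {z\<in>Z. alive t z \<and> basin z (vertex \<sigma>)}" if "c \<sigma> \<noteq> \<zero>\<^bsub>F\<^esub>" for \<sigma>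
    proof (rule finite_basin [OF True])
      have "singular_simplex 0 (sigma_space u t) \<sigma>" using c that by (simp add: F.in_chain_module_iff)
      then show "R t (vertex \<sigma>) (vertex \<sigma>)"
        using singular_simplex_0D(1) by (fastforce simp: R_refl_iff sigma_space_def)
    qed
    then have "finite ?A" using f by (simp add: F.fsupp_def)
    then have "finite {p \<in> SIGMA j:J. {..<m j}. bar_zero p \<in> ?A}"
      using bij_betw_imp_inj_on [OF bar_zero(1)]
      by (intro finite_inverse_image_gen)
    moreover have "{j\<in>J. snd (coords t c) j \<noteq> ?zero j} \<subseteq> fst ` {p \<in> SIGMA j:J. {..<m j}. bar_zero p \<in> ?A}"
    proof
      fix j assume j: "j \<in> {j\<in>J. snd (coords t c) j \<noteq> ?zero j}"
      then obtain i where i: "i < m j" "t \<le> s j" "basin_sum (bar_zero (j, i)) c \<noteq> \<zero>\<^bsub>F\<^esub>"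
        by (auto simp: coords_def fun_eq_iff split: if_splits)
      have "{\<sigma>. c \<sigma> \<noteq> \<zero>\<^bsub>F\<^esub> \<and> basin (bar_zero (j, i)) (vertex \<sigma>)} \<noteq> {}"
      proof
        assume "{\<sigma>. c \<sigma> \<noteq> \<zero>\<^bsub>F\<^esub> \<and> basin (bar_zero (j, i)) (vertex \<sigma>)} = {}"
        then have "basin_sum (bar_zero (j, i)) c = \<zero>\<^bsub>F\<^esub>"
          unfolding basin_sum_def F.csum_def by (simp only: F.finsum_empty)
        then show False using i(3) by simp
      qed
      then have "bar_zero (j, i) \<in> ?A" using bar_zero_in i alive_bar_zero_iff [OF _ i(1) True] j by blast
      then show "j \<in> fst ` {p \<in> SIGMA j:J. {..<m j}. bar_zero p \<in> ?A}"
        using i(1) j by (intro image_eqI [of _ _ "(j, i)"]) auto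
    qed
    ultimately show ?thesis using finite_surj by blast
  qed
  moreover have "basin_sum root c = \<zero>\<^bsub>F\<^esub>" if "\<not> 0 < t"
    using c F.chain_module_sigma_space_trivial [of t u] that by (simp add: basin_sum_def)
  ultimately show ?thesis
    unfolding carrier_bars using basin_sum_closed [OF f] by (auto simp: coords_def)
qed

lemma carrier_bars_trivial:
  assumes "t \<le> 0" "w \<in> carrier (space_at bars t)"
  shows "w = coords t (\<lambda>_. \<zero>\<^bsub>F\<^esub>)"
proof -
  obtain a y where w: "w = (a, y)" by (cases w)
  have a: "a = \<zero>\<^bsub>F\<^esub>" and y: "y \<in> (\<Pi>\<^sub>E j\<in>J. \<Pi>\<^sub>E i\<in>{..<m j}. {\<zero>\<^bsub>F\<^esub>})"
    using assms unfolding w carrier_bars by simp_all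
  have "y = (\<lambda>j\<in>J. \<lambda>i\<in>{..<m j}. \<zero>\<^bsub>F\<^esub>)"
  proof (rule PiE_ext [OF y])
    fix j assume "j \<in> J"
    then have yj: "y j \<in> (\<Pi>\<^sub>E i\<in>{..<m j}. {\<zero>\<^bsub>F\<^esub>})" using y by blast
    show "y j = (\<lambda>j\<in>J. \<lambda>i\<in>{..<m j}. \<zero>\<^bsub>F\<^esub>) j"
      using \<open>j \<in> J\<close> yj by (auto intro!: PiE_ext [OF yj])
  qed auto
  then show ?thesis using a w assms(1) by (auto simp: coords_def basin_sum_def restrict_def fun_eq_iff)
qed

lemma coords_surj:
  assumes w: "w \<in> carrier (space_at bars t)"
  shows "w \<in> coords t ` carrier (C t)"
proof (cases "0 < t")
  case False
  then show ?thesis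
    using carrier_bars_trivial [OF _ w] F.chain_module_sigma_space_trivial [of t u] by simp
next
  case True
  obtain a y where ay: "w = (a, y)" by (cases w)
  let ?zero = "\<lambda>j. \<lambda>i\<in>{..<m j}. \<zero>\<^bsub>F\<^esub>"
  have a: "a \<in> carrier F"
    and y: "y \<in> (\<Pi>\<^sub>E j\<in>J. \<Pi>\<^sub>E i\<in>{..<m j}. if t \<le> s j then carrier F else {\<zero>\<^bsub>F\<^esub>})"
    and fin: "finite {j\<in>J. y j \<noteq> ?zero j}"
    using w True unfolding ay carrier_bars by simp_all
  have yc: "y j i \<in> carrier F" if "j \<in> J" "i < m j" for j i
    using PiE_mem [OF PiE_mem [OF y that(1)], of i] that(2) by (auto split: if_splits)
  have y0: "y j i = \<zero>\<^bsub>F\<^esub>" if "j \<in> J" "i < m j" "\<not> t \<le> s j" for j i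
    using PiE_mem [OF PiE_mem [OF y that(1)], of i] that(2,3) by simp
  let ?inv = "inv_into (SIGMA j:J. {..<m j}) bar_zero"
  \<comment> \<open>The prescribed bar coordinates are moved to the zeros along the inverse of
    \<open>bar_zero\<close>; the value 0 elsewhere only makes \<open>Y\<close> total.\<close>
  define Y where "Y = (\<lambda>z. if z = root then a else if z \<in> Z then y (fst (?inv z)) (snd (?inv z)) else \<zero>\<^bsub>F\<^esub>)"
  have Ybar_zero: "Y (bar_zero (j, i)) = y j i" if "j \<in> J" "i < m j" for j i
    using bar_zero_in [OF that] that inv_into_f_f [OF bij_betw_imp_inj_on [OF bar_zero(1)], of "(j, i)"]
    by (simp add: Y_def)
  have Yroot: "Y root = a" by (simp add: Y_def)
  have "Y z \<in> carrier F" for z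
  proof (cases "z \<in> Z")
    case True
    then show ?thesis by (rule Z_cases) (use Ybar_zero yc Yroot a in auto)
  next
    case False
    then show ?thesis using root_in_Z by (auto simp: Y_def)
  qed
  moreover have "finite {z\<in>Z. Y z \<noteq> \<zero>\<^bsub>F\<^esub>}"
  proof (rule finite_subset)
    show "{z\<in>Z. Y z \<noteq> \<zero>\<^bsub>F\<^esub>} \<subseteq> insert root (bar_zero ` (SIGMA j:{j\<in>J. y j \<noteq> ?zero j}. {..<m j}))"
    proof
      fix z assume z: "z \<in> {z\<in>Z. Y z \<noteq> \<zero>\<^bsub>F\<^esub>}"
      then have "z \<in> Z" by simp
      then show "z \<in> insert root (bar_zero ` (SIGMA j:{j\<in>J. y j \<noteq> ?zero j}. {..<m j}))"
      proof (rule Z_cases)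
        fix j i assume ji: "j \<in> J" "i < m j" "z = bar_zero (j, i)"
        then have "y j \<noteq> ?zero j" using z Ybar_zero by auto
        then show ?thesis using ji by blast
      qed simp
    qed
  qed (use fin in auto)
  ultimately obtain c where c: "c \<in> carrier (C t)" "\<And>z. z \<in> Z \<Longrightarrow> alive t z \<Longrightarrow> basin_sum z c = Y z"
    using ex_chain_basin_sum [OF True, of Y] unfolding sigma_space_def by blast
  have "coords t c = (a, y)"
    unfolding coords_def
  proof (rule arg_cong2 [of _ _ _ _ Pair])
    show "basin_sum root c = a" using c(2) [OF root_in_Z alive_root] Yroot by simp
    show "(\<lambda>j\<in>J. \<lambda>i\<in>{..<m j}. if 0 < t \<and> t \<le> s j then basin_sum (bar_zero (j, i)) c else \<zero>\<^bsub>F\<^esub>) = y"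
      (is "?L = y")
    proof (rule PiE_ext)
      show "?L \<in> (\<Pi>\<^sub>E j\<in>J. \<Pi>\<^sub>E i\<in>{..<m j}. UNIV)" by auto
      show "y \<in> (\<Pi>\<^sub>E j\<in>J. \<Pi>\<^sub>E i\<in>{..<m j}. UNIV)" using y by (auto simp: PiE_iff)
      fix j assume j: "j \<in> J"
      show "?L j = y j"
      proof (rule PiE_ext)
        show "?L j \<in> (\<Pi>\<^sub>E i\<in>{..<m j}. UNIV)" using j by auto
        show "y j \<in> (\<Pi>\<^sub>E i\<in>{..<m j}. UNIV)" using y j by (auto simp: PiE_iff)
        fix i assume "i \<in> {..<m j}"
        then have i: "i < m j" by simp
        show "?L j i = y j i"
        proof (cases "t \<le> s j")
          case True
          then have "basin_sum (bar_zero (j, i)) c = y j i"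
            using c(2) [of "bar_zero (j, i)"] bar_zero_in [OF j i] alive_bar_zero_iff [OF j i \<open>0 < t\<close>] Ybar_zero [OF j i] by simp
          then show ?thesis using j i True \<open>0 < t\<close> by simp
        qed (use j i y0 in simp)
      qed
    qed
  qed
  then show ?thesis using ay c(1) by force
qed

interpretation filt: module_filtration F "\<lambda>t. C t"
  by (rule F.sublevel_filtration)

lemma covers_bars: "filt.covers bars coords"
  unfolding filt.covers_def
proof (intro conjI allI ballI impI)
  fix t
  show "carrier (space_at bars t) = coords t ` carrier (C t)"
    using coords_in_carrier coords_surj by blast
  show "coords t \<zero>\<^bsub>C t\<^esub> = \<zero>\<^bsub>space_at bars t\<^esub>"
    by (auto simp: space_bars prod_module_def dsum_module_def line_module_def zero_module_def coords_def
        basin_sum_def fun_eq_iff)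
  fix x assume x: "x \<in> carrier (C t)"
  have fx: "F.fsupp x" using x by (rule fsupp_C)
  have triv: "x = (\<lambda>_. \<zero>\<^bsub>F\<^esub>)" if "\<not> 0 < t"
    using x F.chain_module_sigma_space_trivial [of t u] that by simp
  {
    fix y assume y: "y \<in> carrier (C t)"
    have fy: "F.fsupp y" using y by (rule fsupp_C)
    have triv': "y = (\<lambda>_. \<zero>\<^bsub>F\<^esub>)" if "\<not> 0 < t"
      using y F.chain_module_sigma_space_trivial [of t u] that by simp
    have "basin_sum z (\<lambda>\<sigma>. x \<sigma> \<oplus>\<^bsub>F\<^esub> y \<sigma>) = basin_sum z x \<oplus>\<^bsub>F\<^esub> basin_sum z y" for z
      unfolding basin_sum_def by (rule F.csum_add [OF fx fy])
    then show "coords t (x \<oplus>\<^bsub>C t\<^esub> y) = coords t x \<oplus>\<^bsub>space_at bars t\<^esub> coords t y"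
      using triv triv'
      by (auto simp: space_bars prod_module_def dsum_module_def line_module_def zero_module_def coords_def
          fun_eq_iff restrict_def basin_sum_def)
  }
  fix a assume a: "a \<in> carrier F"
  have "basin_sum z (\<lambda>\<sigma>. a \<otimes>\<^bsub>F\<^esub> x \<sigma>) = a \<otimes>\<^bsub>F\<^esub> basin_sum z x" for z
    unfolding basin_sum_def by (rule F.csum_smult [OF fx a])
  then show "coords t (a \<odot>\<^bsub>C t\<^esub> x) = a \<odot>\<^bsub>space_at bars t\<^esub> coords t x"
    using triv a
    by (auto simp: space_bars prod_module_def dsum_module_def line_module_def zero_module_def coords_def
        fun_eq_iff restrict_def basin_sum_def)
next
  fix t t' :: real and x
  assume tt': "t \<le> t'" and x: "x \<in> carrier (C t)"
  have triv: "x = (\<lambda>_. \<zero>\<^bsub>F\<^esub>)" if "\<not> 0 < t"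
    using x F.chain_module_sigma_space_trivial [of t u] that by simp
  show "map_at bars t t' (coords t x) = coords t' x"
  proof (cases "0 < t")
    case True
    \<comment> \<open>If a bar still contains \<open>t'\<close>, it contains the earlier positive
      time \<open>t\<close> too, so the same basin sum appears on both sides; otherwise both entries
      are zero.\<close>
    then show ?thesis using tt' unfolding map_bars by (auto simp: coords_def fun_eq_iff restrict_def)
  next
    case False
    have "basin_sum z (\<lambda>_. \<zero>\<^bsub>F\<^esub>) = \<zero>\<^bsub>F\<^esub>" for z by (simp add: basin_sum_def)
    then show ?thesis using False unfolding map_bars triv [OF False]
      by (auto simp: coords_def fun_eq_iff restrict_def)
  qed
qed

text \<open>Equality of the two kernels: a difference bounds exactly when its mass vanishes in the
  basin of every living zero, and these zeros are the root and the zeros of the bars containing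
  \<open>t\<close>.\<close>

lemma homology_class_eq_iff:
  assumes x: "x \<in> carrier (C t)" and y: "y \<in> carrier (C t)"
  shows "F.homology_class u t x = F.homology_class u t y \<longleftrightarrow> coords t x = coords t y"
proof (cases "0 < t")
  case False
  then show ?thesis using x y F.chain_module_sigma_space_trivial [of t u] by simp
next
  case True
  interpret M: module F "C t" by (rule F.module_chain_module)
  have fx: "F.fsupp x" and fy: "F.fsupp y" using x y by (simp_all add: fsupp_C)
  have d: "x \<ominus>\<^bsub>C t\<^esub> y \<in> carrier (C t)" using x y by (rule M.M.minus_closed)
  have "x \<ominus>\<^bsub>C t\<^esub> y = x \<oplus>\<^bsub>C t\<^esub> (\<ominus>\<^bsub>F\<^esub> \<one>\<^bsub>F\<^esub> \<odot>\<^bsub>C t\<^esub> y)"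
    using y by (simp only: a_minus_def M.smult_l_minus [OF F.one_closed] M.smult_one)
  then have eq: "x \<ominus>\<^bsub>C t\<^esub> y = (\<lambda>\<sigma>. x \<sigma> \<oplus>\<^bsub>F\<^esub> \<ominus>\<^bsub>F\<^esub> \<one>\<^bsub>F\<^esub> \<otimes>\<^bsub>F\<^esub> y \<sigma>)" by simp
  have sum: "basin_sum z (x \<ominus>\<^bsub>C t\<^esub> y) = basin_sum z x \<ominus>\<^bsub>F\<^esub> basin_sum z y" for z
    unfolding eq basin_sum_def using fx fy
    by (simp add: F.csum_add F.csum_smult F.l_minus F.minus_eq)
  have sum0: "basin_sum z (x \<ominus>\<^bsub>C t\<^esub> y) = \<zero>\<^bsub>F\<^esub> \<longleftrightarrow> basin_sum z x = basin_sum z y" for z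
    unfolding sum using basin_sum_closed [OF fx] basin_sum_closed [OF fy] by (simp add: F.r_right_minus_eq)
  have "F.homology_class u t x = F.homology_class u t y \<longleftrightarrow> x \<ominus>\<^bsub>C t\<^esub> y \<in> boundaries F 0 (sigma_space u t)"
    using quotient_module_projection(5) [OF F.module_chain_module F.submodule_boundaries_0 x y] True
    by (simp add: F.homology_class_def)
  also have "\<dots> \<longleftrightarrow> (\<forall>z\<in>Z. alive t z \<longrightarrow> basin_sum z x = basin_sum z y)"
    using boundary_of_basin_sum_zero [OF True, of "x \<ominus>\<^bsub>C t\<^esub> y"] basin_sum_boundary [OF _ True, of _ "x \<ominus>\<^bsub>C t\<^esub> y"] d sum0
    unfolding sigma_space_def by blast
  also have "\<dots> \<longleftrightarrow> coords t x = coords t y"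
  proof
    assume al: "\<forall>z\<in>Z. alive t z \<longrightarrow> basin_sum z x = basin_sum z y"
    then have "basin_sum root x = basin_sum root y" using root_in_Z alive_root by blast
    moreover have "basin_sum (bar_zero (j, i)) x = basin_sum (bar_zero (j, i)) y" if "j \<in> J" "i < m j" "t \<le> s j" for j i
      using al bar_zero_in [OF that(1,2)] alive_bar_zero_iff [OF that(1,2) True] that(3) by blast
    ultimately show "coords t x = coords t y" by (auto simp: coords_def fun_eq_iff restrict_def)
  next
    assume e: "coords t x = coords t y"
    show "\<forall>z\<in>Z. alive t z \<longrightarrow> basin_sum z x = basin_sum z y"
    proof (intro ballI impI)
      fix z assume z: "z \<in> Z" "alive t z"
      from z(1) show "basin_sum z x = basin_sum z y"
      proof (rule Z_cases)
        assume "z = root" then show ?thesis using e by (simp add: coords_def)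
      next
        fix j i assume ji: "j \<in> J" "i < m j" "z = bar_zero (j, i)"
        then have "t \<le> s j" using alive_bar_zero_iff [OF ji(1,2) True] z by simp
        moreover have "snd (coords t x) j i = snd (coords t y) j i" using e by simp
        ultimately show ?thesis using ji True by (simp add: coords_def)
      qed
    qed
  qed
  finally show ?thesis .
qed

theorem inner_persistence_isomorphic: "persistence_isomorphic F (inner_persistence F u) bars"
  by (rule filt.persistence_isomorphic_of_covers [OF F.covers_inner_persistence covers_bars homology_class_eq_iff])

end

section \<open>The main theorem\<close>

text \<open>On a compact set a strict bound leaves room for a slightly lower positive level. With
  \<open>l = level t\<close> this gives left continuity along paths; with \<open>l = 1\<close> it
  shows that a compact set is eventually swallowed.\<close>

lemma compact_level_bound:
  assumes "compact K" "K \<subseteq> ball 0 1" "u holomorphic_on ball 0 1"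
    and less: "\<And>z. z \<in> K \<Longrightarrow> norm (u z) < l" and l: "0 < l" "l \<le> 1"
  obtains s where "0 < s" "level s < l" "K \<subseteq> sublevel u (level s)"
proof -
  have "\<exists>M. 0 \<le> M \<and> M < l \<and> (\<forall>z\<in>K. norm (u z) \<le> M)"
  proof (cases "K = {}")
    case True
    then show ?thesis using l by (intro exI [of _ 0]) auto
  next
    case False
    have "continuous_on K u" by (rule continuous_on_subset [OF holomorphic_on_imp_continuous_on [OF assms(3)] assms(2)])
    then obtain z where "z \<in> K" "\<forall>w\<in>K. norm (u w) \<le> norm (u z)"
      using continuous_attains_sup [OF assms(1) False, of "\<lambda>z. norm (u z)"] continuous_on_norm by blast
    then show ?thesis using less by (intro exI [of _ "norm (u z)"]) auto
  qed
  then obtain M where M: "0 \<le> M" "M < l" "\<And>z. z \<in> K \<Longrightarrow> norm (u z) \<le> M" by blast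
  define v where "v = (M + l) / 2"
  have v: "0 < v" "M < v" "v < l" "v < 1" using M(1,2) l by (simp_all add: v_def)
  define s where "s = ln ((1 + v) / (1 - v))"
  have lev: "level s = v" unfolding s_def using v by (intro level_ln) auto
  show thesis
  proof (rule that)
    show "0 < s" using level_pos_iff [of s] lev v by simp
    show "level s < l" using lev v by simp
    show "K \<subseteq> sublevel u (level s)"
      using assms(2) M(3) v(2) lev by (force simp: sublevel_def)
  qed
qed

context
  fixes B :: "complex \<Rightarrow> complex" and J :: "nat set" and \<omega> :: "nat \<Rightarrow> complex" and m :: "nat \<Rightarrow> nat" and s :: "nat \<Rightarrow> real"
  assumes blaschke: "blaschke_product B" and nc: "\<not> B constant_on ball 0 1" and prop_B: "property_B B"
    and bij_\<omega>: "bij_betw \<omega> J (disk_zeros (deriv B) - disk_zeros B)"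
    and m: "\<And>j. j \<in> J \<Longrightarrow> (\<forall>k\<in>{1..m j}. (deriv ^^ k) B (\<omega> j) = 0) \<and> (deriv ^^ (m j + 1)) B (\<omega> j) \<noteq> 0"
    and s: "\<And>j. j \<in> J \<Longrightarrow> s j = ln ((1 + norm (B (\<omega> j))) / (1 - norm (B (\<omega> j))))"
begin

lemma holomorphic_B: "B holomorphic_on ball 0 1"
  using blaschke by (simp add: blaschke_product_def inner_function_def)

lemma B_less_one: "norm z < 1 \<Longrightarrow> norm (B z) < 1"
  by (rule norm_blaschke_product_less [OF blaschke nc])

lemma open_sublevel_B: "open (sublevel B (level t))"
proof -
  have "open (ball 0 1 \<inter> B -` ball 0 (level t))"
    by (intro continuous_open_preimage holomorphic_on_imp_continuous_on holomorphic_B) auto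
  moreover have "sublevel B (level t) = ball 0 1 \<inter> B -` ball 0 (level t)" by (auto simp: sublevel_def)
  ultimately show ?thesis by simp
qed

lemma card_zeros_component:
  assumes t: "0 < t" and x: "x \<in> sublevel B (level t)"
  defines "C \<equiv> connected_component_set (sublevel B (level t)) x"
  shows "C \<subseteq> ball 0 1"
    and "finite {z \<in> C. B z = 0}" "{z \<in> C. B z = 0} \<noteq> {}"
    and "finite {z \<in> C. deriv B z = 0 \<and> B z \<noteq> 0}"
    and "int (card {z \<in> C. B z = 0}) = 1 + (\<Sum>z | z \<in> C \<and> deriv B z = 0 \<and> B z \<noteq> 0. zorder (deriv B) z)"
proof -
  have C: "C \<in> components (sublevel B (level t))" using x by (simp add: C_def componentsI)
  have lt: "0 < level t" "level t < 1" using t level_less_one by simp_all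
  have cl: "closure C \<subseteq> ball 0 1" using prop_B [unfolded property_B_def] C lt
    by (meson greaterThanLessThan_iff)
  then show "C \<subseteq> ball 0 1" using closure_subset by blast
  note card = card_zeros_component_sublevel [OF holomorphic_B nc lt(1) C [unfolded sublevel_def] cl]
  show "finite {z \<in> C. B z = 0}" "{z \<in> C. B z = 0} \<noteq> {}"
    "finite {z \<in> C. deriv B z = 0 \<and> B z \<noteq> 0}"
    "int (card {z \<in> C. B z = 0}) = 1 + (\<Sum>z | z \<in> C \<and> deriv B z = 0 \<and> B z \<noteq> 0. zorder (deriv B) z)"
    by (fact card)+
qed

lemma \<omega>_in:
  assumes "j \<in> J"
  shows "norm (\<omega> j) < 1" "deriv B (\<omega> j) = 0" "B (\<omega> j) \<noteq> 0"
  using bij_betwE [OF bij_\<omega>] assms by (auto simp: disk_zeros_def)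

lemma level_s: "j \<in> J \<Longrightarrow> level (s j) = norm (B (\<omega> j))"
  using s [of j] level_ln [of "norm (B (\<omega> j))"] B_less_one [of "\<omega> j"] \<omega>_in [of j] by simp

lemma zorder_deriv_\<omega>:
  assumes j: "j \<in> J"
  shows "zorder (deriv B) (\<omega> j) = int (m j)"
proof (rule zorder_zero_eqI [of _ "ball 0 1"])
  \<comment> \<open>The derivatives of \<open>deriv B\<close> of orders below \<open>m j\<close> are
    those of \<open>B\<close> of orders 1 to \<open>m j\<close>, so the first nonzero one gives
    order exactly \<open>m j\<close>.\<close>
  have shift: "(deriv ^^ k) (deriv B) = (deriv ^^ Suc k) B" for k by (simp add: funpow_swap1)
  show "deriv B holomorphic_on ball 0 1" using holomorphic_B by (simp add: holomorphic_deriv)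
  show "(deriv ^^ k) (deriv B) (\<omega> j) = 0" if "k < nat (int (m j))" for k
    using m [OF j] that unfolding shift by (metis Suc_leI atLeastAtMost_iff le_add1 nat_int plus_1_eq_Suc)
  show "(deriv ^^ nat (int (m j))) (deriv B) (\<omega> j) \<noteq> 0"
    using m [OF j] unfolding shift by simp
qed (use \<omega>_in [OF j] in auto)

text \<open>The analytic count enters the combinatorics here: a critical point appears as
  \<open>m j\<close> pairs, so its order becomes a number of indices.\<close>

lemma merging_sublevels:
  "merging_components (\<lambda>t. connected_component (sublevel B (level t))) (disk_zeros B) (to_nat_on (disk_zeros B))
    (SIGMA j:J. {..<m j}) (\<lambda>p. \<omega> (fst p)) (\<lambda>p. s (fst p))"
proof
  fix t :: real and x y z
  show "connected_component (sublevel B (level t)) x y \<Longrightarrow> connected_component (sublevel B (level t)) y x"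
    by (rule connected_component_sym)
  show "connected_component (sublevel B (level t)) x y \<Longrightarrow> connected_component (sublevel B (level t)) y z \<Longrightarrow> connected_component (sublevel B (level t)) x z"
    by (rule connected_component_trans)
next
  fix t t' :: real and x y
  show "t \<le> t' \<Longrightarrow> connected_component (sublevel B (level t)) x y \<Longrightarrow> connected_component (sublevel B (level t')) x y"
    using connected_component_of_subset sublevel_level_mono by blast
next
  fix t :: real and x y assume t: "0 < t" and xy: "connected_component (sublevel B (level t)) x y"
  obtain g where g: "path g" "path_image g \<subseteq> sublevel B (level t)" "pathstart g = x" "pathfinish g = y"
    using xy unfolding path_component_eq_connected_component [OF open_imp_locally_path_connected [OF open_sublevel_B], symmetric] path_component_def
    by blast
  \<comment> \<open>The compact path already lies below a slightly lower level, so the connection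
    exists at an earlier time.\<close>
  obtain r where r: "0 < r" "level r < level t" "path_image g \<subseteq> sublevel B (level r)"
    by (rule compact_level_bound [OF compact_path_image [OF g(1)] _ holomorphic_B, of "level t"])
      (use g(2) t level_less_one [of t] in \<open>auto simp: sublevel_def\<close>)
  have "connected_component (sublevel B (level r)) x y"
    unfolding connected_component_def using r(3) g connected_path_image
    by (metis pathfinish_in_path_image pathstart_in_path_image)
  then show "\<exists>r. 0 < r \<and> r < t \<and> connected_component (sublevel B (level r)) x y" using r by auto
next
  fix t :: real and z assume "0 < t" "z \<in> disk_zeros B"
  then show "connected_component (sublevel B (level t)) z z"
    by (auto simp: disk_zeros_def sublevel_def connected_component_refl_eq)
next
  fix t :: real and x assume t: "0 < t" and "connected_component (sublevel B (level t)) x x"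
  then have x: "x \<in> sublevel B (level t)" by (simp add: connected_component_refl_eq)
  then show "\<exists>z\<in>disk_zeros B. connected_component (sublevel B (level t)) x z"
    using card_zeros_component(1,3) [OF t x] unfolding disk_zeros_def by blast
next
  fix z z' assume z: "z \<in> disk_zeros B" "z' \<in> disk_zeros B"
  then have seg: "closed_segment z z' \<subseteq> ball 0 1"
    by (intro closed_segment_subset) (auto simp: disk_zeros_def)
  \<comment> \<open>The disk is convex and \<open>B\<close> has modulus below 1 on the segment, so
    some level contains the whole of it and joins the two zeros.\<close>
  obtain r where r: "0 < r" "level r < 1" "closed_segment z z' \<subseteq> sublevel B (level r)"
    by (rule compact_level_bound [OF compact_segment seg holomorphic_B, of 1]) (use B_less_one seg in auto)
  then have "connected_component (sublevel B (level r)) z z'"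
    unfolding connected_component_def by (intro exI [of _ "closed_segment z z'"]) auto
  then show "\<exists>t>0. connected_component (sublevel B (level t)) z z'" using r(1) by blast
next
  \<comment> \<open>Any point of the disk would do: at a level above its value it has a component,
    and every component contains a zero.\<close>
  obtain r where r: "0 < r" "level r < 1" "{0} \<subseteq> sublevel B (level r)"
    by (rule compact_level_bound [OF _ _ holomorphic_B, of "{0}" 1]) (use B_less_one [of 0] in auto)
  then show "disk_zeros B \<noteq> {}"
    using card_zeros_component(1,3) [OF r(1), of 0] r(3) unfolding disk_zeros_def by blast
next
  \<comment> \<open>Countability makes \<open>to_nat_on\<close> an injective age; it follows by
    exhausting the disk with compact disks.\<close>
  have "countable {z \<in> ball 0 1. B z = 0}"
  proof (rule holomorphic_countable_zeros [OF holomorphic_B _ _ _ nc])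
    have "ball (0::complex) 1 = (\<Union>n. cball 0 (1 - inverse (real (Suc n))))"
    proof (intro subset_antisym subsetI)
      fix z :: complex assume "z \<in> ball 0 1"
      then obtain n where "inverse (real (Suc n)) < 1 - norm z"
        using reals_Archimedean [of "1 - norm z"] by auto
      then show "z \<in> (\<Union>n. cball 0 (1 - inverse (real (Suc n))))" by (intro UN_I [of n]) auto
    qed (auto intro: le_less_trans)
    then show "fsigma (ball (0::complex) 1)"
      unfolding fsigma_Union_compact by (intro exI [of _ "\<lambda>n. cball 0 (1 - inverse (real (Suc n)))"]) auto
  qed auto
  then show "inj_on (to_nat_on (disk_zeros B)) (disk_zeros B)"
    unfolding disk_zeros_def by (rule inj_on_to_nat_on)
next
  fix p assume "p \<in> (SIGMA j:J. {..<m j})"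
  then have j: "fst p \<in> J" by auto
  have "0 < level (s (fst p))" using level_s [OF j] \<omega>_in [OF j] by simp
  then show "0 < s (fst p)" by simp
next
  fix t :: real and p assume "p \<in> (SIGMA j:J. {..<m j})" "0 < t"
  then have j: "fst p \<in> J" by auto
  show "connected_component (sublevel B (level t)) (\<omega> (fst p)) (\<omega> (fst p)) \<longleftrightarrow> s (fst p) < t"
    using \<omega>_in(1) [OF j] level_s [OF j] level_less_iff [of "s (fst p)" t]
    by (simp add: connected_component_refl_eq sublevel_def)
next
  fix t :: real and x assume t: "0 < t" and "connected_component (sublevel B (level t)) x x"
  then have x: "x \<in> sublevel B (level t)" by (simp add: connected_component_refl_eq)
  define C where "C = connected_component_set (sublevel B (level t)) x"
  note comp = card_zeros_component [OF t x, folded C_def]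
  have zeros: "{z \<in> disk_zeros B. connected_component (sublevel B (level t)) x z} = {z \<in> C. B z = 0}"
    using comp(1) by (auto simp: disk_zeros_def C_def)
  then show "finite {z \<in> disk_zeros B. connected_component (sublevel B (level t)) x z}" using comp(2) by simp
  let ?J = "{j \<in> J. \<omega> j \<in> C}"
  have crits: "{z \<in> C. deriv B z = 0 \<and> B z \<noteq> 0} = \<omega> ` ?J"
  proof
    show "{z \<in> C. deriv B z = 0 \<and> B z \<noteq> 0} \<subseteq> \<omega> ` ?J"
    proof
      fix z assume z: "z \<in> {z \<in> C. deriv B z = 0 \<and> B z \<noteq> 0}"
      then have "z \<in> \<omega> ` J"
        using bij_betw_imp_surj_on [OF bij_\<omega>] comp(1) by (auto simp: disk_zeros_def)
      then show "z \<in> \<omega> ` ?J" using z by blast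
    qed
  qed (use \<omega>_in in auto)
  have inj: "inj_on \<omega> ?J" by (rule inj_on_subset [OF bij_betw_imp_inj_on [OF bij_\<omega>]]) auto
  have finJ: "finite ?J" using comp(4) finite_imageD [OF _ inj] unfolding crits by blast
  have pts: "{p \<in> SIGMA j:J. {..<m j}. connected_component (sublevel B (level t)) x (\<omega> (fst p))} = (SIGMA j:?J. {..<m j})"
    by (auto simp: C_def)
  then show "finite {p \<in> SIGMA j:J. {..<m j}. connected_component (sublevel B (level t)) x (\<omega> (fst p))}"
    using finJ by simp
  have "int (card {z \<in> C. B z = 0}) = 1 + (\<Sum>j\<in>?J. zorder (deriv B) (\<omega> j))"
    using comp(5) unfolding crits sum.reindex [OF inj] by simp
  also have "\<dots> = int (Suc (\<Sum>j\<in>?J. m j))" by (simp add: zorder_deriv_\<omega>)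
  finally have "card {z \<in> C. B z = 0} = Suc (\<Sum>j\<in>?J. m j)" by (simp only: of_nat_eq_iff)
  then show "card {z \<in> disk_zeros B. connected_component (sublevel B (level t)) x z} =
      Suc (card {p \<in> SIGMA j:J. {..<m j}. connected_component (sublevel B (level t)) x (\<omega> (fst p))})"
    unfolding zeros pts using finJ by simp
qed

lemma sublevel_merging_blaschke:
  assumes "field F"
  shows "sublevel_merging (\<lambda>t. connected_component (sublevel B (level t))) (disk_zeros B) (to_nat_on (disk_zeros B)) J m
    (\<lambda>p. \<omega> (fst p)) s F B"
  unfolding sublevel_merging_def
  by (intro merging_chains.intro merging_chains_axioms.intro merging_sublevels assms open_sublevel_B) (rule refl)

end

theorem theoremA:
  fixes F :: "('f, 'r) ring_scheme"
    and B :: "complex \<Rightarrow> complex"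
    and J :: "nat set"
    and \<omega> :: "nat \<Rightarrow> complex"
    and m :: "nat \<Rightarrow> nat"
    and s :: "nat \<Rightarrow> real"
  assumes "field F"
    and "blaschke_product B"
    and "\<not> B constant_on ball 0 1"
    and "property_B B"
    and "bij_betw \<omega> J (disk_zeros (deriv B) - disk_zeros B)"
    and "\<And>j. j \<in> J \<Longrightarrow> (\<forall>k\<in>{1..m j}. (deriv ^^ k) B (\<omega> j) = 0) \<and>
                      (deriv ^^ (m j + 1)) B (\<omega> j) \<noteq> 0"
    and "\<And>j. j \<in> J \<Longrightarrow> s j = ln ((1 + norm (B (\<omega> j))) / (1 - norm (B (\<omega> j))))"
  shows "persistence_isomorphic F (inner_persistence F B)
    (persistence_sum (interval_persistence F {0<..})
      (persistence_dsum J (\<lambda>j. persistence_power (m j) (interval_persistence F {0<..s j}))))"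
  using sublevel_merging.inner_persistence_isomorphic [OF sublevel_merging_blaschke [OF assms(2-7) assms(1)]] .

end
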